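(* There are a constant $K_0$ and an infinite sequence $\{\Gamma_n\}_{n\ge 1}$ of unknotted closed $C^\infty$-curves of length $L_n=1$ embedded in $\mathbb{R}^3$, each with pointwise curvature everywhere bounded above by $K_0$ (with $K_0$ independent of $n$), such that for every $n$ any embedded disk spanning $\Gamma_n$ has area $$A \ge n.$$
   Context: A closed embedded curve in $\mathbb{R}^3$ is unknotted if it is the boundary of an embedded disk in $\mathbb{R}^3$. The curvature of a $C^2$-curve with arclength parametrization $\gamma$ is $\kappa(t)=\|\gamma''(t)\|$. A disk spans a closed curve if its boundary is that curve; embedded disks are understood to be piecewise-smooth embedded disks in $\mathbb{R}^3$. *)

theory Defs
  imports "HOL-Analysis.Analysis"
begin

(* C^k on an open set, by iterated directional derivatives. *)
primrec Ck_on :: "nat \<Rightarrow> 'a::real_normed_vector set \<Rightarrow> ('a \<Rightarrow> 'b::real_normed_vector) \<Rightarrow> bool" where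
  "Ck_on 0 U f \<longleftrightarrow> continuous_on U f"
| "Ck_on (Suc k) U f \<longleftrightarrow>
     (\<forall>x\<in>U. f differentiable (at x)) \<and> (\<forall>v. Ck_on k U (\<lambda>x. frechet_derivative f (at x) v))"

definition Cinf_on :: "'a::real_normed_vector set \<Rightarrow> ('a \<Rightarrow> 'b::real_normed_vector) \<Rightarrow> bool" where
  "Cinf_on U f \<longleftrightarrow> (\<forall>k. Ck_on k U f)"

(* The curve itself is the set range \<gamma>; L is the period of the arclength parameter. *)
definition arclength_closed_curve :: "(real \<Rightarrow> real^3) \<Rightarrow> real \<Rightarrow> bool" where
  "arclength_closed_curve \<gamma> L \<longleftrightarrow>
     L > 0 \<and> Cinf_on UNIV \<gamma> \<and> (\<forall>t. \<gamma> (t + L) = \<gamma> t) \<and> inj_on \<gamma> {0..<L} \<and>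
     (\<forall>t. norm (vector_derivative \<gamma> (at t)) = 1)"

definition curve_length :: "(real \<Rightarrow> real^3) \<Rightarrow> real \<Rightarrow> real" where
  "curve_length \<gamma> L = integral {0..L} (\<lambda>t. norm (vector_derivative \<gamma> (at t)))"

definition curvature :: "(real \<Rightarrow> real^3) \<Rightarrow> real \<Rightarrow> real" where
  "curvature \<gamma> t = norm (vector_derivative (\<lambda>s. vector_derivative \<gamma> (at s)) (at t))"

(* A piecewise-smooth embedded disk is given by a parametrization f of a triangulated
   topological disk in the plane: an embedding that is a smooth immersion on each closed
   triangle, i.e. extends near the triangle to a smooth map with injective derivative on it.
   The disk is the set f ` \<Union>\<T>. *)
definition ps_embedded_disk :: "(real^2) set set \<Rightarrow> (real^2 \<Rightarrow> real^3) \<Rightarrow> bool" where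
  "ps_embedded_disk \<T> f \<longleftrightarrow>
     triangulation \<T> \<and> (\<forall>T\<in>\<T>. 2 simplex T) \<and> \<Union>\<T> homeomorphic cball (0::real^2) 1 \<and>
     continuous_on (\<Union>\<T>) f \<and> inj_on f (\<Union>\<T>) \<and>
     (\<forall>T\<in>\<T>. \<exists>U g. open U \<and> T \<subseteq> U \<and> Cinf_on U g \<and>
        (\<forall>x\<in>T. g x = f x \<and> inj (frechet_derivative g (at x))))"

(* By invariance of domain, the boundary circle of a topological disk in the plane is its
   frontier. *)
definition disk_boundary :: "(real^2) set set \<Rightarrow> (real^2 \<Rightarrow> real^3) \<Rightarrow> (real^3) set" where
  "disk_boundary \<T> f = f ` frontier (\<Union>\<T>)"

definition spans :: "(real^2) set set \<Rightarrow> (real^2 \<Rightarrow> real^3) \<Rightarrow> (real^3) set \<Rightarrow> bool" where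
  "spans \<T> f \<Gamma> \<longleftrightarrow> ps_embedded_disk \<T> f \<and> disk_boundary \<T> f = \<Gamma>"

(* The derivative of f may fail to exist only on the edges of the triangles, a null set. *)
definition disk_area :: "(real^2) set set \<Rightarrow> (real^2 \<Rightarrow> real^3) \<Rightarrow> real" where
  "disk_area \<T> f = integral (\<Union>\<T>)
     (\<lambda>x. norm (cross3 (frechet_derivative f (at x) (axis 1 1))
                       (frechet_derivative f (at x) (axis 2 1))))"

definition unknotted :: "(real^3) set \<Rightarrow> bool" where
  "unknotted \<Gamma> \<longleftrightarrow> (\<exists>\<T> f. spans \<T> f \<Gamma>)"

end

theory Submission
  imports Defs
begin

text \<open>
  View \<open>\<real>\<^sup>3\<close> as the unit sphere of \<open>\<complex>\<^sup>2\<close> minus a point, with coordinates \<open>z1, z2\<close>. The curve is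
  the zero set of \<open>FF = ww\<^sup>2 + \<kappa> e\<^bsup>i\<pi>/4\<^esup> z1\<close>, where \<open>ww\<close> is \<open>z2\<close> rotated by an angle \<open>psi (Re z1)\<close>
  that increases by \<open>4\<pi>n\<close> over a short stretch. Geometrically it runs twice along a circle,
  the two strands being \<open>2d\<close> apart, and on that stretch they wind around each other \<open>2n\<close> times;
  since \<open>d\<close> is of order \<open>n\<^sup>-\<^sup>2\<close>, the curvature stays bounded. Away from the stretch the strands
  are spread apart vertically to distance of order one, and two families of straight lines
  pass between them.

  A spanning disk lifts to disjoint translates \<open>E\<^sub>j\<close> of a properly embedded plane in the
  infinite cyclic cover of the complement, which is \<open>\<real> \<times> \<complex>\<close> minus the orbit of a base point, via
  the argument of \<open>FF\<close> and the scale-invariant quantity \<open>zeta\<close>. At least \<open>2n\<close> of the translates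
  separate the base points \<open>0\<close> and \<open>2n\<close>. The lift of a line of the first family, closed up near
  the base point, winds nontrivially around the closed curve \<open>hh = 0\<close> that lifts a line of the
  second family, so a translate that missed both lifts would contradict the existence of a logarithm of \<open>hh\<close> on
  the simply connected side of \<open>E\<^sub>j\<close>. Hence for each pair of lines the disk has at least \<open>2n\<close>
  intersections with their union. One of the two families therefore consists of lines that all meet the disk
  at least \<open>n\<close> times, and projecting along it bounds the area from below by a multiple of \<open>n\<close>.
\<close>

text \<open>The construction rests on a scaling: in the variables \<open>z1\<close> and
  \<open>ww\<close> the function \<open>FF\<close> is homogeneous with weights 2 and 1. The argument
  of \<open>FF\<close> and the ratio \<open>zeta\<close> are invariants of this scaling, and each
  orbit meets the unit sphere once. Hence they turn the complement of the curve into a circle times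
  a plane minus one point, which stands for infinity, and unrolling the circle gives the cover
  explicitly. The obstacle is that the disk is arbitrary: it may touch a line or meet it infinitely
  often, so no intersection numbers are at hand. What is counted instead is the translates that are
  hit; distinct translates give distinct points of the disk. A small \<open>d\<close> bounds the
  curvature, but a gap of width \<open>d\<close> admits few lines; stretching heights by about 1/d
  makes the cross-section of both families independent of n. The phase pi/4 keeps the two strands on
  opposite sides of the plane z = 0 over both coordinate axes. Along the first axis the argument of
  \<open>FF\<close> drops by about 8 pi n and returns; the lifted second axis is placed halfway, at
  index 2n, so that both passages wind around it, and with the same sign.\<close>

section \<open>Calculus of smooth functions\<close>

lemma frechet_derivative_eqI:
  "(f has_derivative f') (at x) \<Longrightarrow> frechet_derivative f (at x) = f'"
  by (rule frechet_derivative_at[symmetric])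

lemma frechet_derivative_cong_open:
  assumes "open U" "x \<in> U" "\<And>y. y \<in> U \<Longrightarrow> f y = g y"
  shows "f differentiable (at x) \<longleftrightarrow> g differentiable (at x)"
    "frechet_derivative f (at x) = frechet_derivative g (at x)"
proof -
  have *: "(f has_derivative D) (at x) \<longleftrightarrow> (g has_derivative D) (at x)" for D
    using assms has_derivative_transform_within_open[OF _ assms(1,2)] by metis
  then show "f differentiable (at x) \<longleftrightarrow> g differentiable (at x)" by (simp add: differentiable_def)
  show "frechet_derivative f (at x) = frechet_derivative g (at x)"
    by (simp add: frechet_derivative_def *)
qed

lemma Ck_on_cong:
  assumes "open U" "\<And>x. x \<in> U \<Longrightarrow> f x = g x" "Ck_on k U f"
  shows "Ck_on k U g"
  using assms
proof (induction k arbitrary: f g)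
  case 0 then show ?case using continuous_on_cong[of U U f g] by simp
next
  case (Suc k)
  have fg: "\<And>x. x \<in> U \<Longrightarrow> g differentiable (at x)"
    "\<And>x. x \<in> U \<Longrightarrow> frechet_derivative f (at x) = frechet_derivative g (at x)"
    using frechet_derivative_cong_open[OF Suc.prems(1) _ Suc.prems(2)] Suc.prems(3) by auto
  have "Ck_on k U (\<lambda>x. frechet_derivative g (at x) v)" for v
  proof (rule Suc.IH[OF Suc.prems(1)])
    show "Ck_on k U (\<lambda>x. frechet_derivative f (at x) v)" using Suc.prems(3) by simp
  qed (simp add: fg)
  then show ?case using fg by simp
qed

text \<open>Lets any known formula for the derivative stand in for
  \<open>frechet_derivative\<close>, which is the form needed in inductions on the order of
  smoothness.\<close>

lemma Ck_on_SucI: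
  assumes U: "open U" and der: "\<And>x. x \<in> U \<Longrightarrow> (f has_derivative f' x) (at x)"
    and Ck: "\<And>v. Ck_on k U (\<lambda>x. f' x v)"
  shows "Ck_on (Suc k) U f"
proof -
  have "Ck_on k U (\<lambda>x. frechet_derivative f (at x) v)" for v
    by (rule Ck_on_cong[OF U _ Ck[of v]]) (simp add: frechet_derivative_eqI[OF der])
  then show ?thesis using der by (auto simp: differentiable_def)
qed

lemma Ck_on_mono: "Ck_on (Suc k) U f \<Longrightarrow> Ck_on k U f"
proof (induction k arbitrary: f)
  case 0
  then show ?case
    by (auto intro!: continuous_at_imp_continuous_on differentiable_imp_continuous_within)
next
  case (Suc k)
  have *: "\<forall>x\<in>U. f differentiable at x" "\<forall>v. Ck_on (Suc k) U (\<lambda>x. frechet_derivative f (at x) v)"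
    using Suc.prems by (subst (asm) Ck_on.simps(2), blast)+
  have "\<forall>v. Ck_on k U (\<lambda>x. frechet_derivative f (at x) v)" using *(2) Suc.IH by blast
  then show ?case using *(1) by (subst Ck_on.simps(2)) blast
qed

lemma Ck_on_subset: "Ck_on k U f \<Longrightarrow> V \<subseteq> U \<Longrightarrow> Ck_on k V f"
proof (induction k arbitrary: f)
  case 0 then show ?case using continuous_on_subset by auto
next
  case (Suc k) then show ?case by (auto simp: subset_eq)
qed

lemma Ck_on_derivative: "Ck_on (Suc k) U f \<Longrightarrow> x \<in> U \<Longrightarrow> (f has_derivative frechet_derivative f (at x)) (at x)"
  by (simp add: frechet_derivative_works)

lemma Ck_on_const: "open U \<Longrightarrow> Ck_on k U (\<lambda>x. c)"
proof (induction k arbitrary: c)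
  case (Suc k)
  then show ?case by (intro Ck_on_SucI[where f'="\<lambda>x v. 0"]) auto
qed simp

lemma Ck_on_bounded_linear:
  assumes "bounded_linear h" "open U"
  shows "Ck_on k U h"
proof (cases k)
  case 0 then show ?thesis using assms by (simp add: linear_continuous_on)
next
  case (Suc j)
  have "Ck_on (Suc j) U h"
    by (rule Ck_on_SucI[OF assms(2), where f'="\<lambda>x. h"])
       (rule bounded_linear_imp_has_derivative[OF assms(1)], rule Ck_on_const[OF assms(2)])
  then show ?thesis by (simp only: Suc)
qed

lemma Ck_on_add: "open U \<Longrightarrow> Ck_on k U f \<Longrightarrow> Ck_on k U g \<Longrightarrow> Ck_on k U (\<lambda>x. f x + g x)"
proof (induction k arbitrary: f g)
  case 0 then show ?case by (auto intro: continuous_on_add)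
next
  case (Suc k)
  show ?case
  proof (rule Ck_on_SucI[OF Suc.prems(1)])
    fix x assume "x \<in> U"
    then show "((\<lambda>x. f x + g x) has_derivative (\<lambda>v. frechet_derivative f (at x) v + frechet_derivative g (at x) v)) (at x)"
      using Ck_on_derivative[OF Suc.prems(2)] Ck_on_derivative[OF Suc.prems(3)]
      by (intro has_derivative_add) simp_all
  qed (use Suc in auto)
qed

text \<open>One induction serves products, scalar multiples and inner products: the product rule
  leaves two terms of the same bilinear shape.\<close>

lemma Ck_on_bilinear:
  assumes "bounded_bilinear h"
  shows "open U \<Longrightarrow> Ck_on k U f \<Longrightarrow> Ck_on k U g \<Longrightarrow> Ck_on k U (\<lambda>x. h (f x) (g x))"
proof (induction k arbitrary: f g)
  case 0 then show ?case using assms by (auto intro: bounded_bilinear.continuous_on)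
next
  case (Suc k)
  show ?case
  proof (rule Ck_on_SucI[OF Suc.prems(1)])
    fix x assume "x \<in> U"
    then show "((\<lambda>x. h (f x) (g x)) has_derivative (\<lambda>v. h (f x) (frechet_derivative g (at x) v) + h (frechet_derivative f (at x) v) (g x))) (at x)"
      using Ck_on_derivative[OF Suc.prems(2)] Ck_on_derivative[OF Suc.prems(3)]
      by (intro bounded_bilinear.FDERIV[OF assms]) simp_all
  next
    fix v
    show "Ck_on k U (\<lambda>x. h (f x) (frechet_derivative g (at x) v) + h (frechet_derivative f (at x) v) (g x))"
      using Suc.prems Ck_on_mono[OF Suc.prems(2)] Ck_on_mono[OF Suc.prems(3)]
      by (intro Ck_on_add Suc.IH) auto
  qed
qed

lemma Ck_on_sum:
  "open U \<Longrightarrow> (\<And>i. i \<in> I \<Longrightarrow> Ck_on k U (f i)) \<Longrightarrow> Ck_on k U (\<lambda>x. \<Sum>i\<in>I. f i x)"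
  by (induction I rule: infinite_finite_induct) (auto intro: Ck_on_const Ck_on_add)

lemma linear_sum_Basis:
  fixes h :: "'a::euclidean_space \<Rightarrow> 'b::real_vector"
  assumes "linear h" shows "h w = (\<Sum>b\<in>Basis. (w \<bullet> b) *\<^sub>R h b)"
proof -
  have "h w = h (\<Sum>b\<in>Basis. (w \<bullet> b) *\<^sub>R b)" by (simp add: euclidean_representation)
  also have "\<dots> = (\<Sum>b\<in>Basis. (w \<bullet> b) *\<^sub>R h b)"
    using assms by (simp add: linear_sum linear_cmul)
  finally show ?thesis .
qed

text \<open>The chain rule evaluates the derivative of f in a direction that varies with x, whereas
  \<open>Ck_on\<close> speaks of fixed directions only. Expanding that direction in the basis turns
  the derivative into a finite sum of products, each covered by the induction hypothesis.\<close>

lemma Ck_on_compose: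
  fixes f :: "'b::euclidean_space \<Rightarrow> 'c::real_normed_vector" and g :: "'a::real_normed_vector \<Rightarrow> 'b"
  shows "open U \<Longrightarrow> open V \<Longrightarrow> Ck_on k V f \<Longrightarrow> Ck_on k U g \<Longrightarrow> g ` U \<subseteq> V \<Longrightarrow> Ck_on k U (\<lambda>x. f (g x))"
proof (induction k arbitrary: f)
  case 0 then show ?case by (auto intro: continuous_on_compose2)
next
  case (Suc k)
  show ?case
  proof (rule Ck_on_SucI[OF Suc.prems(1)])
    fix x assume x: "x \<in> U"
    then have gx: "g x \<in> V" using Suc.prems by blast
    have df: "(f has_derivative frechet_derivative f (at (g x))) (at (g x))"
      using Ck_on_derivative[OF Suc.prems(3) gx] .
    have lin: "linear (frechet_derivative f (at (g x)))"
      using df has_derivative_linear by blast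
    have "((\<lambda>x. f (g x)) has_derivative (\<lambda>v. frechet_derivative f (at (g x)) (frechet_derivative g (at x) v))) (at x)"
      using has_derivative_compose[OF Ck_on_derivative[OF Suc.prems(4) x] df] .
    then show "((\<lambda>x. f (g x)) has_derivative (\<lambda>v. \<Sum>b\<in>Basis. (frechet_derivative g (at x) v \<bullet> b) *\<^sub>R frechet_derivative f (at (g x)) b)) (at x)"
      by (subst linear_sum_Basis[OF lin, symmetric])
  next
    fix v
    show "Ck_on k U (\<lambda>x. \<Sum>b\<in>Basis. (frechet_derivative g (at x) v \<bullet> b) *\<^sub>R frechet_derivative f (at (g x)) b)"
    proof (intro Ck_on_sum Suc.prems(1) Ck_on_bilinear[OF bounded_bilinear_scaleR])
      fix b :: 'b
      show "Ck_on k U (\<lambda>x. frechet_derivative g (at x) v \<bullet> b)"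
        using Suc.prems by (intro Ck_on_bilinear[OF bounded_bilinear_inner] Ck_on_const) auto
      show "Ck_on k U (\<lambda>x. frechet_derivative f (at (g x)) b)"
        using Suc.prems Ck_on_mono[OF Suc.prems(4)] by (intro Suc.IH[of "\<lambda>y. frechet_derivative f (at y) b"]) auto
    qed
  qed
qed

lemma Ck_on_SucI_real:
  fixes f :: "real \<Rightarrow> real"
  assumes U: "open U" and der: "\<And>x. x \<in> U \<Longrightarrow> (f has_real_derivative f' x) (at x)"
    and Ck: "Ck_on k U f'"
  shows "Ck_on (Suc k) U f"
proof (rule Ck_on_SucI[OF U])
  show "(f has_derivative (\<lambda>v. f' x * v)) (at x)" if "x \<in> U" for x
    using der[OF that] by (simp add: has_field_derivative_def)
  show "Ck_on k U (\<lambda>x. f' x * v)" for v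
    by (intro Ck_on_bilinear[OF bounded_bilinear_mult] U Ck Ck_on_const)
qed

lemma Cinf_onI: "(\<And>k. Ck_on k U f) \<Longrightarrow> Cinf_on U f" by (simp add: Cinf_on_def)
lemma Cinf_onD: "Cinf_on U f \<Longrightarrow> Ck_on k U f" by (simp add: Cinf_on_def)

lemma Cinf_on_differentiable: "Cinf_on U f \<Longrightarrow> x \<in> U \<Longrightarrow> f differentiable (at x)"
  using Cinf_onD[of U f "Suc 0"] by simp

lemma Cinf_on_continuous: "Cinf_on U f \<Longrightarrow> continuous_on U f"
  using Cinf_onD[of U f 0] by simp

lemma Cinf_on_const: "open U \<Longrightarrow> Cinf_on U (\<lambda>x. c)"
  by (simp add: Cinf_on_def Ck_on_const)

lemma Cinf_on_bounded_linear: "bounded_linear h \<Longrightarrow> open U \<Longrightarrow> Cinf_on U h"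
  by (simp add: Cinf_on_def Ck_on_bounded_linear)

lemma Cinf_on_id: "open U \<Longrightarrow> Cinf_on U (\<lambda>x. x)"
  by (rule Cinf_on_bounded_linear) (auto simp: bounded_linear_ident)

lemma Cinf_on_add: "open U \<Longrightarrow> Cinf_on U f \<Longrightarrow> Cinf_on U g \<Longrightarrow> Cinf_on U (\<lambda>x. f x + g x)"
  by (simp add: Cinf_on_def Ck_on_add)

lemma Cinf_on_scaleR:
  "open U \<Longrightarrow> Cinf_on U f \<Longrightarrow> Cinf_on U g \<Longrightarrow> Cinf_on U (\<lambda>x. f x *\<^sub>R g x)"
  by (simp add: Cinf_on_def Ck_on_bilinear[OF bounded_bilinear_scaleR])

lemma Cinf_on_inner:
  "open U \<Longrightarrow> Cinf_on U f \<Longrightarrow> Cinf_on U g \<Longrightarrow> Cinf_on U (\<lambda>x. f x \<bullet> g x)"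
  by (simp add: Cinf_on_def Ck_on_bilinear[OF bounded_bilinear_inner])

lemma Cinf_on_mult:
  fixes f g :: "_ \<Rightarrow> real"
  shows "open U \<Longrightarrow> Cinf_on U f \<Longrightarrow> Cinf_on U g \<Longrightarrow> Cinf_on U (\<lambda>x. f x * g x)"
  by (simp add: Cinf_on_def Ck_on_bilinear[OF bounded_bilinear_mult])

lemma Cinf_on_minus: "open U \<Longrightarrow> Cinf_on U f \<Longrightarrow> Cinf_on U (\<lambda>x. - f x)"
  using Cinf_on_scaleR[of U "\<lambda>x. -1" f] Cinf_on_const by fastforce

lemma Cinf_on_diff: "open U \<Longrightarrow> Cinf_on U f \<Longrightarrow> Cinf_on U g \<Longrightarrow> Cinf_on U (\<lambda>x. f x - g x)"
  using Cinf_on_add[of U f "\<lambda>x. - g x"] Cinf_on_minus by fastforce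

lemma Cinf_on_power:
  fixes f :: "_ \<Rightarrow> real"
  shows "open U \<Longrightarrow> Cinf_on U f \<Longrightarrow> Cinf_on U (\<lambda>x. f x ^ n)"
  by (induction n) (auto intro: Cinf_on_const Cinf_on_mult)

lemma Cinf_on_sum:
  "open U \<Longrightarrow> (\<And>i. i \<in> I \<Longrightarrow> Cinf_on U (f i)) \<Longrightarrow> Cinf_on U (\<lambda>x. \<Sum>i\<in>I. f i x)"
  by (simp add: Cinf_on_def Ck_on_sum)

lemma Cinf_on_compose:
  fixes f :: "'b::euclidean_space \<Rightarrow> 'c::real_normed_vector"
  shows "Cinf_on V f \<Longrightarrow> open U \<Longrightarrow> open V \<Longrightarrow> Cinf_on U g \<Longrightarrow> (\<And>x. x \<in> U \<Longrightarrow> g x \<in> V) \<Longrightarrow> Cinf_on U (\<lambda>x. f (g x))"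
  unfolding Cinf_on_def by (blast intro: Ck_on_compose)

lemma Cinf_on_subset: "Cinf_on U f \<Longrightarrow> V \<subseteq> U \<Longrightarrow> Cinf_on V f"
  unfolding Cinf_on_def using Ck_on_subset by blast

lemma Cinf_on_vec_nth: "open U \<Longrightarrow> Cinf_on U f \<Longrightarrow> Cinf_on U (\<lambda>x. (f x :: real^'n) $ i)"
  using Cinf_on_compose[of UNIV "\<lambda>x::real^'n. x $ i" U f] Cinf_on_bounded_linear[OF bounded_linear_vec_nth]
  by auto

lemma Cinf_on_vec:
  fixes f :: "'a::real_normed_vector \<Rightarrow> real^'n"
  assumes "open U" "\<And>i. Cinf_on U (\<lambda>x. f x $ i)"
  shows "Cinf_on U f"
proof -
  have "Cinf_on U (\<lambda>x. \<Sum>i\<in>UNIV. (f x $ i) *\<^sub>R axis i (1::real))"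
    using assms by (intro Cinf_on_sum Cinf_on_scaleR Cinf_on_const) auto
  moreover have "f x = (\<Sum>i\<in>UNIV. (f x $ i) *\<^sub>R axis i (1::real))" for x
    using basis_expansion[of "f x"] by (simp add: scalar_mult_eq_scaleR)
  ultimately show ?thesis by simp
qed

text \<open>The derivative is a polynomial in the function itself, so the induction feeds on its own
  hypothesis.\<close>

lemma Ck_on_inverse: "Ck_on k {x::real. x \<noteq> 0} inverse"
proof (induction k)
  case 0 then show ?case by (auto intro!: continuous_intros)
next
  case (Suc k)
  have op: "open {x::real. x \<noteq> 0}" by (simp add: open_Collect_neq)
  show ?case
  proof (rule Ck_on_SucI_real[OF op])
    show "(inverse has_real_derivative (- 1) * (inverse x * inverse x)) (at x)" if "x \<in> {x. x \<noteq> 0}" for x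
      using that DERIV_inverse[of x UNIV] by (simp add: power2_eq_square)
    show "Ck_on k {x::real. x \<noteq> 0} (\<lambda>x. (- 1) * (inverse x * inverse x))"
      by (intro Ck_on_bilinear[OF bounded_bilinear_mult] op Ck_on_const Suc)
  qed
qed

lemma Ck_on_sqrt: "Ck_on k {x::real. x > 0} sqrt"
proof (induction k)
  case 0 then show ?case by (auto intro!: continuous_intros)
next
  case (Suc k)
  have op: "open {x::real. x > 0}" "open {x::real. x \<noteq> 0}" by (auto simp: open_Collect_neq open_Collect_less)
  show ?case
  proof (rule Ck_on_SucI_real[OF op(1)])
    show "(sqrt has_real_derivative inverse (sqrt x) * (1/2)) (at x)" if "x \<in> {x. x > 0}" for x
      using that DERIV_real_sqrt[of x] by simp
    show "Ck_on k {x::real. x > 0} (\<lambda>x. inverse (sqrt x) * (1/2))"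
      by (intro Ck_on_bilinear[OF bounded_bilinear_mult] op Ck_on_const
         Ck_on_compose[OF op(1) op(2) Ck_on_inverse Suc]) auto
  qed
qed

lemma Ck_on_sin_cos: "Ck_on k UNIV (sin :: real \<Rightarrow> real)" "Ck_on k UNIV (cos :: real \<Rightarrow> real)"
proof -
  have "Ck_on k UNIV (sin :: real \<Rightarrow> real) \<and> Ck_on k UNIV (cos :: real \<Rightarrow> real)"
  proof (induction k)
    case 0 then show ?case by (auto intro!: continuous_intros)
  next
    case (Suc k)
    have "Ck_on k UNIV (\<lambda>x. (- 1) * sin x :: real)"
      using Suc by (intro Ck_on_bilinear[OF bounded_bilinear_mult] Ck_on_const) auto
    then have ms: "Ck_on k UNIV (\<lambda>x. - sin x :: real)" by simp
    have "Ck_on (Suc k) UNIV (sin :: real \<Rightarrow> real)"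
      using Suc by (intro Ck_on_SucI_real[where f'=cos]) (auto intro!: derivative_eq_intros)
    moreover have "Ck_on (Suc k) UNIV (cos :: real \<Rightarrow> real)"
      using ms by (intro Ck_on_SucI_real[where f'="\<lambda>x. - sin x"]) (auto intro!: derivative_eq_intros)
    ultimately show ?case by (rule conjI)
  qed
  then show "Ck_on k UNIV (sin :: real \<Rightarrow> real)" "Ck_on k UNIV (cos :: real \<Rightarrow> real)" by auto
qed

lemma Cinf_on_divide:
  fixes f g :: "_ \<Rightarrow> real"
  assumes "open U" "Cinf_on U f" "Cinf_on U g" "\<And>x. x \<in> U \<Longrightarrow> g x \<noteq> 0"
  shows "Cinf_on U (\<lambda>x. f x / g x)"
proof -
  have "Cinf_on U (\<lambda>x. inverse (g x))"
  proof (rule Cinf_on_compose[of "{x. x \<noteq> 0}" inverse])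
    show "Cinf_on {x::real. x \<noteq> 0} inverse" by (rule Cinf_onI, rule Ck_on_inverse)
    show "open {x::real. x \<noteq> 0}" by (simp add: open_Collect_neq)
  qed (use assms in auto)
  then show ?thesis using Cinf_on_mult[OF assms(1,2)] by (simp add: divide_inverse)
qed

lemma Cinf_on_sqrt:
  fixes g :: "_ \<Rightarrow> real"
  assumes "open U" "Cinf_on U g" "\<And>x. x \<in> U \<Longrightarrow> g x > 0"
  shows "Cinf_on U (\<lambda>x. sqrt (g x))"
proof (rule Cinf_on_compose[of "{x. x > 0}" sqrt])
  show "Cinf_on {x::real. x > 0} sqrt" by (rule Cinf_onI, rule Ck_on_sqrt)
  show "open {x::real. x > 0}" by (simp add: open_Collect_less)
qed (use assms in auto)

lemma Cinf_on_sin: "open U \<Longrightarrow> Cinf_on U g \<Longrightarrow> Cinf_on U (\<lambda>x. sin (g x :: real))"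
  and Cinf_on_cos: "open U \<Longrightarrow> Cinf_on U g \<Longrightarrow> Cinf_on U (\<lambda>x. cos (g x :: real))"
  by (rule Cinf_on_compose[OF Cinf_onI[OF Ck_on_sin_cos(1)] _ open_UNIV], auto,
      rule Cinf_on_compose[OF Cinf_onI[OF Ck_on_sin_cos(2)] _ open_UNIV], auto)

lemmas Cinf_intros = Cinf_on_const Cinf_on_id Cinf_on_add Cinf_on_minus Cinf_on_diff Cinf_on_mult
  Cinf_on_power Cinf_on_divide Cinf_on_sqrt Cinf_on_sin Cinf_on_cos Cinf_on_vec_nth Cinf_on_scaleR Cinf_on_inner

section \<open>A smooth step function\<close>

text \<open>The powers of 1/x are carried along because the family is then closed under
  differentiation up to linear combinations; one induction proves all members smooth.\<close>

definition flat_exp :: "nat \<Rightarrow> real \<Rightarrow> real" where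
  "flat_exp m x = (if x > 0 then exp (- inverse x) * inverse x ^ m else 0)"

lemma flat_exp_limit: "((\<lambda>x. exp (- inverse x) * inverse x ^ m) \<longlongrightarrow> (0::real)) (at_right 0)"
proof -
  have "((\<lambda>y::real. y ^ m / exp y) \<longlongrightarrow> 0) at_top" by (rule tendsto_power_div_exp_0)
  then have "((\<lambda>x::real. inverse x ^ m / exp (inverse x)) \<longlongrightarrow> 0) (at_right 0)"
    by (rule filterlim_compose) (rule filterlim_inverse_at_top_right)
  then show ?thesis by (simp add: exp_minus field_simps)
qed

lemma flat_exp_derivative:
  "(flat_exp m has_real_derivative (flat_exp (m + 2) x + (- real m) * flat_exp (Suc m) x)) (at x)"
proof (cases "x = 0")
  case False
  show ?thesis
  proof (cases "x > 0")
    case True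
    have "((\<lambda>x. exp (- inverse x) * inverse x ^ m) has_real_derivative (flat_exp (m + 2) x + (- real m) * flat_exp (Suc m) x)) (at x)"
    proof (cases m)
      case 0
      then show ?thesis using True
        by (auto intro!: derivative_eq_intros simp: flat_exp_def power2_eq_square field_simps)
    next
      case (Suc j)
      have a: "((\<lambda>x. inverse x ^ m) has_real_derivative real m * (inverse x ^ j * (- (inverse x * inverse x)))) (at x)"
        using True DERIV_power[of inverse "- (inverse x * inverse x)" x UNIV m] DERIV_inverse[of x UNIV] Suc
        by (simp add: power2_eq_square ac_simps)
      have b: "((\<lambda>x. exp (- inverse x)) has_real_derivative exp (- inverse x) * (inverse x * inverse x)) (at x)"
        using True by (auto intro!: derivative_eq_intros simp: power2_eq_square)
      have "((\<lambda>x. exp (- inverse x) * inverse x ^ m) has_real_derivative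
        (exp (- inverse x) * (inverse x * inverse x)) * inverse x ^ m + real m * (inverse x ^ j * (- (inverse x * inverse x))) * exp (- inverse x)) (at x)"
        by (rule DERIV_mult[OF b a])
      then show ?thesis using True Suc
        by (auto elim!: DERIV_cong simp: flat_exp_def algebra_simps)
    qed
    then show ?thesis
      by (rule has_field_derivative_transform_within_open[of _ _ _ "{0<..}"]) (use True in \<open>auto simp: flat_exp_def\<close>)
  next
    case neg: False
    have "((\<lambda>x. 0) has_real_derivative 0) (at x)" by simp
    then have "(flat_exp m has_real_derivative 0) (at x)"
      by (rule has_field_derivative_transform_within_open[of _ _ _ "{..<0}"]) (use neg False in \<open>auto simp: flat_exp_def\<close>)
    then show ?thesis using neg by (simp add: flat_exp_def)
  qed
next
  case True
  \<comment> \<open>At the origin the difference quotient from the right is the next member of the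
    family, which tends to 0 there; from the left it vanishes.\<close>
  have "((\<lambda>y. flat_exp m y / y) \<longlongrightarrow> 0) (at 0)"
  proof -
    have "((\<lambda>y. flat_exp m y / y) \<longlongrightarrow> 0) (at_right 0)"
    proof (rule Lim_transform_eventually[OF flat_exp_limit[of "Suc m"]])
      show "\<forall>\<^sub>F x in at_right 0. exp (- inverse x) * inverse x ^ Suc m = flat_exp m x / x"
        by (auto simp: eventually_at_right_field flat_exp_def field_simps intro!: exI[of _ 1])
    qed
    moreover have "((\<lambda>y. flat_exp m y / y) \<longlongrightarrow> 0) (at_left 0)"
      by (rule Lim_transform_eventually[OF tendsto_const])
         (auto simp: eventually_at_left_field flat_exp_def intro!: exI[of _ "-1"])
    ultimately show ?thesis by (simp add: filterlim_at_split)
  qed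
  then have "(flat_exp m has_real_derivative 0) (at 0)"
    by (simp add: has_field_derivative_iff flat_exp_def)
  then show ?thesis using True by (simp add: flat_exp_def)
qed

lemma Cinf_on_flat_exp: "Cinf_on UNIV (flat_exp m)"
proof (rule Cinf_onI)
  fix k show "Ck_on k UNIV (flat_exp m)"
  proof (induction k arbitrary: m)
    case 0
    show ?case using flat_exp_derivative by (auto intro!: continuous_at_imp_continuous_on DERIV_isCont)
  next
    case (Suc k)
    show ?case
      by (rule Ck_on_SucI_real[OF open_UNIV flat_exp_derivative])
         (intro Ck_on_add Ck_on_bilinear[OF bounded_bilinear_mult] Ck_on_const open_UNIV Suc)
  qed
qed

text \<open>The quotient is smooth because x and 1 - x are never both nonpositive, so the
  denominator is positive.\<close>

definition stp :: "real \<Rightarrow> real" where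
  "stp x = flat_exp 0 x / (flat_exp 0 x + flat_exp 0 (1 - x))"

lemma flat_exp0: "flat_exp 0 x \<ge> 0" "x > 0 \<Longrightarrow> flat_exp 0 x > 0" "x \<le> 0 \<Longrightarrow> flat_exp 0 x = 0"
  by (auto simp: flat_exp_def)

lemma stp_den: "flat_exp 0 x + flat_exp 0 (1 - x) > 0"
  using flat_exp0(1)[of x] flat_exp0(1)[of "1 - x"] flat_exp0(2)[of x] flat_exp0(2)[of "1 - x"]
  by (cases "x > 0") (auto intro: add_pos_nonneg add_nonneg_pos)

lemma stp_0: "x \<le> 0 \<Longrightarrow> stp x = 0" by (simp add: stp_def flat_exp0)
lemma stp_1: "x \<ge> 1 \<Longrightarrow> stp x = 1" using stp_den[of x] flat_exp0(2)[of x] flat_exp0(3)[of "1 - x"] by (simp add: stp_def)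
lemma stp_bounds: "0 \<le> stp x" "stp x \<le> 1"
  using stp_den[of x] flat_exp0(1)[of x] flat_exp0(1)[of "1 - x"] by (auto simp: stp_def divide_simps)

lemma Cinf_on_stp: "Cinf_on UNIV stp"
proof -
  have "Cinf_on UNIV (\<lambda>x. flat_exp 0 (1 - x))"
    by (rule Cinf_on_compose[OF Cinf_on_flat_exp]) (auto intro!: Cinf_intros)
  then have "Cinf_on UNIV (\<lambda>x. flat_exp 0 x / (flat_exp 0 x + flat_exp 0 (1 - x)))"
    by (intro Cinf_on_divide Cinf_on_add Cinf_on_flat_exp open_UNIV less_imp_neq[OF stp_den, symmetric])
  then show ?thesis by (simp add: stp_def[abs_def])
qed

section \<open>Arclength reparametrization\<close>

lemma antiderivative_UNIV:
  fixes v :: "real \<Rightarrow> real"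
  assumes "continuous_on UNIV v"
  obtains S where "\<And>t. (S has_real_derivative v t) (at t)"
proof -
  define S where "S u = (LBINT y=0..u. v y)" for u :: real
  have "(S has_real_derivative v t) (at t)" for t
  proof -
    define a b where "a = - \<bar>t\<bar> - 1" and "b = \<bar>t\<bar> + 1"
    have "((\<lambda>u. LBINT y=0..u. v y) has_vector_derivative v t) (at t within {a..b})"
      by (rule interval_integral_FTC2[of a 0 b v t, unfolded zero_ereal_def[symmetric]])
         (auto simp: a_def b_def intro: continuous_on_subset[OF assms])
    moreover have "at t within {a..b} = at t"
      by (rule at_within_interior) (auto simp: a_def b_def)
    ultimately show ?thesis by (simp add: S_def[abs_def] has_real_derivative_iff_has_vector_derivative)
  qed
  then show thesis using that by blast
qed

lemma vector_derivative_frechet: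
  assumes "f differentiable (at t)"
  shows "vector_derivative f (at t) = frechet_derivative f (at t) 1"
proof -
  have "(f has_vector_derivative vector_derivative f (at t)) (at t)"
    using assms vector_derivative_works by blast
  then have "frechet_derivative f (at t) = (\<lambda>h. h *\<^sub>R vector_derivative f (at t))"
    unfolding has_vector_derivative_def by (rule frechet_derivative_at[symmetric])
  then show ?thesis by simp
qed

lemma Cinf_on_vector_derivative:
  assumes "Cinf_on UNIV f"
  shows "Cinf_on UNIV (\<lambda>t. vector_derivative f (at t))" "\<And>t. (f has_vector_derivative vector_derivative f (at t)) (at t)"
proof -
  have d: "f differentiable (at t)" for t using Cinf_on_differentiable[OF assms] by simp
  then show "\<And>t. (f has_vector_derivative vector_derivative f (at t)) (at t)"
    using vector_derivative_works by blast
  have "Ck_on k UNIV (\<lambda>t. frechet_derivative f (at t) 1)" for k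
    using Cinf_onD[OF assms, of "Suc k"] by simp
  then show "Cinf_on UNIV (\<lambda>t. vector_derivative f (at t))"
    by (simp add: vector_derivative_frechet[OF d] Cinf_on_def)
qed

text \<open>The curve is divided by its length l, which multiplies the curvature by l. The factor 2
  comes from a crude bound: the derivative of the unit tangent is a difference of two terms, each of
  norm at most |c''|/|c'|.\<close>

lemma arclength_reparametrization:
  fixes c :: "real \<Rightarrow> real^3"
  assumes c: "Cinf_on UNIV c" and P: "P > 0" and per: "\<And>t. c (t + P) = c t" and inj: "inj_on c {0..<P}"
    and m: "m > 0" "\<And>t. m \<le> norm (vector_derivative c (at t))"
    and M1: "\<And>t. norm (vector_derivative c (at t)) \<le> M1"
    and M2: "\<And>t. norm (vector_derivative (\<lambda>s. vector_derivative c (at s)) (at t)) \<le> M2"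
  obtains \<gamma> l where "P * m \<le> l" "l \<le> P * M1" "arclength_closed_curve \<gamma> 1"
    "range \<gamma> = (\<lambda>p. p /\<^sub>R l) ` range c" "\<And>u. curvature \<gamma> u \<le> 2 * l * M2 / m\<^sup>2"
proof -
  define c1 where "c1 t = vector_derivative c (at t)" for t
  define c2 where "c2 t = vector_derivative c1 (at t)" for t
  define v where "v t = norm (c1 t)" for t
  have c1C: "Cinf_on UNIV c1" and dc: "\<And>t. (c has_vector_derivative c1 t) (at t)"
    using Cinf_on_vector_derivative[OF c] unfolding c1_def by auto
  have dc1: "(c1 has_vector_derivative c2 t) (at t)" for t
    using Cinf_on_vector_derivative(2)[OF c1C] unfolding c2_def by auto
  have vm: "m \<le> v t" "v t > 0" "v t \<le> M1" for t
    using m(2)[of t] M1[of t] m(1) unfolding v_def c1_def by auto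
  have M2': "norm (c2 t) \<le> M2" for t
    using M2[of t] unfolding c2_def c1_def by simp
  have vC: "Cinf_on UNIV v"
  proof -
    have "Cinf_on UNIV (\<lambda>t. sqrt (c1 t \<bullet> c1 t))"
    proof (intro Cinf_on_sqrt Cinf_on_inner c1C open_UNIV)
      fix t show "c1 t \<bullet> c1 t > 0" using vm(2)[of t] by (auto simp: v_def)
    qed
    then show ?thesis by (simp add: v_def[abs_def] norm_eq_sqrt_inner)
  qed
  obtain S where S: "\<And>t. (S has_real_derivative v t) (at t)"
    using antiderivative_UNIV Cinf_on_continuous[OF vC] by blast
  have c1per: "c1 (t + P) = c1 t" for t
  proof -
    have "((\<lambda>s. s + P) has_vector_derivative 1) (at t)"
      by (auto simp flip: has_real_derivative_iff_has_vector_derivative intro!: derivative_eq_intros)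
    then have "((\<lambda>s. c (s + P)) has_vector_derivative c1 (t + P)) (at t)"
      using vector_diff_chain_at[of "\<lambda>s. s + P" 1 t c "c1 (t + P)"] dc[of "t + P"]
      by (simp add: o_def)
    then have "(c has_vector_derivative c1 (t + P)) (at t)" by (simp add: per)
    then show ?thesis using dc[of t] vector_derivative_unique_at by blast
  qed
  define l where "l = S P - S 0"
  have SP: "S (t + P) = S t + l" for t
  proof -
    have "((\<lambda>t. S (t + P) - S t) has_real_derivative 0) (at t)" for t
      using S[of "t + P"] S[of t] c1per[of t]
      by (auto intro!: derivative_eq_intros DERIV_shift[THEN iffD1] simp: v_def)
    then have "S (t + P) - S t = S (0 + P) - S 0"
      using DERIV_isconst_all by blast
    then show ?thesis by (simp add: l_def)
  qed
  have mono: "S a < S b" if "a < b" for a b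
    using DERIV_pos_imp_increasing[OF that, of S] S vm(2) by blast
  have Sb: "m * (b - a) \<le> S b - S a" "S b - S a \<le> M1 * (b - a)" if ab: "a < b" for a b
  proof -
    obtain z where "S b - S a = (b - a) * v z" using MVT2[OF ab, of S v] S by blast
    then show "m * (b - a) \<le> S b - S a" "S b - S a \<le> M1 * (b - a)"
      using vm(1)[of z] vm(3)[of z] ab by (auto simp: mult.commute mult_left_mono)
  qed
  have l: "P * m \<le> l" "l \<le> P * M1" using Sb[of 0 P] P by (auto simp: l_def mult.commute)
  have lpos: "l > 0" using l(1) P m(1) by (smt (verit) mult_pos_pos)
  have contS: "isCont S t" for t using S DERIV_isCont by blast
  have injS: "inj S" by (rule injI) (metis mono less_irrefl linorder_neqE)
  have surjS: "\<exists>t. S t = y" for y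
  proof -
    define a where "a = \<bar>y - S 0\<bar> / m + 1"
    have a: "a > 0" "m * a \<ge> \<bar>y - S 0\<bar>" using m(1) by (auto simp: a_def field_simps intro: add_nonneg_pos)
    have "S (-a) \<le> y" "y \<le> S a" using Sb(1)[of 0 a] Sb(1)[of "-a" 0] a by auto
    then show ?thesis using IVT[of S "-a" y a] contS a by auto
  qed
  \<comment> \<open>Inverse of the arclength function, rescaled so that one turn corresponds to an
    interval of length 1.\<close>
  define ph where "ph u = (THE t. S t = S 0 + l * u)" for u
  have ph: "S (ph u) = S 0 + l * u" for u
  proof -
    obtain t where t: "S t = S 0 + l * u" using surjS by blast
    show ?thesis unfolding ph_def by (rule theI[of _ t]) (use t injS in \<open>auto simp: inj_def\<close>)
  qed
  have phS: "ph u = t" if "S t = S 0 + l * u" for u t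
    using ph[of u] that injS by (metis injD)
  have ph0: "ph 0 = 0" "ph 1 = P" by (auto intro!: phS simp: l_def)
  have ph1: "ph (u + 1) = ph u + P" for u
    by (rule phS) (simp add: SP ph distrib_left)
  have phmono: "ph a < ph b" if "a < b" for a b
  proof (rule ccontr)
    assume "\<not> ph a < ph b"
    then have "S (ph b) \<le> S (ph a)" using mono by (metis not_less order_le_less)
    then show False using that lpos by (simp add: ph)
  qed
  have contph: "isCont ph u" for u
  proof -
    let ?f = "\<lambda>t. (S t - S 0) / l"
    have fin: "?f (ph w) = w" for w using ph lpos by simp
    have inv: "ph (?f t) = t" for t using lpos by (intro phS) simp
    have "isCont ph (?f (ph u))"
    proof (rule isCont_inverse_function2[of "ph u - 1" "ph u" "ph u + 1" ph ?f])
      show "ph (?f z) = z" for z by (rule inv)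
      show "isCont ?f z" for z using contS lpos by (intro continuous_intros) auto
    qed auto
    then show ?thesis by (simp add: fin)
  qed
  have dph: "(ph has_real_derivative l / v (ph u)) (at u)" for u
  proof -
    let ?f = "\<lambda>t. (S t - S 0) / l"
    have "(?f has_real_derivative v (ph u) / l) (at (ph u))"
      using S[of "ph u"] lpos by (auto intro!: derivative_eq_intros)
    then have "(ph has_real_derivative inverse (v (ph u) / l)) (at u)"
      by (rule DERIV_inverse_function[of _ _ _ _ "u - 1" "u + 1"])
         (use vm(2)[of "ph u"] lpos contph ph in \<open>auto simp: ph\<close>)
    then show ?thesis by simp
  qed
  \<comment> \<open>Bootstrapping: the derivative of \<open>ph\<close> is a smooth function of
    \<open>ph\<close>, so each order of smoothness yields the next.\<close>
  have phC: "Cinf_on UNIV ph"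
  proof (rule Cinf_onI)
    fix k show "Ck_on k UNIV ph"
    proof (induction k)
      case 0 then show ?case using contph continuous_at_imp_continuous_on by auto
    next
      case (Suc k)
      have "Cinf_on UNIV (\<lambda>t. l / v t)"
        using vm(2) by (intro Cinf_on_divide Cinf_on_const vC open_UNIV) (metis less_irrefl)
      then have "Ck_on k UNIV (\<lambda>u. l / v (ph u))"
        by (intro Ck_on_compose[of UNIV UNIV k "\<lambda>t. l / v t" ph] Suc Cinf_onD) auto
      then show ?case by (intro Ck_on_SucI_real[OF open_UNIV dph])
    qed
  qed
  define \<gamma> where "\<gamma> u = inverse l *\<^sub>R c (ph u)" for u
  define T where "T t = inverse (v t) *\<^sub>R c1 t" for t
  have d\<gamma>: "(\<gamma> has_vector_derivative T (ph u)) (at u)" for u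
  proof -
    have "((\<lambda>u. c (ph u)) has_vector_derivative (l / v (ph u)) *\<^sub>R c1 (ph u)) (at u)"
      using vector_diff_chain_at[of ph "l / v (ph u)" u c "c1 (ph u)"] dph[of u] dc[of "ph u"]
      by (simp add: o_def has_real_derivative_iff_has_vector_derivative)
    then have "(\<gamma> has_vector_derivative inverse l *\<^sub>R ((l / v (ph u)) *\<^sub>R c1 (ph u))) (at u)"
      unfolding \<gamma>_def by (intro bounded_linear.has_vector_derivative[OF bounded_linear_scaleR_right])
    moreover have "inverse l *\<^sub>R ((l / v (ph u)) *\<^sub>R c1 (ph u)) = T (ph u)"
      using lpos by (simp add: T_def field_simps)
    ultimately show ?thesis by simp
  qed
  have vd\<gamma>: "vector_derivative \<gamma> (at u) = T (ph u)" for u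
    using d\<gamma> vector_derivative_at by blast
  have nT: "norm (T t) = 1" for t using vm(2)[of t] by (simp add: T_def v_def)
  have dv: "(v has_real_derivative (c1 t \<bullet> c2 t) / v t) (at t)" for t
  proof -
    have "((\<lambda>t. sqrt (c1 t \<bullet> c1 t)) has_real_derivative (2 * (c1 t \<bullet> c2 t)) * (inverse (sqrt (c1 t \<bullet> c1 t)) / 2)) (at t)"
    proof (rule DERIV_chain2[where f=sqrt, THEN DERIV_cong])
      show "(sqrt has_real_derivative inverse (sqrt (c1 t \<bullet> c1 t)) / 2) (at (c1 t \<bullet> c1 t))"
        using vm(2)[of t] by (intro DERIV_real_sqrt) (auto simp: v_def)
      have "((\<lambda>t. c1 t \<bullet> c1 t) has_vector_derivative (c1 t \<bullet> c2 t + c2 t \<bullet> c1 t)) (at t)"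
        by (intro bounded_bilinear.has_vector_derivative[OF bounded_bilinear_inner] dc1)
      then show "((\<lambda>t. c1 t \<bullet> c1 t) has_real_derivative 2 * (c1 t \<bullet> c2 t)) (at t)"
        by (simp add: has_real_derivative_iff_has_vector_derivative inner_commute)
    qed (simp add: mult.commute)
    moreover have sv: "sqrt (c1 t \<bullet> c1 t) = v t" for t by (simp only: v_def norm_eq_sqrt_inner)
    moreover have "(\<lambda>t. sqrt (c1 t \<bullet> c1 t)) = v" by (rule ext) (rule sv)
    moreover have "(2 * (c1 t \<bullet> c2 t)) * (inverse (sqrt (c1 t \<bullet> c1 t)) / 2) = (c1 t \<bullet> c2 t) / v t"
    proof -
      have "(2 * a) * (inverse b / 2) = a / b" for a b :: real by (simp add: field_simps)
      then show ?thesis unfolding sv by blast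
    qed
    ultimately show ?thesis by metis
  qed
  \<comment> \<open>Derivative of the unit tangent \<open>T\<close>, by the quotient rule.\<close>
  define T' where "T' t = inverse (v t) *\<^sub>R c2 t - ((c1 t \<bullet> c2 t) / v t ^ 3) *\<^sub>R c1 t" for t
  have dT: "(T has_vector_derivative T' t) (at t)" for t
  proof -
    have "((\<lambda>t. inverse (v t)) has_real_derivative - ((c1 t \<bullet> c2 t) / v t) / (v t)\<^sup>2) (at t)"
      using DERIV_inverse_fun[OF dv[of t]] vm(2)[of t] by (simp add: power2_eq_square divide_inverse ac_simps)
    then have "((\<lambda>t. inverse (v t)) has_vector_derivative - ((c1 t \<bullet> c2 t) / v t) / (v t)\<^sup>2) (at t)"
      by (simp add: has_real_derivative_iff_has_vector_derivative)
    then have "(T has_vector_derivative (inverse (v t) *\<^sub>R c2 t + (- ((c1 t \<bullet> c2 t) / v t) / (v t)\<^sup>2) *\<^sub>R c1 t)) (at t)"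
      unfolding T_def by (intro bounded_bilinear.has_vector_derivative[OF bounded_bilinear_scaleR] dc1)
    moreover have "(inverse (v t) *\<^sub>R c2 t + (- ((c1 t \<bullet> c2 t) / v t) / (v t)\<^sup>2) *\<^sub>R c1 t) = T' t"
      by (simp add: T'_def power3_eq_cube power2_eq_square)
    ultimately show ?thesis by simp
  qed
  have nT': "norm (T' t) \<le> 2 * M2 / v t" for t
  proof -
    have "norm (T' t) \<le> norm (inverse (v t) *\<^sub>R c2 t) + norm (((c1 t \<bullet> c2 t) / v t ^ 3) *\<^sub>R c1 t)"
      unfolding T'_def by (rule norm_triangle_ineq4)
    also have "norm (inverse (v t) *\<^sub>R c2 t) = norm (c2 t) / v t"
      using vm(2)[of t] by (simp add: divide_inverse mult.commute)
    also have "norm (((c1 t \<bullet> c2 t) / v t ^ 3) *\<^sub>R c1 t) \<le> norm (c2 t) / v t"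
    proof -
      have "norm (((c1 t \<bullet> c2 t) / v t ^ 3) *\<^sub>R c1 t) = \<bar>c1 t \<bullet> c2 t\<bar> / v t ^ 3 * v t"
        using vm(2)[of t] by (simp add: v_def[symmetric])
      also have "\<dots> \<le> (v t * norm (c2 t)) / v t ^ 3 * v t"
        using vm(2)[of t] Cauchy_Schwarz_ineq2[of "c1 t" "c2 t"]
        by (intro mult_right_mono divide_right_mono) (auto simp: v_def)
      also have "\<dots> = norm (c2 t) / v t" using vm(2)[of t] by (simp add: power3_eq_cube)
      finally show ?thesis .
    qed
    finally have "norm (T' t) \<le> 2 * (norm (c2 t) / v t)" by simp
    also have "\<dots> \<le> 2 * (M2 / v t)" using M2'[of t] vm(2)[of t] by (intro mult_left_mono divide_right_mono) auto
    finally show ?thesis by simp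
  qed
  have curv: "curvature \<gamma> u \<le> 2 * l * M2 / m\<^sup>2" for u
  proof -
    have "((\<lambda>u. T (ph u)) has_vector_derivative (l / v (ph u)) *\<^sub>R T' (ph u)) (at u)"
      using vector_diff_chain_at[of ph "l / v (ph u)" u T "T' (ph u)"] dph[of u] dT[of "ph u"]
      by (simp add: o_def has_real_derivative_iff_has_vector_derivative)
    then have "curvature \<gamma> u = norm ((l / v (ph u)) *\<^sub>R T' (ph u))"
      unfolding curvature_def vd\<gamma> using vector_derivative_at by metis
    also have "\<dots> \<le> (l / v (ph u)) * (2 * M2 / v (ph u))"
    proof -
      have "norm ((l / v (ph u)) *\<^sub>R T' (ph u)) = (l / v (ph u)) * norm (T' (ph u))"
        using lpos vm(2)[of "ph u"] by simp
      also have "\<dots> \<le> (l / v (ph u)) * (2 * M2 / v (ph u))"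
        using nT'[of "ph u"] lpos vm(2)[of "ph u"] by (intro mult_left_mono) simp_all
      finally show ?thesis .
    qed
    also have "\<dots> = (2 * l * M2) / (v (ph u))\<^sup>2" by (simp add: power2_eq_square)
    also have "\<dots> \<le> (2 * l * M2) / m\<^sup>2"
    proof (rule divide_left_mono)
      show "m\<^sup>2 \<le> (v (ph u))\<^sup>2" using vm(1)[of "ph u"] m(1) by (intro power_mono) auto
      show "0 \<le> 2 * l * M2" using lpos order_trans[OF norm_ge_zero M2'[of 0]] by simp
    qed (use m(1) vm(2)[of "ph u"] in auto)
    finally show ?thesis .
  qed
  have per\<gamma>: "\<gamma> (u + 1) = \<gamma> u" for u by (simp add: \<gamma>_def ph1 per)
  have inj\<gamma>: "inj_on \<gamma> {0..<1}"
  proof (rule inj_onI)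
    fix a b :: real assume ab: "a \<in> {0..<1}" "b \<in> {0..<1}" "\<gamma> a = \<gamma> b"
    have r: "ph w \<in> {0..<P}" if "w \<in> {0..<1}" for w
      using that phmono[of 0 w] phmono[of w 1] ph0 by (cases "w = 0") auto
    have "c (ph a) = c (ph b)" using ab(3) lpos by (simp add: \<gamma>_def)
    then have "ph a = ph b" using inj r ab by (auto dest: inj_onD)
    then show "a = b" using phmono[of a b] phmono[of b a] by (cases a b rule: linorder_cases) auto
  qed
  have "Cinf_on UNIV \<gamma>"
    unfolding \<gamma>_def by (intro Cinf_on_scaleR Cinf_on_const open_UNIV Cinf_on_compose[OF c] phC) auto
  then have arc: "arclength_closed_curve \<gamma> 1"
    unfolding arclength_closed_curve_def using per\<gamma> inj\<gamma> nT by (simp add: vd\<gamma>)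
  have rng: "range \<gamma> = (\<lambda>p. p /\<^sub>R l) ` range c"
  proof -
    have "c t /\<^sub>R l \<in> range \<gamma>" for t
    proof -
      have "ph ((S t - S 0) / l) = t" using lpos by (intro phS) simp
      then have "\<gamma> ((S t - S 0) / l) = c t /\<^sub>R l" by (simp add: \<gamma>_def)
      then show ?thesis by (metis rangeI)
    qed
    then show ?thesis by (auto simp: \<gamma>_def)
  qed
  show thesis using that[OF l arc rng curv] .
qed

section \<open>Area bounded below by the multiplicity of a projection\<close>

text \<open>The inequality half of the area formula. Cut D into grid cells: the measure of the image
  of a cell is at most the integral of the Jacobian over it. A fine enough grid separates m
  preimages of a point, so the point lies in at least m images.\<close>

lemma image_multiplicity_le_integral:
  fixes f :: "real^2 \<Rightarrow> real^2" and m :: nat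
  assumes D: "D \<in> sets lebesgue" "bounded D"
    and der: "\<And>x. x \<in> D \<Longrightarrow> (f has_derivative f' x) (at x within D)"
    and int: "(\<lambda>x. \<bar>det (matrix (f' x))\<bar>) absolutely_integrable_on D"
    and S: "S \<in> lmeasurable"
    and mult: "\<And>p. p \<in> S \<Longrightarrow> infinite {x \<in> D. f x = p} \<or> m \<le> card {x \<in> D. f x = p}"
  shows "real m * measure lebesgue S \<le> integral D (\<lambda>x. \<bar>det (matrix (f' x))\<bar>)"
proof -
  let ?J = "\<lambda>x. \<bar>det (matrix (f' x))\<bar>"
  \<comment> \<open>Index of the grid cell of side 1/(k+1) that contains x.\<close>
  define q where "q k x = (\<lfloor>real (Suc k) * x $ 1\<rfloor>, \<lfloor>real (Suc k) * x $ 2\<rfloor>)" for k and x :: "real^2"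
  define cell where "cell k c = {x \<in> D. q k x = c}" for k c
  obtain B where B: "\<And>x. x \<in> D \<Longrightarrow> norm x \<le> B"
    using D(2) by (auto simp: bounded_iff)
  have fin: "finite (q k ` D)" for k
  proof (rule finite_subset)
    let ?b = "\<lceil>real (Suc k) * B\<rceil> + 1"
    show "q k ` D \<subseteq> {- ?b..?b} \<times> {- ?b..?b}"
    proof (rule image_subsetI)
      fix x assume x: "x \<in> D"
      have *: "\<bar>real (Suc k) * x $ i\<bar> \<le> real (Suc k) * B" for i
        using order_trans[OF component_le_norm_cart B[OF x]] by (simp add: abs_mult mult_left_mono)
      have "\<lfloor>real (Suc k) * x $ i\<rfloor> \<in> {- ?b..?b}" for i
        using *[of i] unfolding abs_le_iff atLeastAtMost_iff by linarith
      then show "q k x \<in> {- ?b..?b} \<times> {- ?b..?b}" by (simp add: q_def)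
    qed
  qed simp
  have cellD: "cell k c \<subseteq> D" for k c by (auto simp: cell_def)
  have cellm: "cell k c \<in> sets lebesgue" for k c
  proof -
    have "{x::real^2. q k x = c} \<in> sets borel"
    proof -
      have "{x::real^2. \<lfloor>real (Suc k) * x $ i\<rfloor> = n} \<in> sets borel" for i n
      proof -
        have "{x::real^2. \<lfloor>real (Suc k) * x $ i\<rfloor> = n} = {x. of_int n \<le> real (Suc k) * x $ i} \<inter> {x. real (Suc k) * x $ i < of_int n + 1}"
          by (auto simp: floor_eq_iff)
        moreover have "closed {x::real^2. of_int n \<le> real (Suc k) * x $ i}"
          by (intro closed_Collect_le continuous_intros)
        moreover have "open {x::real^2. real (Suc k) * x $ i < of_int n + 1}"
          by (intro open_Collect_less continuous_intros)
        ultimately show ?thesis by auto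
      qed
      moreover have "{x::real^2. q k x = c} = {x. \<lfloor>real (Suc k) * x $ 1\<rfloor> = fst c} \<inter> {x. \<lfloor>real (Suc k) * x $ 2\<rfloor> = snd c}"
        by (auto simp: q_def)
      ultimately show ?thesis by (metis sets.Int)
    qed
    then have "{x::real^2. q k x = c} \<in> sets lebesgue" by auto
    moreover have "cell k c = D \<inter> {x. q k x = c}" by (auto simp: cell_def)
    ultimately show ?thesis using D(1) by (metis sets.Int)
  qed
  have cint: "?J absolutely_integrable_on cell k c" for k c
    using set_integrable_subset[OF int cellm cellD] .
  have cder: "(f has_derivative f' x) (at x within cell k c)" if "x \<in> cell k c" for x k c
    using der that cellD has_derivative_subset by blast
  have cint': "?J integrable_on cell k c" for k c
    using cint set_lebesgue_integral_eq_integral(1) by blast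
  have im: "f ` cell k c \<in> lmeasurable" "measure lebesgue (f ` cell k c) \<le> integral (cell k c) ?J" for k c
    using measurable_differentiable_image[OF cellm cder cint'] measure_differentiable_image[OF cellm cder cint']
    by blast+
  \<comment> \<open>Number of cells of the k-th grid whose image contains p.\<close>
  define g where "g k p = (\<Sum>c\<in>q k ` D. indicat_real (f ` cell k c) p)" for k p
  have gi: "integrable lebesgue (indicat_real (f ` cell k c))" for k c
    using im(1)[of k c] by (auto simp: fmeasurable_def)
  have gint: "integrable lebesgue (g k)" for k
    unfolding g_def using gi by (intro Bochner_Integration.integrable_sum) auto
  have "(\<integral>p. g k p \<partial>lebesgue) \<le> integral D ?J" for k
  proof -
    have "(\<integral>p. g k p \<partial>lebesgue) = (\<Sum>c\<in>q k ` D. measure lebesgue (f ` cell k c))"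
      unfolding g_def using gi by (subst Bochner_Integration.integral_sum) auto
    also have "\<dots> \<le> (\<Sum>c\<in>q k ` D. integral (cell k c) ?J)"
      by (intro sum_mono im)
    also have "\<dots> = integral (\<Union>c\<in>q k ` D. cell k c) ?J"
    proof (rule integral_unique[symmetric], rule has_integral_UN[OF fin])
      show "(?J has_integral integral (cell k c) ?J) (cell k c)" for c
        using cint' by (rule integrable_integral)
      show "pairwise (\<lambda>i i'. negligible (cell k i \<inter> cell k i')) (q k ` D)"
      proof (rule pairwiseI)
        fix i i' :: "int \<times> int" assume "i \<noteq> i'"
        then have "cell k i \<inter> cell k i' = {}" by (auto simp: cell_def)
        then show "negligible (cell k i \<inter> cell k i')" by simp
      qed
    qed
    also have "(\<Union>c\<in>q k ` D. cell k c) = D" by (auto simp: cell_def)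
    finally show ?thesis .
  qed
  note gle = this
  define A where "A k = {p \<in> S. real m \<le> g k p}" for k
  have Am: "A k \<in> lmeasurable" for k
  proof -
    have "{p \<in> space lebesgue. real m \<le> g k p} \<in> sets lebesgue"
      using borel_measurable_integrable[OF gint[of k]] by measurable
    moreover have "A k = S \<inter> {p \<in> space lebesgue. real m \<le> g k p}" by (auto simp: A_def)
    ultimately show ?thesis using fmeasurable_Int_fmeasurable[OF S] by simp
  qed
  have Ale: "real m * measure lebesgue (A k) \<le> integral D ?J" for k
  proof -
    have "real m * measure lebesgue (A k) = (\<integral>p. real m * indicat_real (A k) p \<partial>lebesgue)"
      using Am[of k] by simp
    also have "\<dots> \<le> (\<integral>p. g k p \<partial>lebesgue)"
    proof (rule integral_mono)
      show "integrable lebesgue (\<lambda>p. real m * indicat_real (A k) p)"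
        using Am[of k] by (auto simp: fmeasurable_def)
      show "real m * indicat_real (A k) p \<le> g k p" for p
        by (auto simp: A_def indicator_def g_def intro!: sum_nonneg)
    qed (rule gint)
    finally show ?thesis using gle[of k] by linarith
  qed
  \<comment> \<open>The grids are not nested, so a later grid may count fewer cells. The points for
    which all grids from k on count at least m form an increasing sequence of sets, to which
    continuity of the measure applies.\<close>
  define C where "C k = (\<Inter>l\<in>{k..}. A l)" for k
  have Cm: "C k \<in> lmeasurable" for k
  proof -
    have "C k \<in> sets lebesgue" unfolding C_def using Am by (intro sets.countable_INT') auto
    moreover have "C k \<subseteq> A k" by (auto simp: C_def)
    ultimately show ?thesis using Am fmeasurableI2 by blast
  qed
  have Cle: "real m * measure lebesgue (C k) \<le> integral D ?J" for k
  proof -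
    have "measure lebesgue (C k) \<le> measure lebesgue (A k)"
      using Cm Am by (intro measure_mono_fmeasurable) (auto simp: C_def)
    then show ?thesis using Ale[of k] by (smt (verit) mult_left_mono of_nat_0_le_iff)
  qed
  have "S = (\<Union>k. C k)"
  proof
    show "(\<Union>k. C k) \<subseteq> S" by (auto simp: C_def A_def)
    show "S \<subseteq> (\<Union>k. C k)"
    proof
      fix p assume p: "p \<in> S"
      obtain X where X: "X \<subseteq> {x \<in> D. f x = p}" "finite X" "card X = m"
      proof (cases "finite {x \<in> D. f x = p}")
        case True
        then show ?thesis
          using mult[OF p] obtain_subset_with_card_n[of m "{x \<in> D. f x = p}"] that by blast
      next
        case False
        then show ?thesis
          using infinite_arbitrarily_large[of "{x \<in> D. f x = p}" m] that by blast
      qed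
      obtain e where e: "e > 0" "\<And>x y. x \<in> X \<Longrightarrow> y \<in> X \<Longrightarrow> x \<noteq> y \<Longrightarrow> e \<le> dist x y"
      proof -
        define E where "E = insert 1 (case_prod dist ` (X \<times> X - Id))"
        have fE: "finite E" using X(2) by (simp add: E_def)
        have "Min E \<in> E" using fE by (intro Min_in) (auto simp: E_def)
        then have pos: "Min E > 0" by (auto simp: E_def)
        have "Min E \<le> dist x y" if "x \<in> X" "y \<in> X" "x \<noteq> y" for x y
          using fE that by (intro Min_le) (auto simp: E_def image_iff intro!: disjI2 bexI[of _ "(x, y)"])
        then show ?thesis using pos that by blast
      qed
      \<comment> \<open>Two points of one cell of the k-th grid have distance below 2/(k+1), each
        coordinate contributing at most one side.\<close>
      obtain k where k: "2 / real (Suc k) < e"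
      proof -
        obtain k where "2 / e < real k" using reals_Archimedean2 by blast
        then have "2 / e < real (Suc k)" by simp
        then show ?thesis using e(1) that[of k] by (simp add: field_simps)
      qed
      have "p \<in> A l" if l: "l \<ge> k" for l
      proof -
        have "2 / real (Suc l) \<le> 2 / real (Suc k)" using l by (simp add: frac_le)
        then have l2: "2 / real (Suc l) < e" using k by linarith
        have inj: "inj_on (q l) X"
        proof (rule inj_onI, rule ccontr)
          fix x y assume xy: "x \<in> X" "y \<in> X" "q l x = q l y" "x \<noteq> y"
          have "\<bar>real (Suc l) * x $ i - real (Suc l) * y $ i\<bar> < 1" if "\<lfloor>real (Suc l) * x $ i\<rfloor> = \<lfloor>real (Suc l) * y $ i\<rfloor>" for i
            using that by linarith
          moreover have "\<bar>(x - y) $ i\<bar> = \<bar>real (Suc l) * x $ i - real (Suc l) * y $ i\<bar> / real (Suc l)" for i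
            unfolding right_diff_distrib[symmetric] abs_mult by simp
          ultimately have "\<bar>(x - y) $ i\<bar> < 1 / real (Suc l)" if "\<lfloor>real (Suc l) * x $ i\<rfloor> = \<lfloor>real (Suc l) * y $ i\<rfloor>" for i
            using that by (simp add: divide_strict_right_mono)
          then have "\<bar>(x - y) $ 1\<bar> < 1 / real (Suc l)" "\<bar>(x - y) $ 2\<bar> < 1 / real (Suc l)"
            using xy(3) unfolding q_def by blast+
          moreover have "dist x y \<le> \<bar>(x - y) $ 1\<bar> + \<bar>(x - y) $ 2\<bar>"
            using norm_le_l1_cart[of "x - y"] by (simp add: dist_norm sum_2)
          ultimately show False using e(2)[OF xy(1,2,4)] l2 by linarith
        qed
        have "m = card (q l ` X)" using card_image[OF inj] X(3) by simp
        also have "real \<dots> = (\<Sum>c\<in>q l ` X. 1)" by simp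
        also have "\<dots> \<le> (\<Sum>c\<in>q l ` X. indicat_real (f ` cell l c) p)"
        proof (rule sum_mono)
          fix c assume "c \<in> q l ` X"
          then obtain x where "x \<in> X" "c = q l x" by auto
          then have "p \<in> f ` cell l c" using X(1) by (auto simp: cell_def)
          then show "1 \<le> indicat_real (f ` cell l c) p" by simp
        qed
        also have "\<dots> \<le> g l p"
          unfolding g_def using X(1) by (intro sum_mono2 fin) auto
        finally show ?thesis using p by (simp add: A_def)
      qed
      then show "p \<in> (\<Union>k. C k)" by (auto simp: C_def)
    qed
  qed
  moreover have "(\<lambda>k. measure lebesgue (C k)) \<longlonglongrightarrow> measure lebesgue (\<Union>k. C k)"
  proof (rule Lim_measure_incseq)
    show "range C \<subseteq> sets lebesgue" using Cm by auto
    show "incseq C" by (auto simp: incseq_def C_def)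
    show "emeasure lebesgue (\<Union>i. C i) \<noteq> \<infinity>" using S calculation by (auto simp: fmeasurable_def)
  qed
  ultimately have "(\<lambda>k. real m * measure lebesgue (C k)) \<longlonglongrightarrow> real m * measure lebesgue S"
    by (intro tendsto_intros) simp
  then show ?thesis using Cle by (intro LIMSEQ_le_const2) auto
qed

text \<open>The hypothesis \<open>prdet\<close> says that the projection does not increase areas, so
  the Jacobian of the projected map is at most the area integrand. Differentiability holds inside
  the triangles only; points over the edges are discarded as a null set.\<close>

lemma ps_disk_area_ge:
  fixes pr :: "real^3 \<Rightarrow> real^2" and m :: nat
  assumes disk: "ps_embedded_disk \<T> f" and pr: "linear pr"
    and prdet: "\<And>u v. \<bar>pr u $ 1 * pr v $ 2 - pr v $ 1 * pr u $ 2\<bar> \<le> norm (cross3 u v)"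
    and S: "S \<in> lmeasurable"
    and mult: "\<And>p. p \<in> S \<Longrightarrow> infinite {x \<in> \<Union>\<T>. pr (f x) = p} \<or> m \<le> card {x \<in> \<Union>\<T>. pr (f x) = p}"
  shows "real m * measure lebesgue S \<le> disk_area \<T> f"
proof -
  define w where "w x = norm (cross3 (frechet_derivative f (at x) (axis 1 1)) (frechet_derivative f (at x) (axis 2 1)))" for x
  define D where "D = (\<Union>T\<in>\<T>. interior T)"
  have tri: "triangulation \<T>" "\<And>T. T \<in> \<T> \<Longrightarrow> 2 simplex T"
    using disk by (auto simp: ps_embedded_disk_def)
  have finT: "finite \<T>" using tri by (simp add: triangulation_def)
  have T: "compact T" "convex T" if "T \<in> \<T>" for T
    using tri(2)[OF that] by (auto simp: simplex intro: finite_imp_compact_convex_hull)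
  have opD: "open D" by (auto simp: D_def)
  have DU: "D \<subseteq> \<Union>\<T>" using interior_subset by (auto simp: D_def)
  have bdU: "bounded (\<Union>\<T>)" using finT T(1) compact_imp_bounded by (intro bounded_Union) auto
  then have bdD: "bounded D" using DU bounded_subset by blast
  have ex: "\<exists>U g. open U \<and> T \<subseteq> U \<and> Cinf_on U g \<and> (\<forall>x\<in>T. g x = f x)" if "T \<in> \<T>" for T
  proof -
    have "\<exists>U g. open U \<and> T \<subseteq> U \<and> Cinf_on U g \<and> (\<forall>x\<in>T. g x = f x \<and> inj (frechet_derivative g (at x)))"
      using disk that unfolding ps_embedded_disk_def by simp
    then show ?thesis by (elim exE conjE) (intro exI conjI ballI, assumption+, simp)
  qed
  have loc: "\<exists>U g. open U \<and> T \<subseteq> U \<and> (\<forall>x\<in>T. g x = f x) \<and> (\<forall>x\<in>U. g differentiable at x) \<and>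
      (\<forall>v. continuous_on U (\<lambda>x. frechet_derivative g (at x) v)) \<and>
      (\<forall>x\<in>interior T. (f has_derivative frechet_derivative g (at x)) (at x) \<and> frechet_derivative f (at x) = frechet_derivative g (at x))"
    if TT: "T \<in> \<T>" for T
  proof -
    obtain U g where Ug: "open U" "T \<subseteq> U" "Cinf_on U g" "\<And>x. x \<in> T \<Longrightarrow> g x = f x"
      using ex[OF TT] by blast
    have "Ck_on (Suc 0) U g" using Ug(3) unfolding Cinf_on_def by blast
    then have gd: "\<And>x. x \<in> U \<Longrightarrow> g differentiable at x" "\<And>v. continuous_on U (\<lambda>x. frechet_derivative g (at x) v)"
      by auto
    have "(f has_derivative frechet_derivative g (at x)) (at x)" if x: "x \<in> interior T" for x
    proof (rule has_derivative_transform_within_open[where f=g])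
      show "(g has_derivative frechet_derivative g (at x)) (at x)"
        using gd(1)[of x] x interior_subset Ug(2) frechet_derivative_works by blast
      show "g y = f y" if "y \<in> interior T" for y using that interior_subset Ug(4) by blast
    qed (use x in auto)
    note der = this
    show ?thesis
    proof (intro exI conjI ballI allI)
      show "open U" "T \<subseteq> U" by (rule Ug)+
      show "\<And>x. x \<in> T \<Longrightarrow> g x = f x" by (rule Ug)
      show "\<And>x. x \<in> U \<Longrightarrow> g differentiable at x" by (rule gd)
      show "\<And>v. continuous_on U (\<lambda>x. frechet_derivative g (at x) v)" by (rule gd)
      fix x assume x: "x \<in> interior T"
      show "(f has_derivative frechet_derivative g (at x)) (at x)" by (rule der[OF x])
      show "frechet_derivative f (at x) = frechet_derivative g (at x)"
        by (rule frechet_derivative_at[OF der[OF x], symmetric])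
    qed
  qed
  have derf: "(f has_derivative frechet_derivative f (at x)) (at x)" if x: "x \<in> D" for x
  proof -
    obtain T where T: "T \<in> \<T>" "x \<in> interior T" using x by (auto simp: D_def)
    show ?thesis using loc[OF T(1)] T(2) by metis
  qed
  have contD: "continuous_on D (\<lambda>x. frechet_derivative f (at x) v)" for v
  proof (unfold D_def, rule continuous_on_open_UN)
    fix T assume TT: "T \<in> \<T>"
    obtain U g where "T \<subseteq> U" "continuous_on U (\<lambda>x. frechet_derivative g (at x) v)"
      "\<And>x. x \<in> interior T \<Longrightarrow> frechet_derivative f (at x) = frechet_derivative g (at x)"
      using loc[OF TT] by blast
    then show "continuous_on (interior T) (\<lambda>x. frechet_derivative f (at x) v)"
      using continuous_on_cong[OF refl, of "interior T" "\<lambda>x. frechet_derivative f (at x) v" "\<lambda>x. frechet_derivative g (at x) v"]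
        continuous_on_subset[of U "\<lambda>x. frechet_derivative g (at x) v" "interior T"] interior_subset[of T] by auto
  qed auto
  have bdd: "\<exists>B. \<forall>x\<in>D. norm (frechet_derivative f (at x) v) \<le> B" for v
  proof -
    have "\<exists>B. \<forall>x\<in>interior T. norm (frechet_derivative f (at x) v) \<le> B" if TT: "T \<in> \<T>" for T
    proof -
      obtain U g where Ug: "T \<subseteq> U" "continuous_on U (\<lambda>x. frechet_derivative g (at x) v)"
        "\<And>x. x \<in> interior T \<Longrightarrow> frechet_derivative f (at x) = frechet_derivative g (at x)"
        using loc[OF TT] by blast
      have "bounded ((\<lambda>x. frechet_derivative g (at x) v) ` T)"
        using Ug T(1)[OF TT] by (intro compact_imp_bounded compact_continuous_image continuous_on_subset[OF Ug(2)]) auto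
      then obtain B where "\<And>x. x \<in> T \<Longrightarrow> norm (frechet_derivative g (at x) v) \<le> B"
        by (auto simp: bounded_iff)
      then have "norm (frechet_derivative f (at x) v) \<le> B" if "x \<in> interior T" for x
        using Ug(3)[OF that] that interior_subset by (metis subsetD)
      then show ?thesis by blast
    qed
    then obtain B where B: "\<And>T x. T \<in> \<T> \<Longrightarrow> x \<in> interior T \<Longrightarrow> norm (frechet_derivative f (at x) v) \<le> B T"
      by metis
    have "norm (frechet_derivative f (at x) v) \<le> (\<Sum>T\<in>\<T>. \<bar>B T\<bar>)" if x: "x \<in> D" for x
    proof -
      obtain T where TT: "T \<in> \<T>" "x \<in> interior T" using x by (auto simp: D_def)
      then have "norm (frechet_derivative f (at x) v) \<le> \<bar>B T\<bar>" using B[OF TT] by linarith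
      also have "\<dots> \<le> (\<Sum>T\<in>\<T>. \<bar>B T\<bar>)" using finT TT by (intro member_le_sum) auto
      finally show ?thesis .
    qed
    then show ?thesis by blast
  qed
  have Dm: "D \<in> sets lebesgue" using opD by auto
  have Dlm: "D \<in> lmeasurable" using opD bdD by (simp add: bounded_set_imp_lmeasurable)
  have bint: "h absolutely_integrable_on D" if h: "continuous_on D h" "\<And>x. x \<in> D \<Longrightarrow> norm (h x) \<le> (B::real)"
    for h :: "real^2 \<Rightarrow> real" and B
  proof (rule measurable_bounded_by_integrable_imp_absolutely_integrable[where g="\<lambda>_. B"])
    show "h \<in> borel_measurable (lebesgue_on D)" using h(1) Dm by (rule continuous_imp_measurable_on_sets_lebesgue)
    show "(\<lambda>_. B) integrable_on D" using Dlm integrable_on_const by blast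
  qed (use Dm h in auto)
  let ?a = "axis 1 1 :: real^2" and ?b = "axis 2 1 :: real^2"
  obtain B1 where B1: "\<And>x. x \<in> D \<Longrightarrow> norm (frechet_derivative f (at x) ?a) \<le> B1" using bdd by blast
  obtain B2 where B2: "\<And>x. x \<in> D \<Longrightarrow> norm (frechet_derivative f (at x) ?b) \<le> B2" using bdd by blast
  have cross_le: "norm (cross3 u v) \<le> norm u * norm v" for u v
  proof -
    have "(norm (cross3 u v))\<^sup>2 \<le> (norm u * norm v)\<^sup>2"
      using norm_cross_dot[of u v] by (simp flip: norm_cross_dot)
    then show ?thesis by (rule power2_le_imp_le) simp
  qed
  have wB: "norm (w x) \<le> \<bar>B1\<bar> * \<bar>B2\<bar>" if "x \<in> D" for x
  proof -
    have "norm (w x) \<le> norm (frechet_derivative f (at x) ?a) * norm (frechet_derivative f (at x) ?b)"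
      unfolding w_def using cross_le by simp
    also have "\<dots> \<le> \<bar>B1\<bar> * \<bar>B2\<bar>" using B1[OF that] B2[OF that] by (intro mult_mono) auto
    finally show ?thesis .
  qed
  have cw: "continuous_on D w"
    unfolding w_def by (intro continuous_on_norm continuous_on_cross contD)
  have wint: "w absolutely_integrable_on D" using bint[OF cw wB] by blast
  define F' where "F' x v = pr (frechet_derivative f (at x) v)" for x v
  define J where "J x = \<bar>det (matrix (F' x))\<bar>" for x
  have blpr: "bounded_linear pr" using pr linear_conv_bounded_linear by blast
  have derpf: "((\<lambda>x. pr (f x)) has_derivative F' x) (at x within D)" if "x \<in> D" for x
    unfolding F'_def using bounded_linear.has_derivative[OF blpr derf[OF that]] has_derivative_at_withinI by blast
  have detF: "det (matrix (F' x)) = F' x ?a $ 1 * F' x ?b $ 2 - F' x ?b $ 1 * F' x ?a $ 2" for x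
    by (simp add: det_2 matrix_def)
  have Jw: "J x \<le> w x" for x
    unfolding J_def detF F'_def w_def by (rule prdet)
  have cJ: "continuous_on D J"
    unfolding J_def detF unfolding F'_def
    by (intro continuous_intros linear_continuous_on_compose[OF contD] pr)
  have Jint: "J absolutely_integrable_on D"
    using Jw wB by (intro bint[OF cJ, of "\<bar>B1\<bar> * \<bar>B2\<bar>"]) (smt (verit) J_def real_norm_def)
  \<comment> \<open>Projections of the triangle boundaries. Each is the image of a null set under a
    differentiable map, and off \<open>N\<close> no preimage is lost on passing to the open
    triangles.\<close>
  define N where "N = (\<Union>T\<in>\<T>. (\<lambda>x. pr (f x)) ` (T - interior T))"
  have negT: "negligible (T - interior T)" if "T \<in> \<T>" for T
    using negligible_convex_frontier[OF T(2)[OF that]] T(1)[OF that]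
    by (simp add: frontier_def closure_closed compact_imp_closed)
  have negN: "negligible N"
    unfolding N_def
  proof (intro negligible_Union finite_imageI finT, clarify)
    fix T assume TT: "T \<in> \<T>"
    obtain U g where Ug: "T \<subseteq> U" "\<And>x. x \<in> T \<Longrightarrow> g x = f x" "\<And>x. x \<in> U \<Longrightarrow> g differentiable at x"
      using loc[OF TT] by metis
    have "negligible ((\<lambda>x. pr (g x)) ` (T - interior T))"
    proof (rule negligible_differentiable_image_negligible[OF order_refl negT[OF TT]])
      show "(\<lambda>x. pr (g x)) differentiable_on (T - interior T)"
        unfolding differentiable_on_def
      proof
        fix x assume "x \<in> T - interior T"
        then have "g differentiable (at x within (T - interior T))"
          using Ug differentiable_at_withinI by blast
        then show "(\<lambda>x. pr (g x)) differentiable (at x within (T - interior T))"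
          using bounded_linear.has_derivative[OF blpr] unfolding differentiable_def by blast
      qed
    qed
    moreover have "(\<lambda>x. pr (g x)) ` (T - interior T) = (\<lambda>x. pr (f x)) ` (T - interior T)"
      using Ug(2) by (intro image_cong) auto
    ultimately show "negligible ((\<lambda>x. pr (f x)) ` (T - interior T))" by simp
  qed
  have SN: "S - N \<in> lmeasurable" "measure lebesgue (S - N) = measure lebesgue S"
    using S negN by (auto simp: lmeasurable_negligible_symdiff measure_Diff_null_set negligible_iff_null_sets
      intro!: fmeasurable_Diff dest: null_sets_completionI)
  have "real m * measure lebesgue (S - N) \<le> integral D (\<lambda>x. \<bar>det (matrix (F' x))\<bar>)"
  proof (rule image_multiplicity_le_integral[OF Dm bdD derpf _ SN(1)])
    show "(\<lambda>x. \<bar>det (matrix (F' x))\<bar>) absolutely_integrable_on D" using Jint by (simp add: J_def[abs_def])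
    fix p assume p: "p \<in> S - N"
    have "{x \<in> D. pr (f x) = p} = {x \<in> \<Union>\<T>. pr (f x) = p}"
      using p DU unfolding N_def D_def by blast
    then show "infinite {x \<in> D. pr (f x) = p} \<or> m \<le> card {x \<in> D. pr (f x) = p}"
      using mult[of p] p by auto
  qed
  also have "\<dots> \<le> integral D w"
    using Jint wint Jw unfolding J_def
    by (intro integral_le) (auto simp: set_lebesgue_integral_eq_integral(1) J_def[abs_def])
  also have "integral D w = integral (\<Union>\<T>) w"
  proof (rule integral_spike_set)
    have "negligible (\<Union>\<T> - D)"
    proof (rule negligible_subset)
      show "negligible (\<Union>T\<in>\<T>. T - interior T)" using finT negT by (intro negligible_Union) auto
    qed (auto simp: D_def)
    then show "negligible {x \<in> \<Union>\<T> - D. w x \<noteq> 0}" by (rule negligible_subset) auto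
    show "negligible {x \<in> D - \<Union>\<T>. w x \<noteq> 0}"
    proof -
      have "{x \<in> D - \<Union>\<T>. w x \<noteq> 0} = {}" using DU by blast
      then show ?thesis by (metis negligible_empty)
    qed
  qed
  also have "\<dots> = disk_area \<T> f" unfolding disk_area_def w_def[abs_def] by simp
  finally show ?thesis by (simp add: SN(2))
qed

section \<open>Closed planes separate space\<close>

text \<open>An open set around b has a compact complement, which g carries to a compact and hence
  closed set; this gives continuity at a. Compactness then makes the continuous bijection a
  homeomorphism.\<close>

lemma homeomorphic_one_point_extension:
  fixes S :: "'a::euclidean_space set" and T :: "'b::euclidean_space set"
  assumes S: "compact S" "a \<in> S" and T: "compact T" "b \<in> T"
    and hom: "homeomorphism (S - {a}) (T - {b}) f g"
  shows "S homeomorphic T"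
proof -
  let ?F = "\<lambda>x. if x = a then b else f x"
  have fim: "f ` (S - {a}) = T - {b}" and gim: "g ` (T - {b}) = S - {a}"
    and contf: "continuous_on (S - {a}) f" and contg: "continuous_on (T - {b}) g"
    and gf: "\<And>x. x \<in> S - {a} \<Longrightarrow> g (f x) = x" and fg: "\<And>y. y \<in> T - {b} \<Longrightarrow> f (g y) = y"
    using hom by (auto simp: homeomorphism_def)
  have Fim: "?F ` S = T"
  proof -
    have "?F ` S = insert b (f ` (S - {a}))"
      using S by (auto simp: image_iff)
    then show ?thesis using fim T by auto
  qed
  have inj: "inj_on ?F S"
  proof (rule inj_onI)
    fix x y assume "x \<in> S" "y \<in> S" "?F x = ?F y"
    then show "x = y"
      using fim gf[of x] gf[of y]
      by (smt (verit) DiffI Diff_iff image_eqI singletonD singletonI)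
  qed
  have "openin (top_of_set S) (S \<inter> ?F -` U)" if U: "openin (top_of_set T) U" for U
  proof (cases "b \<in> U")
    case True
    have K: "compact (T - U)"
    proof (rule closedin_compact[OF T(1)])
      show "closedin (top_of_set T) (T - U)"
        using U by (metis closedin_diff closedin_topspace topspace_euclidean_subtopology)
    qed
    have "S \<inter> ?F -` U = S - g ` (T - U)"
    proof -
      have "x \<in> g ` (T - U)" if "x \<in> S" "x \<noteq> a" "f x \<notin> U" for x
        using that fim gf by (intro image_eqI[where x="f x"]) auto
      moreover have "f x \<notin> U \<and> x \<noteq> a" if x: "x \<in> g ` (T - U)" for x
      proof -
        obtain y where y: "y \<in> T" "y \<notin> U" "x = g y" using x by auto
        then have "y \<in> T - {b}" using True by auto
        then show ?thesis using fg[of y] gim y by auto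
      qed
      ultimately show ?thesis using True by (auto split: if_splits) blast+
    qed
    moreover have "compact (g ` (T - U))"
      using K True by (intro compact_continuous_image continuous_on_subset[OF contg]) auto
    ultimately show ?thesis
      by (simp add: openin_open_Int Diff_eq compact_imp_closed open_Compl)
  next
    case False
    have "S \<inter> ?F -` U = (S - {a}) \<inter> f -` U"
      using False by (auto split: if_splits)
    moreover have "openin (top_of_set (S - {a})) ((S - {a}) \<inter> f -` U)"
      using contf False fim U
      by (intro continuous_openin_preimage[where T="T - {b}"])
         (auto simp: openin_open)
    moreover have "openin (top_of_set S) (S - {a})"
      using openin_open_Int[of "- {a}" S] by (simp add: open_Compl Diff_eq)
    ultimately show ?thesis
      by (metis openin_trans)
  qed
  then have "continuous_on S ?F"
    unfolding continuous_on_open[of S ?F] Fim by (simp add: Int_def)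
  then show ?thesis
    using homeomorphic_compact[OF S(1) _ Fim inj] by blast
qed

text \<open>Inversion centred at c turns the unbounded closed plane into a bounded set that becomes
  compact when c is added. This one-point compactification is a sphere, and the Jordan-Brouwer
  theorem applies. A connected open set stays connected without c, so connectedness would pass
  through the inversion.\<close>

lemma closed_plane_separates:
  fixes S :: "'a::euclidean_space set"
  assumes dim: "DIM('a) = 3" and S: "closed S" "S homeomorphic (UNIV::complex set)" and c: "c \<notin> S"
  shows "\<not> connected (- S)"
proof
  assume con: "connected (- S)"
  \<comment> \<open>Inversion in the unit sphere around c, an involution of the space punctured at
    c.\<close>
  define J where "J v = c + (v - c) /\<^sub>R (norm (v - c))\<^sup>2" for v :: 'a
  have JJ: "J (J v) = v" if "v \<noteq> c" for v
  proof -
    have "norm (J v - c) = 1 / norm (v - c)"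
      using that by (simp add: J_def power2_eq_square divide_simps)
    then have "(norm (J v - c))\<^sup>2 = 1 / (norm (v - c))\<^sup>2"
      by (simp add: power_divide)
    then show ?thesis
      using that unfolding J_def[of "J v"] by (simp add: J_def)
  qed
  have Jc: "J v \<noteq> c" if "v \<noteq> c" for v
    using that by (simp add: J_def)
  have contJ: "continuous_on (-{c}) J"
    unfolding J_def by (intro continuous_intros) auto
  have homJ: "homeomorphism (-{c}) (-{c}) J J"
  proof -
    have "J ` (-{c}) = -{c}"
    proof
      show "-{c} \<subseteq> J ` (-{c})"
      proof
        fix v assume v: "v \<in> -{c}"
        then show "v \<in> J ` (-{c})" using JJ[of v] Jc[of v] by (intro image_eqI[where x="J v"]) auto
      qed
    qed (use Jc in auto)
    then show ?thesis
      unfolding homeomorphism_def using contJ JJ by simp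
  qed
  have imJ: "J ` (- S - {c}) = - insert c (J ` S)"
  proof -
    have "y \<in> J ` (- S - {c})" if y: "y \<notin> insert c (J ` S)" for y
    proof (rule image_eqI[where x="J y"])
      show "y = J (J y)" using y JJ[of y] by simp
      have "J y \<notin> S" using y JJ[of y] image_eqI[of y J "J y" S] by auto
      then show "J y \<in> - S - {c}" using y Jc[of y] by simp
    qed
    moreover have "J v \<notin> insert c (J ` S)" if v: "v \<notin> S" "v \<noteq> c" for v
    proof
      assume "J v \<in> insert c (J ` S)"
      then obtain u where u: "u \<in> S" "J v = J u" using Jc[OF v(2)] by auto
      then have "u \<noteq> c" using c by auto
      then have "u = v" using JJ[of u] JJ[of v] u v by simp
      then show False using u v by simp
    qed
    ultimately show ?thesis by auto
  qed
  obtain e where e: "e > 0" "ball c e \<subseteq> - S"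
    using S c open_contains_ball[of "- S"] by blast
  have Sunb: "\<not> bounded S"
    using S compact_eq_bounded_closed homeomorphic_compactness not_compact_UNIV by blast
  define S' where "S' = insert c (J ` S)"
  have JS: "J ` S = S' - {c}"
  proof -
    have "c \<notin> J ` S"
    proof
      assume "c \<in> J ` S"
      then obtain v where v: "v \<in> S" "J v = c" by auto
      then have "v \<noteq> c" using c by metis
      then show False using Jc[of v] v by simp
    qed
    then show ?thesis by (auto simp: S'_def)
  qed
  have bd: "bounded S'"
  proof -
    have "dist c (J v) \<le> 1 / e" if "v \<in> S" for v
    proof -
      have "norm (v - c) \<ge> e"
      proof (rule ccontr)
        assume "\<not> norm (v - c) \<ge> e"
        then have "v \<in> ball c e" by (simp add: dist_norm norm_minus_commute)
        then show False using e(2) that by blast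
      qed
      then have "1 / norm (v - c) \<le> 1 / e"
        using e by (simp add: frac_le)
      moreover have "dist c (J v) = 1 / norm (v - c)"
        by (simp add: J_def dist_norm power2_eq_square divide_simps)
      ultimately show ?thesis by simp
    qed
    then show ?thesis
      unfolding S'_def bounded_insert by (auto simp: bounded_def)
  qed
  have cl: "closed S'"
  proof -
    have "openin (top_of_set (-{c})) (J ` (- S - {c}))"
    proof (rule homeomorphism_imp_open_map[OF homJ])
      have "open (- S - {c})" using S by (simp add: open_Compl open_delete)
      then show "openin (top_of_set (- {c})) (- S - {c})"
        by (auto simp: openin_open_eq open_Compl)
    qed
    then have "open (J ` (- S - {c}))"
      by (simp add: openin_open_eq open_Compl)
    moreover have "J ` (- S - {c}) = - S'" using imJ by (simp add: S'_def)
    ultimately show ?thesis by (simp add: closed_open)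
  qed
  obtain b :: 'a where b: "b \<in> sphere 0 1"
    using that[of "SOME i. i \<in> Basis"] norm_Basis[OF SOME_Basis, where 'a='a] by simp
  have Jhom: "J ` S homeomorphic S"
  proof -
    have "homeomorphism S (J ` S) J J"
      using c by (intro homeomorphism_of_subsets[OF homJ]) auto
    then show ?thesis using homeomorphic_def homeomorphic_sym by blast
  qed
  have "(sphere (0::'a) 1 - {b}) homeomorphic {x::'a. b \<bullet> x = 0}"
    using b by (intro homeomorphic_punctured_sphere_hyperplane) auto
  also have "{x::'a. b \<bullet> x = 0} homeomorphic (UNIV::complex set)"
  proof (rule homeomorphic_affine_sets)
    have "b \<noteq> 0" using b by auto
    then show "aff_dim {x::'a. b \<bullet> x = 0} = aff_dim (UNIV::complex set)"
      using dim by simp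
  qed (auto simp: affine_hyperplane)
  finally have "(S' - {c}) homeomorphic (sphere (0::'a) 1 - {b})"
    using Jhom S JS homeomorphic_trans homeomorphic_sym by metis
  then have "S' homeomorphic sphere (0::'a) 1"
    using homeomorphic_one_point_extension[of S' c "sphere 0 1" b] bd cl b
    by (auto simp: homeomorphic_def compact_eq_bounded_closed S'_def)
  then have ncon: "\<not> connected (- S')"
    by (rule Jordan_Brouwer_separation) simp
  have "connected (- S - {c})"
    using S con dim by (intro connected_open_delete) auto
  then have "connected (J ` (- S - {c}))"
    by (intro connected_continuous_image continuous_on_subset[OF contJ]) auto
  moreover have "J ` (- S - {c}) = - S'" using imJ by (simp add: S'_def)
  ultimately show False using ncon by simp
qed

section \<open>Periodic families of separating sets, and logarithms\<close>

text \<open>The closure of the component meets E: otherwise the component would be open and closed,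
  hence everything.\<close>

lemma connected_component_Un:
  fixes E :: "'a::real_normed_vector set"
  assumes E: "closed E" "connected E" "E \<noteq> {}" and v: "v \<notin> E"
  shows "connected (connected_component_set (- E) v \<union> E)"
proof -
  let ?C = "connected_component_set (- E) v"
  have op: "open ?C" using E by (simp add: open_Compl open_connected_component)
  have vC: "v \<in> ?C" using v by simp
  have "closure ?C \<inter> E \<noteq> {}"
  proof
    assume "closure ?C \<inter> E = {}"
    then have "closure ?C \<subseteq> ?C"
      using subsetD[OF closure_subset vC] connected_imp_connected_closure[OF connected_connected_component]
      by (intro connected_component_maximal) auto
    then have "closed ?C" by (simp add: closure_subset_eq)
    then have "?C = UNIV" using op vC clopen[of ?C] by blast
    then show False using E connected_component_subset[of "- E" v] by auto
  qed
  then obtain e where e: "e \<in> closure ?C" "e \<in> E" by auto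
  have "connected (insert e ?C)"
  proof (rule connected_intermediate_closure[OF connected_connected_component])
    show "?C \<subseteq> insert e ?C" by blast
    show "insert e ?C \<subseteq> closure ?C" using e closure_subset by blast
  qed
  then have "connected (insert e ?C \<union> E)"
    using E e by (intro connected_Un) auto
  moreover have "insert e ?C \<union> E = ?C \<union> E" using e by auto
  ultimately show ?thesis by simp
qed

lemma connected_subset_component:
  assumes "connected T" "T \<inter> E = {}" "x \<in> T" "y \<in> T"
  shows "connected_component (- E) x y"
  using assms by (auto simp: connected_component_def)

text \<open>Deck translates \<open>E k\<close> of a separating closed set: the points \<open>b i\<close> in an orbit cannot all lie
  far out in the same complementary component of \<open>E 0\<close>, since otherwise the bounded sides of the
  \<open>E k\<close> would partition the whole space into disjoint closed sets.\<close>

locale periodic_separators =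
  fixes E :: "int \<Rightarrow> 'a::euclidean_space set" and b :: "int \<Rightarrow> 'a" and t :: 'a
  assumes shiftE: "E k = (\<lambda>v. v + of_int k *\<^sub>R t) ` E 0" and shiftb: "b k = b 0 + of_int k *\<^sub>R t"
    and closedE0: "closed (E 0)" and connE0: "connected (E 0)" and neE0: "E 0 \<noteq> {}"
    and sepE0: "\<not> connected (- E 0)"
    and disj: "i \<noteq> j \<Longrightarrow> E i \<inter> E j = {}"
    and locfin: "compact K \<Longrightarrow> finite {k. E k \<inter> K \<noteq> {}}"
    and bE: "b i \<notin> E k"
    and reach: "v \<notin> (\<Union>k. E k) \<Longrightarrow> \<exists>i. connected_component (- (\<Union>k. E k)) v (b i)"
begin

lemma mem_shift: "v + of_int k *\<^sub>R t \<in> E (l + k) \<longleftrightarrow> v \<in> E l"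
proof -
  have "E (l + k) = (\<lambda>v. v + of_int (l + k) *\<^sub>R t) ` E 0" "E l = (\<lambda>v. v + of_int l *\<^sub>R t) ` E 0"
    by (rule shiftE)+
  then show ?thesis by (auto simp: scaleR_add_left image_iff add.assoc add.commute add.left_commute)
qed

lemma shift_b: "b l + of_int k *\<^sub>R t = b (l + k)"
  by (simp add: shiftb[of l] shiftb[of "l + k"] scaleR_add_left)

lemma closedE: "closed (E k)"
  unfolding shiftE[of k] using closed_translation[OF closedE0, of "of_int k *\<^sub>R t"] by (simp add: add.commute)

lemma connE: "connected (E k)"
  unfolding shiftE[of k] by (intro connected_continuous_image continuous_intros connE0)

lemma neE: "E k \<noteq> {}"
  unfolding shiftE[of k] using neE0 by simp

lemma comp_shift_imp:
  assumes "connected_component (- E l) u v"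
  shows "connected_component (- E (l + k)) (u + of_int k *\<^sub>R t) (v + of_int k *\<^sub>R t)"
proof -
  obtain T where T: "connected T" "T \<subseteq> - E l" "u \<in> T" "v \<in> T"
    using assms by (auto simp: connected_component_def)
  let ?T = "(\<lambda>v. v + of_int k *\<^sub>R t) ` T"
  have "connected ?T" by (intro connected_continuous_image continuous_intros T)
  moreover have "?T \<subseteq> - E (l + k)" using T mem_shift by auto
  ultimately show ?thesis using T by (auto simp: connected_component_def)
qed

lemma comp_shift_b: "connected_component (- E (l + k)) (b (i + k)) (b (j + k)) \<longleftrightarrow> connected_component (- E l) (b i) (b j)"
proof -
  have "b (i + k) - of_int k *\<^sub>R t = b i" "b (j + k) - of_int k *\<^sub>R t = b j"
    by (simp_all add: shift_b[symmetric])
  then show ?thesis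
    using comp_shift_imp[of l "b i" "b j" k] comp_shift_imp[of "l + k" "b (i + k)" "b (j + k)" "- k"]
    by (auto simp: shift_b)
qed

abbreviation R where "R i j \<equiv> connected_component (- E 0) (b i) (b j)"

lemma R_refl: "R i i" using bE by simp
lemma R_sym: "R i j \<Longrightarrow> R j i" by (simp add: connected_component_sym)
lemma R_trans: "R i j \<Longrightarrow> R j k \<Longrightarrow> R i k" by (rule connected_component_trans)

text \<open>By local finiteness almost every translate misses the segment from \<open>b 0\<close> to
  \<open>b 1\<close>. Shifting back, \<open>E 0\<close> fails to separate \<open>b i\<close> from
  its successor for all but finitely many i.\<close>

lemma eventually_R: "\<exists>M>0. (\<forall>i\<ge>M. \<forall>j\<ge>M. R i j) \<and> (\<forall>i\<le>-M. \<forall>j\<le>-M. R i j)"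
proof -
  let ?K = "closed_segment (b 0) (b 1)"
  have fin: "finite {k. E k \<inter> ?K \<noteq> {}}" by (rule locfin) simp
  have "\<not> R (-k) (1-k) \<Longrightarrow> E k \<inter> ?K \<noteq> {}" for k
  proof (rule ccontr)
    assume a: "\<not> R (-k) (1-k)" "\<not> E k \<inter> ?K \<noteq> {}"
    then have "connected_component (- E k) (b 0) (b 1)"
      by (intro connected_subset_component[of ?K]) auto
    then show False using a comp_shift_b[of k "-k" 0 1] by simp
  qed
  then have "finite {k. \<not> R (-k) (1-k)}" using fin by (elim rev_finite_subset) blast
  then obtain M where M: "\<And>k. \<not> R (-k) (1-k) \<Longrightarrow> \<bar>k\<bar> < M" "M > 0"
  proof -
    assume *: "\<And>M. \<lbrakk>\<And>k. \<not> R (- k) (1 - k) \<Longrightarrow> \<bar>k\<bar> < M; 0 < M\<rbrakk> \<Longrightarrow> thesis"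
    let ?S = "{k. \<not> R (-k) (1-k)}"
    have "\<bar>k\<bar> < (\<Sum>k\<in>?S. \<bar>k\<bar>) + 1" if "k \<in> ?S" for k
      using member_le_sum[OF that, of abs] \<open>finite ?S\<close> by auto
    then show thesis by (intro *[of "(\<Sum>k\<in>?S. \<bar>k\<bar>) + 1"]) (auto intro!: add_nonneg_pos sum_nonneg)
  qed
  have st: "R i (i+1)" if "\<bar>i\<bar> \<ge> M" for i
    using M(1)[of "-i"] that by (auto simp: add.commute)
  have up: "R M i" if "i \<ge> M" for i
    using that
  proof (induction i rule: int_ge_induct)
    case base then show ?case by (rule R_refl)
  next
    case (step i) then show ?case using st[of i] R_trans[of M i "i+1"] M by simp
  qed
  have dn: "R (-M) i" if "i \<le> -M" for i
    using that
  proof (induction i rule: int_le_induct)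
    case base then show ?case by (rule R_refl)
  next
    case (step i) then show ?case using R_sym[OF st[of "i-1"]] R_trans[of "-M" i "i-1"] M by simp
  qed
  have "R i j" if "i \<ge> M" "j \<ge> M" for i j
    using R_trans[OF R_sym[OF up[OF that(1)]] up[OF that(2)]] .
  moreover have "R i j" if "i \<le> -M" "j \<le> -M" for i j
    using R_trans[OF R_sym[OF dn[OF that(1)]] dn[OF that(2)]] .
  ultimately show ?thesis using M(2) by blast
qed

text \<open>If both ends lay on the same side of \<open>E 0\<close>, only finitely many base points
  would lie off that side. The closed complements \<open>X k\<close> of the far sides would then be
  pairwise disjoint, cover the space and be met by a segment only finitely often, against
  connectedness of the segment.\<close>

lemma ends_separated:
  obtains M where "M > 0" "\<And>i j. i \<ge> M \<Longrightarrow> j \<le> -M \<Longrightarrow> \<not> R i j"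
proof -
  obtain M where M: "M > 0" "\<And>i j. i \<ge> M \<Longrightarrow> j \<ge> M \<Longrightarrow> R i j" "\<And>i j. i \<le> -M \<Longrightarrow> j \<le> -M \<Longrightarrow> R i j"
    using eventually_R by blast
  have "\<not> R M (-M)"
  proof
    assume RM: "R M (-M)"
    \<comment> \<open>\<open>C k\<close> is the side of \<open>E k\<close> that contains the far
      base points at both ends, \<open>B k\<close> everything else off \<open>E k\<close>, and
      \<open>I\<close> lists the base points in \<open>B 0\<close>.\<close>
    define C where "C k = connected_component_set (- E k) (b (M + k))" for k
    define B where "B k = - E k - C k" for k
    define I where "I = {i. \<not> R M i}"
    have far: "R M i" if "\<bar>i\<bar> \<ge> M" for i
    proof (cases "i \<ge> M")
      case True then show ?thesis using M(2) by simp
    next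
      case False
      then have "i \<le> -M" using that by linarith
      then show ?thesis using M(3)[of "-M" i] RM R_trans by blast
    qed
    have finI: "finite I"
    proof (rule finite_subset)
      show "I \<subseteq> {-M..M}"
      proof
        fix i assume "i \<in> I"
        then have "\<not> \<bar>i\<bar> \<ge> M" using far by (auto simp: I_def)
        then show "i \<in> {-M..M}" by auto
      qed
    qed simp
    have bC: "b (i + k) \<in> C k \<longleftrightarrow> i \<notin> I" for i k
      using comp_shift_b[of 0 k M i] by (simp add: C_def I_def)
    have bB: "b (i + k) \<in> B k \<longleftrightarrow> i \<in> I" for i k
      using bC[of i k] bE by (auto simp: B_def)
    have opC: "open (C k)" for k
      unfolding C_def using closedE by (simp add: open_Compl open_connected_component)
    have CE: "C k \<inter> E k = {}" for k
      using connected_component_subset[of "- E k" "b (M + k)"] by (auto simp: C_def)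
    have conCE: "connected (C k \<union> E k)" for k
      unfolding C_def by (intro connected_component_Un closedE connE neE bE)
    have maxC: "T \<subseteq> C k" if T: "connected T" "T \<inter> E k = {}" "T \<inter> C k \<noteq> {}" for T k
    proof -
      obtain v where v: "v \<in> T" "v \<in> C k" using T by auto
      then have "connected_component_set (- E k) v = C k"
        unfolding C_def by (metis connected_component_eq)
      moreover have "T \<subseteq> connected_component_set (- E k) v"
        using T v by (intro connected_component_maximal) auto
      ultimately show ?thesis by simp
    qed
    have Bne: "B 0 \<noteq> {}"
    proof
      assume "B 0 = {}"
      then have "- E 0 = C 0" using CE[of 0] by (auto simp: B_def)
      then show False using sepE0 connected_connected_component unfolding C_def by metis
    qed
    have far_in: "\<exists>i. i \<notin> I \<and> i + l \<notin> I" for l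
    proof -
      have "M + \<bar>l\<bar> \<notin> I" "M + \<bar>l\<bar> + l \<notin> I" using far M(1) by (auto simp: I_def)
      then show ?thesis by blast
    qed
    have clU: "closed (\<Union>l\<in>{l. l \<noteq> k}. E l)" for k
    proof (subst closed_limpt, intro allI impI)
      fix x assume x: "x islimpt (\<Union>l\<in>{l. l \<noteq> k}. E l)"
      let ?L = "{l. E l \<inter> cball x 1 \<noteq> {}}"
      have fin: "finite ?L" by (rule locfin) simp
      have "x islimpt ((\<Union>l\<in>{l. l \<noteq> k}. E l) \<inter> cball x 1)"
      proof (subst islimpt_approachable, intro allI impI)
        fix e :: real assume "e > 0"
        then obtain y where "y \<in> (\<Union>l\<in>{l. l \<noteq> k}. E l)" "y \<noteq> x" "dist y x < min e 1"
          using x unfolding islimpt_approachable by (metis min_less_iff_conj zero_less_one)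
        then show "\<exists>y\<in>(\<Union>l\<in>{l. l \<noteq> k}. E l) \<inter> cball x 1. y \<noteq> x \<and> dist y x < e"
          by (intro bexI[of _ y]) (auto simp: dist_commute)
      qed
      then have "x islimpt (\<Union>l\<in>?L \<inter> {l. l \<noteq> k}. E l)"
        by (rule islimpt_subset) auto
      moreover have "closed (\<Union>l\<in>?L \<inter> {l. l \<noteq> k}. E l)"
        using fin closedE by (intro closed_UN) auto
      ultimately show "x \<in> (\<Union>l\<in>{l. l \<noteq> k}. E l)"
        by (auto simp: closed_limpt)
    qed
    \<comment> \<open>If no base point lay in \<open>B 0\<close>, then by \<open>reach\<close> every
      point of \<open>B 0\<close> would lie on a translate. A component inside \<open>B 0\<close>
      would then be a disjoint union of relatively closed pieces, hence a single \<open>E k\<close>,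
      which would be open and closed.\<close>
    have Ine: "I \<noteq> {}"
    proof -
      have "\<exists>v\<in>B 0. v \<notin> (\<Union>k. E k)"
      proof (rule ccontr)
        assume "\<not> (\<exists>v\<in>B 0. v \<notin> (\<Union>k. E k))"
        then have BU: "B 0 \<subseteq> (\<Union>k. E k)" by auto
        obtain v where v: "v \<in> B 0" using Bne by auto
        then obtain k where k: "v \<in> E k" using BU by auto
        have k0: "k \<noteq> 0" using v k by (auto simp: B_def)
        let ?Q = "connected_component_set (- E 0) v"
        have vE: "v \<notin> E 0" using v by (auto simp: B_def)
        have QB: "?Q \<subseteq> B 0"
        proof -
          have "?Q \<inter> C 0 = {}"
          proof (rule ccontr)
            assume "?Q \<inter> C 0 \<noteq> {}"
            then have "?Q \<subseteq> C 0"
              using connected_component_subset[of "- E 0" v] by (intro maxC) auto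
            moreover have "v \<in> ?Q" using vE by simp
            ultimately show False using v unfolding B_def by blast
          qed
          then show ?thesis using connected_component_subset[of "- E 0" v] by (auto simp: B_def)
        qed
        have EQ: "E k \<subseteq> ?Q"
          using k disj[OF k0] connE by (intro connected_component_maximal) auto
        define Q W where "Q = ?Q" and "W = (\<Union>l\<in>{l. l \<noteq> k}. E l)"
        have Q: "connected Q" "open Q" "E k \<subseteq> Q" "Q \<subseteq> E k \<union> W"
          unfolding Q_def using closedE[of 0] EQ QB BU
          by (auto simp: open_Compl open_connected_component W_def)
        have W: "closed W" "E k \<inter> W = {}" unfolding W_def using clU disj by auto
        have "Q = E k"
        proof (rule ccontr)
          assume "Q \<noteq> E k"
          then have "W \<inter> Q \<noteq> {}" using Q by auto
          moreover have "E k \<inter> W \<inter> Q = {}" using W by auto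
          moreover have "E k \<inter> Q \<noteq> {}" using Q(3) neE[of k] by blast
          ultimately show False
            using connected_closedD[OF Q(1) _ Q(4) closedE W(1)] by simp
        qed
        then have "open (E k)" using Q(2) by simp
        then have "E k = UNIV" using closedE[of k] neE clopen by blast
        then show False using disj[OF k0] neE[of 0] by auto
      qed
      then obtain v where v: "v \<in> B 0" "v \<notin> (\<Union>k. E k)" by auto
      then obtain i where i: "connected_component (- (\<Union>k. E k)) v (b i)" using reach by blast
      then have vi: "connected_component (- E 0) v (b i)"
        unfolding connected_component_def by blast
      have "b i \<notin> C 0"
      proof
        assume "b i \<in> C 0"
        then have "v \<in> C 0"
          using connected_component_trans[OF _ connected_component_sym[OF vi]] by (simp add: C_def)
        then show False using v by (simp add: B_def)
      qed
      then show ?thesis using bC[of i 0] by auto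
    qed
    \<comment> \<open>Otherwise \<open>E k\<close> lies beyond \<open>E l\<close>, and the inner
      part of k is contained in that of l.\<close>
    have EC: "E k \<subseteq> C l" if kl: "k \<noteq> l" for k l
    proof (rule ccontr)
      assume n: "\<not> E k \<subseteq> C l"
      then have "E k \<inter> C l = {}" using maxC[OF connE, of k l] disj[OF kl] by auto
      then have "(C l \<union> E l) \<inter> E k = {}" using disj[OF kl] by auto
      moreover obtain i where i: "i \<notin> I" "i + (l - k) \<notin> I" using far_in by blast
      then have "b (i + l) \<in> C l" "b (i + l) \<in> C k"
        using bC[of i l] bC[of "i + (l - k)" k] by auto
      ultimately have "C l \<union> E l \<subseteq> C k" using maxC[OF conCE] by blast
      then have "B k \<subseteq> B l" by (auto simp: B_def)
      \<comment> \<open>Now \<open>I\<close> is mapped into itself by a nonzero translation. For a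
        finite nonempty set of integers this is impossible, as comparing sums of elements
        shows.\<close>
      then have *: "i \<in> I \<Longrightarrow> i + (k - l) \<in> I" for i
        using bB[of i k] bB[of "i + (k - l)" l] by auto
      then have "(\<lambda>i. i + (k - l)) ` I \<subseteq> I" by auto
      then have "(\<lambda>i. i + (k - l)) ` I = I"
        using finI by (intro card_subset_eq) (auto simp: card_image inj_on_def)
      then have "(\<Sum>i\<in>I. i + (k - l)) = (\<Sum>i\<in>I. i)"
        using sum.reindex[of "\<lambda>i. i + (k - l)" I "\<lambda>i. i"] by (simp add: inj_on_def)
      then have "of_nat (card I) * (k - l) = 0" by (simp add: sum.distrib)
      then show False using Ine finI kl by auto
    qed
    define X where "X k = B k \<union> E k" for k
    have Xc: "X k = - C k" for k using CE[of k] by (auto simp: X_def B_def)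
    have clX: "closed (X k)" for k using opC by (simp add: Xc closed_open)
    have XX: "X k \<inter> X l = {}" if kl: "k \<noteq> l" for k l
    proof -
      have "v \<in> C l" if v: "v \<in> B k" for v
      proof -
        let ?Q = "connected_component_set (- E k) v"
        have vE: "v \<notin> E k" using v by (auto simp: B_def)
        have "?Q \<inter> C k = {}"
        proof (rule ccontr)
          assume "?Q \<inter> C k \<noteq> {}"
          then have "?Q \<subseteq> C k"
            using connected_component_subset[of "- E k" v] by (intro maxC) auto
          moreover have "v \<in> ?Q" using vE by simp
          ultimately show False using v unfolding B_def by blast
        qed
        moreover define Q where "Q = ?Q"
        ultimately have "(Q \<union> E k) \<inter> E l = {}"
          using EC[of l k] kl disj[OF kl] by blast
        moreover have "connected (Q \<union> E k)"
          unfolding Q_def by (intro connected_component_Un closedE connE neE vE)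
        moreover have "(Q \<union> E k) \<inter> C l \<noteq> {}" using EC[OF kl] neE[of k] by blast
        ultimately have "Q \<union> E k \<subseteq> C l" using maxC by blast
        moreover have "v \<in> Q" using vE by (simp add: Q_def)
        ultimately show ?thesis by blast
      qed
      then show ?thesis using EC[OF kl] unfolding Xc[of l] by (auto simp: X_def)
    qed
    \<comment> \<open>A point off all translates is joined to some \<open>b l\<close>; for any i in
      \<open>I\<close> that base point lies in the inner part of index l - i, and so does the given
      point.\<close>
    have cover: "\<exists>k. v \<in> X k" for v
    proof (cases "v \<in> (\<Union>k. E k)")
      case False
      then obtain l where l: "connected_component (- (\<Union>k. E k)) v (b l)" using reach by blast
      obtain i where i: "i \<in> I" using Ine by auto
      let ?k = "l - i"
      have "connected_component (- E ?k) v (b l)"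
        using l unfolding connected_component_def by blast
      moreover have "b l \<notin> C ?k" using bC[of i ?k] i by auto
      ultimately have "v \<notin> C ?k"
        unfolding C_def using connected_component_trans[of "- E ?k" _ v "b l"] by auto
      then show ?thesis by (auto simp: Xc)
    qed (auto simp: X_def)
    obtain i where i: "i \<in> I" using Ine by auto
    let ?K = "closed_segment (b i) (b (i + 1))"
    let ?L = "{k. E k \<inter> ?K \<noteq> {}}"
    have fin: "finite ?L" by (rule locfin) simp
    have biX: "b i \<in> X 0" "b (i + 1) \<in> X 1" using bB[of i 0] bB[of i 1] i by (auto simp: X_def)
    have hit: "k \<in> ?L" if "?K \<inter> X k \<noteq> {}" for k
    proof (rule ccontr)
      assume k: "k \<notin> ?L"
      then have "?K \<inter> C k = {}"
        using that maxC[of ?K k] by (auto simp: Xc)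
      then have "b i \<in> X k" "b (i + 1) \<in> X k" by (auto simp: Xc)
      then have "k = 0" "k = 1" using biX XX[of k 0] XX[of k 1] by blast+
      then show False by simp
    qed
    let ?Y = "\<Union>k\<in>?L - {0}. X k"
    have "closed ?Y" using fin clX by (intro closed_UN) auto
    moreover have "?K \<subseteq> X 0 \<union> ?Y" using cover hit by blast
    moreover have "X 0 \<inter> ?Y \<inter> ?K = {}" using XX[of 0] by auto
    moreover have "X 0 \<inter> ?K \<noteq> {}" using biX by auto
    moreover have "?Y \<inter> ?K \<noteq> {}"
    proof -
      have bK: "b (i + 1) \<in> ?K" by simp
      then have "?K \<inter> X 1 \<noteq> {}" using biX(2) by blast
      then have "1 \<in> ?L - {0}" using hit[of 1] by simp
      then have "b (i + 1) \<in> ?Y" using biX(2) by (rule UN_I)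
      then show ?thesis using bK by blast
    qed
    ultimately show False
      using connected_closedD[of ?K "X 0" ?Y] clX by simp
  qed
  then have "\<not> R i j" if "i \<ge> M" "j \<le> -M" for i j
    using R_trans[OF M(2)[of M i] R_trans[OF _ M(3)[of j "-M"]]] that by auto
  then show thesis using M(1) that by blast
qed

text \<open>In each residue class modulo j the base points run from one end to the other, and the
  ends are separated by \<open>E 0\<close>. Hence some step of length j in the class crosses
  \<open>E 0\<close>. Translating this step to the pair \<open>b 0\<close>, \<open>b j\<close> gives
  one separator per class, and different classes give different indices.\<close>

lemma many_separators:
  assumes "j > 0"
  obtains K where "finite K" "card K = j" "\<And>k. k \<in> K \<Longrightarrow> \<not> connected_component (- E k) (b 0) (b (int j))"
proof -
  obtain M where M: "M > 0" "\<And>i j. i \<ge> M \<Longrightarrow> j \<le> -M \<Longrightarrow> \<not> R i j" using ends_separated by blast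
  have "\<exists>i. i mod int j = int a \<and> \<not> R i (i + int j)" if a: "a < j" for a
  proof (rule ccontr)
    assume "\<not> ?thesis"
    then have st: "R i (i + int j)" if "i mod int j = int a" for i using that by blast
    have md: "(int a + int j * q) mod int j = int a" for q
      using a by simp
    have ch: "R (int a - int j * M) (int a - int j * M + int j * int m)" for m
    proof (induction m)
      case 0 then show ?case using R_refl by simp
    next
      case (Suc m)
      have "(int a - int j * M + int j * int m) mod int j = int a"
        using md[of "int m - M"] by (simp add: algebra_simps)
      from R_trans[OF Suc st[OF this]] show ?case by (simp add: algebra_simps)
    qed
    have "R (int a - int j * M) (int a - int j * M + int j * int (nat (2 * M)))" by (rule ch)
    moreover have "int a - int j * M + int j * int (nat (2 * M)) = int a + int j * M"
      using M by (simp add: algebra_simps)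
    moreover have "M \<le> int a + int j * M"
    proof -
      have "1 * M \<le> int j * M" using assms M(1) by (intro mult_right_mono) auto
      then show ?thesis by simp
    qed
    moreover have "R (int a + int j * (- M - 1)) (int a - int j * M)"
      using st[OF md[of "- M - 1"]] by (simp add: algebra_simps)
    moreover have "int a + int j * (- M - 1) \<le> - M"
    proof -
      have "1 * M \<le> int j * M" using assms M by (intro mult_right_mono) auto
      moreover have "int a + int j * (- M - 1) = (int a - int j) - int j * M" by (simp add: algebra_simps)
      ultimately show ?thesis using a by linarith
    qed
    ultimately have "R (int a + int j * (- M - 1)) (int a + int j * M)"
      "M \<le> int a + int j * M" "int a + int j * (- M - 1) \<le> - M"
      using R_trans[of "int a + int j * (- M - 1)" "int a - int j * M"] by metis+
    then show False using M(2) R_sym by blast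
  qed
  then obtain i where i: "\<And>a. a < j \<Longrightarrow> i a mod int j = int a" "\<And>a. a < j \<Longrightarrow> \<not> R (i a) (i a + int j)"
    by metis
  let ?K = "(\<lambda>a. - i a) ` {..<j}"
  have inj: "inj_on (\<lambda>a. - i a) {..<j}"
    by (rule inj_onI) (metis i(1) lessThan_iff neg_equal_iff_equal of_nat_eq_iff)
  have "\<not> connected_component (- E k) (b 0) (b (int j))" if k: "k \<in> ?K" for k
  proof -
    obtain a where a: "a < j" "k = - i a" using k by auto
    then show ?thesis using i(2)[of a] comp_shift_b[of 0 "- i a" "i a" "i a + int j"] by simp
  qed
  moreover have "card ?K = j" using card_image[OF inj] by simp
  ultimately show thesis using that by blast
qed

end

text \<open>A set \<open>E\<close> without topology carries every nonvanishing function on one of its sides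
  to a function with a logarithm: cut off along \<open>E\<close> and extend by Tietze.\<close>

lemma logarithm_on_side:
  fixes h :: "'a::euclidean_space \<Rightarrow> complex"
  assumes E: "closed E" "contractible E" and h: "continuous_on UNIV h"
    and nz: "\<And>u. connected_component (- E) v u \<or> u \<in> E \<Longrightarrow> h u \<noteq> 0"
  obtains m where "continuous_on UNIV m" "\<And>u. connected_component (- E) v u \<Longrightarrow> h u = exp (m u)"
proof -
  define C where "C = connected_component_set (- E) v"
  have op: "open C" unfolding C_def using E by (simp add: open_Compl open_connected_component)
  have CE: "C \<inter> E = {}" unfolding C_def using connected_component_subset[of "- E" v] by blast
  have clCE: "closed (C \<union> E)"
  proof -
    \<comment> \<open>The closure of a side adds points of \<open>E\<close> only, so side and
      separator together are closed and functions can be pasted there.\<close>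
    have "closure C \<inter> - E \<subseteq> C"
    proof (cases "C = {}")
      case False
      then have "v \<in> - E" unfolding C_def by (metis connected_component_eq_empty)
      then have vC: "v \<in> C" by (simp add: C_def)
      have "connected (closure C \<inter> - E)"
      proof (rule connected_intermediate_closure)
        show "connected C" by (simp add: C_def)
        show "C \<subseteq> closure C \<inter> - E" using CE closure_subset by blast
      qed blast
      then show ?thesis unfolding C_def using vC closure_subset \<open>v \<in> - E\<close>
        by (intro connected_component_maximal) (auto simp: C_def[symmetric])
    qed simp
    then have "closure (C \<union> E) \<subseteq> C \<union> E"
      using E(1) by (auto simp: closure_Un closure_closed)
    then show ?thesis using closure_subset_eq by blast
  qed
  obtain l where l: "continuous_on E l" "\<And>u. u \<in> E \<Longrightarrow> h u = exp (l u)"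
    using continuous_logarithm_on_contractible[of E h] E nz continuous_on_subset[OF h] by (metis subset_UNIV)
  obtain l' where l': "continuous_on UNIV l'" "\<And>u. u \<in> E \<Longrightarrow> l' u = l u"
    using Tietze_unbounded[of E l UNIV] l(1) E(1) by auto
  define G where "G u = (if u \<in> C \<union> E then h u else exp (l' u))" for u
  have "continuous_on ((C \<union> E) \<union> (- C)) G"
    unfolding G_def
  proof (rule continuous_on_cases)
    show "closed (C \<union> E)" "closed (- C)" using clCE op by auto
    show "continuous_on (C \<union> E) h" using h continuous_on_subset by blast
    show "continuous_on (- C) (\<lambda>u. exp (l' u))"
      by (intro continuous_intros continuous_on_subset[OF l'(1)]) auto
    show "\<forall>x. x \<in> C \<union> E \<and> x \<notin> C \<union> E \<or> x \<in> - C \<and> x \<in> C \<union> E \<longrightarrow> h x = exp (l' x)"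
      using l l' by auto
  qed
  moreover have "(C \<union> E) \<union> (- C) = UNIV" by auto
  ultimately have "continuous_on UNIV G" by simp
  moreover have "G u \<noteq> 0" for u using nz unfolding G_def C_def by auto
  ultimately obtain m where m: "continuous_on UNIV m" "\<And>u. G u = exp (m u)"
    using continuous_logarithm_on_contractible[of UNIV G] convex_imp_contractible[OF convex_UNIV]
    by (metis UNIV_I)
  have "h u = exp (m u)" if "connected_component (- E) v u" for u
    using m(2)[of u] that by (simp add: G_def C_def)
  then show thesis using that[OF m(1)] by blast
qed

text \<open>The hypothesis \<open>proper\<close> says that images run off to infinity when the
  argument approaches a limit outside U. So a convergent sequence of images has preimages
  accumulating inside U, and the map is closed.\<close>

lemma proper_embedding:
  fixes e :: "'a::euclidean_space \<Rightarrow> 'b::euclidean_space"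
  assumes K: "compact K" "U \<subseteq> K" and e: "continuous_on U e" "inj_on e U"
    and proper: "\<And>x l. \<lbrakk>\<And>n. x n \<in> U; x \<longlonglongrightarrow> l; l \<in> K; bounded (range (\<lambda>n. e (x n)))\<rbrakk> \<Longrightarrow> l \<in> U"
  shows "closed (e ` U)" "U homeomorphic (e ` U)"
proof -
  have cl: "closed (e ` C)" if C: "closedin (top_of_set U) C" for C
    unfolding closed_sequential_limits
  proof (intro allI impI, elim conjE)
    fix y l assume y: "\<forall>n. y n \<in> e ` C" and lim: "y \<longlonglongrightarrow> l"
    have CU: "C \<subseteq> U" using C closedin_imp_subset by blast
    have "\<forall>n. \<exists>x. x \<in> C \<and> y n = e x" using y by blast
    then obtain x where "\<forall>n. x n \<in> C \<and> y n = e (x n)" by (rule choice[THEN exE])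
    then have x: "\<And>n. x n \<in> C" "\<And>n. y n = e (x n)" by auto
    have "\<forall>n. x n \<in> K" using x(1) CU K(2) by blast
    then obtain r a where r: "strict_mono (r::nat\<Rightarrow>nat)" "a \<in> K" "(x \<circ> r) \<longlonglongrightarrow> a"
      using K(1)[unfolded compact_def] by blast
    have "bounded (range (\<lambda>n. e ((x \<circ> r) n)))"
    proof -
      have "bounded (range y)" using lim convergent_imp_bounded by blast
      then show ?thesis using x(2) by (elim bounded_subset) auto
    qed
    then have aU: "a \<in> U" using proper[of "x \<circ> r" a] r x(1) CU by auto
    then have aC: "a \<in> C"
    proof -
      obtain T where T: "closed T" "C = U \<inter> T" using C unfolding closedin_closed by blast
      have "(x \<circ> r) n \<in> T" for n using x(1)[of "r n"] T(2) by simp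
      then have "a \<in> T" using closed_sequentially[OF T(1) _ r(3)] by blast
      then show ?thesis using T(2) aU by blast
    qed
    have "(\<lambda>n. e ((x \<circ> r) n)) \<longlonglongrightarrow> e a"
      using subsetD[OF CU x(1)] by (intro continuous_on_tendsto_compose[OF e(1) r(3) aU]) simp
    moreover have "(\<lambda>n. e ((x \<circ> r) n)) = y \<circ> r" using x(2) by (auto simp: fun_eq_iff)
    ultimately have "l = e a"
      using LIMSEQ_subseq_LIMSEQ[OF lim r(1)] LIMSEQ_unique by metis
    then show "l \<in> e ` C" using aC by auto
  qed
  show "closed (e ` U)" using cl[of U] by simp
  have "closedin (top_of_set (e ` U)) (e ` C)" if C: "closedin (top_of_set U) C" for C
    using cl[OF C] closedin_imp_subset[OF C] by (intro closed_subset image_mono)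
  then have "\<exists>g. homeomorphism U (e ` U) e g"
    using homeomorphism_injective_closed_map[OF e(1) refl e(2)] by metis
  then show "U homeomorphic (e ` U)" unfolding homeomorphic_def by blast
qed

section \<open>The curve as a zero set, and coordinates on its complement\<close>

lemma stp_mono: "x \<le> y \<Longrightarrow> stp x \<le> stp y"
proof -
  assume xy: "x \<le> y"
  have mono: "flat_exp 0 a \<le> flat_exp 0 b" if "a \<le> b" for a b
    using that by (auto simp: flat_exp_def le_imp_inverse_le)
  have "flat_exp 0 x * flat_exp 0 (1 - y) \<le> flat_exp 0 y * flat_exp 0 (1 - x)"
    using mono[OF xy] mono[of "1 - y" "1 - x"] xy flat_exp0(1) by (intro mult_mono) auto
  then show ?thesis
    unfolding stp_def using stp_den[of x] stp_den[of y]
    by (simp add: divide_simps algebra_simps)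
qed

text \<open>The twist takes place for Re z1 in [3/5, 4/5], while \<open>spread\<close> vanishes on
  the larger interval [11/20, 17/20]. The margin is needed since \<open>spread\<close> is evaluated
  at the first coordinate in space, which on the curve differs from Re z1 by a factor within about
  one percent of 1.\<close>

definition tstep :: "real \<Rightarrow> real" where "tstep t = stp (5 * t - 3)"
definition spread :: "real \<Rightarrow> real" where "spread t = stp (11 - 20 * t) + stp (20 * t - 17)"

lemma tstep_simps: "t \<le> 3/5 \<Longrightarrow> tstep t = 0" "t \<ge> 4/5 \<Longrightarrow> tstep t = 1"
  by (auto simp: tstep_def stp_0 stp_1)
lemma tstep_mono: "x \<le> y \<Longrightarrow> tstep x \<le> tstep y" by (auto simp: tstep_def stp_mono)
lemma Cinf_on_tstep: "Cinf_on UNIV tstep"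
  unfolding tstep_def by (rule Cinf_on_compose[OF Cinf_on_stp]) (auto intro!: Cinf_intros)
lemma spread_simps: "t \<le> 1/2 \<Longrightarrow> spread t = 1" "t \<ge> 9/10 \<Longrightarrow> spread t = 1"
  "11/20 \<le> t \<Longrightarrow> t \<le> 17/20 \<Longrightarrow> spread t = 0"
  by (auto simp: spread_def stp_0 stp_1)
lemma spread_nonneg: "spread t \<ge> 0" using stp_bounds by (auto simp: spread_def)
lemma Cinf_on_spread: "Cinf_on UNIV spread"
  unfolding spread_def
  by (intro Cinf_on_add open_UNIV; rule Cinf_on_compose[OF Cinf_on_stp]) (auto intro!: Cinf_intros)

locale twist =
  fixes n :: nat and d :: real
  assumes n1: "n \<ge> 1" and d0: "0 < d" and d1: "d \<le> 1/100"
begin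

text \<open>On the curve |z1| is \<open>rad\<close> and |ww| is \<open>d\<close>; \<open>kap\<close>
  is the coefficient with kap * rad = d^2 that makes this consistent with \<open>FF\<close> =
  0.\<close>

definition "rad = sqrt (1 - d\<^sup>2)"
definition "kap = d\<^sup>2 / rad"
text \<open>Vertical stretch by 1 + 1/d where \<open>spread\<close> is 1, so that a gap of size
  \<open>d\<close> gets height of order one.\<close>

definition "sc x = 1 + spread x / d"
text \<open>The total angle is a multiple of 2 pi, so that \<open>ww\<close> equals
  \<open>z2\<close> on both sides of the twist.\<close>

definition "psi t = 4 * pi * real n * tstep t"
definition "zz p = p $ 3 / sc (p $ 1)" for p :: "real^3"
definition "NN p = 1 + (p $ 1)\<^sup>2 + (p $ 2)\<^sup>2 + (zz p)\<^sup>2" for p :: "real^3"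
text \<open>Together with \<open>z2\<close> this is inverse stereographic projection onto the unit
  sphere, after undoing the vertical stretch; the missing point is z2 = 1.\<close>

definition "z1 p = Complex (2 * p $ 1 / NN p) (2 * p $ 2 / NN p)" for p :: "real^3"
definition "z2 p = Complex ((NN p - 2) / NN p) (2 * zz p / NN p)" for p :: "real^3"
definition "ww p = z2 p * cis (- psi (Re (z1 p)))" for p :: "real^3"
definition "FF p = (ww p)\<^sup>2 + of_real kap * cis (pi/4) * z1 p" for p :: "real^3"
definition "zeta p = ww p / of_real (sqrt (cmod (FF p)))" for p :: "real^3"
text \<open>Stereographic projection from z2 = 1 followed by the vertical stretch, inverse to the
  pair \<open>z1\<close>, \<open>z2\<close>.\<close>

definition "PP a b = (let x = Re a / (1 - Re b) in
  vector [x, Im a / (1 - Re b), sc x * (Im b / (1 - Re b))] :: real^3)" for a b :: complex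

lemma dsq: "0 < d\<^sup>2" "d\<^sup>2 \<le> 1/10000"
  using d0 d1 power_mono[of d "1/100" 2] by (auto simp: power2_eq_square)
lemma rad: "0 < rad" "rad \<le> 1" "rad\<^sup>2 = 1 - d\<^sup>2" "99/100 \<le> rad"
proof -
  show "rad\<^sup>2 = 1 - d\<^sup>2" "0 < rad" "rad \<le> 1" using dsq by (auto simp: rad_def)
  show "99/100 \<le> rad" unfolding rad_def by (rule real_le_rsqrt) (use dsq in \<open>auto simp: power2_eq_square\<close>)
qed
lemma kap: "0 < kap" "kap \<le> 1/100"
proof -
  show "0 < kap" using dsq rad by (simp add: kap_def)
  have "d\<^sup>2 \<le> 1/100 * rad" using dsq rad by simp
  then show "kap \<le> 1/100" using rad by (simp add: kap_def divide_simps)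
qed
lemma sc_ge1: "sc x \<ge> 1" using spread_nonneg[of x] d0 by (simp add: sc_def)
lemma sc_pos: "sc x > 0" using sc_ge1[of x] by linarith
lemma sc_nz: "sc x \<noteq> 0" using sc_pos[of x] by simp
lemma NN_ge1: "NN p \<ge> 1" by (simp add: NN_def)
lemma NN_pos: "NN p > 0" using NN_ge1[of p] by linarith
lemma NN_nz: "NN p \<noteq> 0" using NN_pos[of p] by simp

lemma z_norm: "(cmod (z1 p))\<^sup>2 + (cmod (z2 p))\<^sup>2 = 1"
proof -
  have eq: "(2 * p $ 1)\<^sup>2 + (2 * p $ 2)\<^sup>2 + (NN p - 2)\<^sup>2 + (2 * zz p)\<^sup>2 = (NN p)\<^sup>2"
    by (simp add: NN_def power2_eq_square algebra_simps)
  have "(cmod (z1 p))\<^sup>2 + (cmod (z2 p))\<^sup>2 = ((2 * p $ 1)\<^sup>2 + (2 * p $ 2)\<^sup>2 + (NN p - 2)\<^sup>2 + (2 * zz p)\<^sup>2) / (NN p)\<^sup>2"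
    by (simp add: cmod_power2 z1_def z2_def power_divide add_divide_distrib)
  then show ?thesis unfolding eq using NN_nz[of p] by simp
qed

lemma z2_Re: "1 - Re (z2 p) = 2 / NN p" "Re (z2 p) < 1"
  using NN_pos[of p] by (auto simp: z2_def divide_simps)

lemma PP_inverse: "PP (z1 p) (z2 p) = p"
proof -
  have a: "Re (z1 p) / (1 - Re (z2 p)) = p $ 1" "Im (z1 p) / (1 - Re (z2 p)) = p $ 2"
    "Im (z2 p) / (1 - Re (z2 p)) = zz p"
    unfolding z2_Re using NN_nz[of p] by (auto simp: z1_def z2_def)
  have "sc (p $ 1) * zz p = p $ 3" using sc_nz[of "p $ 1"] by (simp add: zz_def)
  then show ?thesis
    unfolding PP_def Let_def a by (simp add: vec_eq_iff forall_3 vector_3)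
qed

lemma z_PP:
  assumes "(cmod a)\<^sup>2 + (cmod b)\<^sup>2 = 1" "Re b < 1"
  shows "z1 (PP a b) = a" "z2 (PP a b) = b"
proof -
  define u where "u = 1 - Re b"
  have u: "u > 0" using assms by (simp add: u_def)
  have c: "PP a b $ 1 = Re a / u" "PP a b $ 2 = Im a / u" "PP a b $ 3 = sc (Re a / u) * (Im b / u)"
    by (auto simp: PP_def Let_def u_def vector_3)
  have z: "zz (PP a b) = Im b / u" unfolding zz_def c using sc_nz by simp
  have "(Re a)\<^sup>2 + (Im a)\<^sup>2 + (Im b)\<^sup>2 = 1 - (Re b)\<^sup>2" using assms(1) by (simp add: cmod_power2)
  also have "\<dots> = u * (2 - u)" by (simp add: u_def power2_eq_square algebra_simps)
  finally have "(Re a)\<^sup>2 + (Im a)\<^sup>2 + (Im b)\<^sup>2 = u * (2 - u)" .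
  then have "((Re a)\<^sup>2 + (Im a)\<^sup>2 + (Im b)\<^sup>2) / u\<^sup>2 = (2 - u) / u"
    using u by (simp add: power2_eq_square)
  moreover have "NN (PP a b) = 1 + ((Re a)\<^sup>2 + (Im a)\<^sup>2 + (Im b)\<^sup>2) / u\<^sup>2"
    unfolding NN_def z c by (simp add: power_divide add_divide_distrib)
  ultimately have "NN (PP a b) = 1 + (2 - u) / u" by simp
  then have N: "NN (PP a b) = 2 / u" using u by (simp add: diff_divide_distrib)
  show "z1 (PP a b) = a" unfolding z1_def N c using u by (simp add: complex_eq_iff)
  show "z2 (PP a b) = b" proof -
    have "(2 / u - 2) / (2 / u) = 1 - u" using u by (simp add: field_simps)
    then show ?thesis unfolding z2_def N z using u by (simp add: complex_eq_iff) (simp add: u_def)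
  qed
qed

lemma Cinf_on_psi: "Cinf_on UNIV psi"
  unfolding psi_def by (intro Cinf_intros Cinf_on_compose[OF Cinf_on_tstep]) auto

lemma Cinf_on_sc: "Cinf_on UNIV sc"
  unfolding sc_def using d0 by (intro Cinf_intros Cinf_on_compose[OF Cinf_on_spread]) auto

lemma continuous_psi: "continuous_on S psi"
  unfolding psi_def by (intro continuous_intros continuous_on_subset[OF Cinf_on_continuous[OF Cinf_on_tstep]]) auto

lemma continuous_sc: "continuous_on S sc"
  unfolding sc_def using d0
  by (intro continuous_intros continuous_on_subset[OF Cinf_on_continuous[OF Cinf_on_spread]]) auto

lemma continuous_zz: "continuous_on S zz"
  unfolding zz_def using sc_nz
  by (intro continuous_intros continuous_on_compose2[OF continuous_sc[of UNIV]]) auto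

lemma continuous_NN: "continuous_on S NN"
  unfolding NN_def by (intro continuous_intros continuous_zz)

lemma continuous_z1: "continuous_on S z1"
  unfolding z1_def Complex_eq using NN_nz by (intro continuous_intros continuous_NN) auto
lemma continuous_z2: "continuous_on S z2"
  unfolding z2_def Complex_eq using NN_nz by (intro continuous_intros continuous_NN continuous_zz) auto
lemma continuous_ww: "continuous_on S ww"
  unfolding ww_def cis_conv_exp
  by (intro continuous_intros continuous_z2 continuous_z1 continuous_on_compose2[OF continuous_psi[of UNIV]]) auto
lemma continuous_FF: "continuous_on S FF"
  unfolding FF_def by (intro continuous_intros continuous_z1 continuous_ww)
lemma continuous_zeta: "(\<And>p. p \<in> S \<Longrightarrow> FF p \<noteq> 0) \<Longrightarrow> continuous_on S zeta"
  unfolding zeta_def by (intro continuous_intros continuous_FF continuous_ww) auto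

lemma ww_norm: "cmod (ww p) = cmod (z2 p)" by (simp add: ww_def norm_mult)
lemma z2_ww: "z2 p = ww p * cis (psi (Re (z1 p)))" by (simp add: ww_def cis_mult)
lemma z1_FF: "of_real kap * cis (pi/4) * z1 p = FF p - (ww p)\<^sup>2" by (simp add: FF_def)
lemma kc_nz: "of_real kap * cis (pi/4) \<noteq> (0::complex)" using kap by simp

text \<open>Equal data mean that the pairs (z1, ww) lie on one orbit of the scaling by m^2 and m.
  The squared norm is strictly increasing in m, so the unit sphere meets an orbit once.\<close>

lemma lift_injective:
  assumes F: "FF p \<noteq> 0" "FF q \<noteq> 0" and s: "sgn (FF p) = sgn (FF q)" and z: "zeta p = zeta q"
  shows "p = q"
proof -
  define m where "m = sqrt (cmod (FF q) / cmod (FF p))"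
  have m: "m > 0" "m\<^sup>2 = cmod (FF q) / cmod (FF p)" using F by (auto simp: m_def)
  have Fq: "FF q = of_real (m\<^sup>2) * FF p"
  proof -
    have "FF q = of_real (cmod (FF q)) * sgn (FF q)" using F by (simp add: sgn_eq)
    also have "\<dots> = of_real (cmod (FF q)) * (FF p / of_real (cmod (FF p)))" using s sgn_eq[of "FF p"] by simp
    also have "\<dots> = of_real (cmod (FF q) / cmod (FF p)) * FF p" by simp
    finally show ?thesis by (simp only: m(2))
  qed
  have wq: "ww q = of_real m * ww p"
  proof -
    have "ww q = zeta q * of_real (sqrt (cmod (FF q)))" using F by (simp add: zeta_def)
    also have "\<dots> = ww p * of_real (sqrt (cmod (FF q)) / sqrt (cmod (FF p)))"
    proof -
      have zq: "zeta q = ww p / of_real (sqrt (cmod (FF p)))" using z zeta_def[of p] by simp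
      show ?thesis unfolding zq by simp
    qed
    also have "\<dots> = of_real m * ww p" by (simp add: m_def real_sqrt_divide)
    finally show ?thesis .
  qed
  have "of_real kap * cis (pi/4) * z1 q = of_real kap * cis (pi/4) * (of_real (m\<^sup>2) * z1 p)"
    using z1_FF[of p] unfolding z1_FF[of q] Fq wq by (simp add: power_mult_distrib right_diff_distrib mult.left_commute mult.assoc)
  then have z1q: "z1 q = of_real (m\<^sup>2) * z1 p" using kc_nz mult_left_cancel by blast
  have eq: "(m\<^sup>2)\<^sup>2 * (cmod (z1 p))\<^sup>2 + m\<^sup>2 * (cmod (z2 p))\<^sup>2 = (cmod (z1 p))\<^sup>2 + (cmod (z2 p))\<^sup>2"
  proof -
    have "cmod (z1 q) = m\<^sup>2 * cmod (z1 p)" using z1q by (simp add: norm_mult norm_power m(1))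
    moreover have "cmod (z2 q) = m * cmod (z2 p)"
      using wq m(1) by (simp add: ww_norm[symmetric] norm_mult)
    ultimately show ?thesis using z_norm[of p] z_norm[of q] by (simp add: power_mult_distrib)
  qed
  have "m = 1"
  proof -
    define M a c where "M = m\<^sup>2" and "a = (cmod (z1 p))\<^sup>2" and "c = (cmod (z2 p))\<^sup>2"
    have ac: "a \<ge> 0" "c \<ge> 0" "a + c = 1" "M > 0" using z_norm[of p] m(1) by (auto simp: a_def c_def M_def)
    have "(M - 1) * ((M + 1) * a + c) = 0"
      using eq unfolding M_def[symmetric] a_def[symmetric] c_def[symmetric]
      by (simp add: algebra_simps power2_eq_square)
    moreover have "(M + 1) * a + c > 0"
    proof -
      have "M * a \<ge> 0" using ac by simp
      moreover have "(M + 1) * a + c = M * a + 1" using ac by (simp add: algebra_simps)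
      ultimately show ?thesis by linarith
    qed
    ultimately have "M = 1" by simp
    then show ?thesis using m(1) by (simp add: M_def power2_eq_1_iff)
  qed
  then have "z1 q = z1 p" "ww q = ww p" using z1q wq by auto
  then have "z1 q = z1 p" "z2 q = z2 p" by (auto simp: z2_ww)
  then show ?thesis using PP_inverse[of p] PP_inverse[of q] by simp
qed

text \<open>The value of \<open>z1\<close> forced by FF = X and ww = z. The following definitions
  rescale this pair by \<open>ll\<close> onto the unit sphere, untwist \<open>ww\<close> to get
  \<open>z2\<close>, and project to space.\<close>

definition "AA X z = (X - z\<^sup>2) * cis (- (pi/4)) / of_real kap" for X z :: complex
text \<open>Positive root of l^2 |A|^2 + l |z|^2 = 1, in the form that stays valid when A
  vanishes.\<close>

definition "ll X z = 2 / ((cmod z)\<^sup>2 + sqrt ((cmod z)^4 + 4 * (cmod (AA X z))\<^sup>2))" for X z :: complex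
definition "b1 X z = of_real (ll X z) * AA X z" for X z :: complex
definition "b2 X z = of_real (sqrt (ll X z)) * z * cis (psi (Re (b1 X z)))" for X z :: complex
definition "XX X z = PP (b1 X z) (b2 X z)" for X z :: complex

lemma AA_eq: "of_real kap * cis (pi/4) * AA X z = X - z\<^sup>2"
proof -
  have "of_real kap * cis (pi/4) * AA X z = (X - z\<^sup>2) * (cis (pi/4) * cis (- (pi/4)))"
    using kap by (simp add: AA_def)
  then show ?thesis by (simp add: cis_mult)
qed

lemma ll_root:
  assumes "X \<noteq> 0 \<or> z \<noteq> 0"
  shows "ll X z > 0" "(ll X z)\<^sup>2 * (cmod (AA X z))\<^sup>2 + ll X z * (cmod z)\<^sup>2 = 1"
proof -
  define u v where "u = (cmod z)\<^sup>2" and "v = (cmod (AA X z))\<^sup>2"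
  have uv: "u \<ge> 0" "v \<ge> 0" "u > 0 \<or> v > 0"
  proof -
    show "u \<ge> 0" "v \<ge> 0" by (auto simp: u_def v_def)
    show "u > 0 \<or> v > 0"
    proof (cases "z = 0")
      case True
      then have "AA X z \<noteq> 0" using assms AA_eq[of X z] by auto
      then show ?thesis by (simp add: v_def)
    qed (simp add: u_def)
  qed
  have s: "sqrt (u\<^sup>2 + 4 * v) \<ge> 0" "(sqrt (u\<^sup>2 + 4 * v))\<^sup>2 = u\<^sup>2 + 4 * v" using uv by auto
  have D: "u + sqrt (u\<^sup>2 + 4 * v) > 0"
    using uv(3)
  proof
    assume "v > 0"
    then have "sqrt (u\<^sup>2 + 4 * v) > 0" using uv by (simp add: add_nonneg_pos)
    then show ?thesis using uv(1) by linarith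
  qed (use s(1) in linarith)
  have le: "ll X z = 2 / (u + sqrt (u\<^sup>2 + 4 * v))"
    unfolding ll_def u_def v_def by (simp add: power_mult[symmetric])
  show "ll X z > 0" unfolding le using D by simp
  define q where "q = sqrt (u\<^sup>2 + 4 * v)"
  have q: "q\<^sup>2 = u\<^sup>2 + 4 * v" "u + q > 0" using s D by (auto simp: q_def)
  have "(2 / (u + q))\<^sup>2 * v + 2 / (u + q) * u = (4 * v + 2 * u * (u + q)) / (u + q)\<^sup>2"
  proof -
    have "2 / (u + q) * u = (2 * u * (u + q)) / (u + q)\<^sup>2" using q(2) by (simp add: power2_eq_square)
    moreover have "(2 / (u + q))\<^sup>2 * v = (4 * v) / (u + q)\<^sup>2" by (simp add: power_divide)
    ultimately show ?thesis by (simp add: add_divide_distrib)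
  qed
  also have "4 * v + 2 * u * (u + q) = (u + q)\<^sup>2"
    using q(1) by (simp add: power2_eq_square algebra_simps)
  finally have "(2 / (u + q))\<^sup>2 * v + 2 / (u + q) * u = 1" using q(2) by simp
  then show "(ll X z)\<^sup>2 * (cmod (AA X z))\<^sup>2 + ll X z * (cmod z)\<^sup>2 = 1"
    unfolding le q_def u_def v_def by simp
qed

lemma b_norm:
  assumes "X \<noteq> 0 \<or> z \<noteq> 0"
  shows "(cmod (b1 X z))\<^sup>2 + (cmod (b2 X z))\<^sup>2 = 1"
  using ll_root[OF assms] by (simp add: b1_def b2_def norm_mult power_mult_distrib)

text \<open>The excluded parameters are those of the orbit through the missing point of the sphere,
  where z1 = 0 and z2 = 1. There Re z1 = 0, so the twist angle is 0.\<close>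

lemma Re_b2:
  assumes nz: "X \<noteq> 0 \<or> z \<noteq> 0" and ex: "\<not> (X = z\<^sup>2 \<and> Im z = 0 \<and> Re z > 0)"
  shows "Re (b2 X z) < 1"
proof (rule ccontr)
  assume a: "\<not> Re (b2 X z) < 1"
  have "(cmod (b2 X z))\<^sup>2 \<le> 1" using b_norm[OF nz] zero_le_power2[of "cmod (b1 X z)"] by linarith
  then have le: "(Re (b2 X z))\<^sup>2 + (Im (b2 X z))\<^sup>2 \<le> 1" by (simp add: cmod_power2)
  have "(Re (b2 X z))\<^sup>2 \<ge> 1" using a by (simp add: one_le_power)
  then have "(Im (b2 X z))\<^sup>2 \<le> 0" "(Re (b2 X z))\<^sup>2 = 1" using le zero_le_power2[of "Im (b2 X z)"] by linarith+
  then have b2: "Im (b2 X z) = 0" "Re (b2 X z) = 1" using a by (auto simp: power2_eq_1_iff)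
  then have "(cmod (b2 X z))\<^sup>2 = 1" by (simp add: cmod_power2)
  then have "b1 X z = 0" using b_norm[OF nz] by simp
  then have A: "AA X z = 0" and b2': "b2 X z = of_real (sqrt (ll X z)) * z"
    using ll_root[OF nz] by (auto simp: b1_def b2_def psi_def tstep_simps)
  then have "X = z\<^sup>2" using AA_eq[of X z] by simp
  moreover have "Im z = 0" "Re z > 0"
    using b2 ll_root(1)[OF nz] unfolding b2' by (auto simp: zero_less_mult_iff) (metis mult_pos_pos real_sqrt_gt_zero zero_less_one zero_less_mult_pos)
  ultimately show False using ex by simp
qed

lemma XX_props:
  assumes nz: "X \<noteq> 0 \<or> z \<noteq> 0" and ex: "\<not> (X = z\<^sup>2 \<and> Im z = 0 \<and> Re z > 0)"
  shows "z1 (XX X z) = b1 X z" "z2 (XX X z) = b2 X z" "ww (XX X z) = of_real (sqrt (ll X z)) * z"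
    "FF (XX X z) = of_real (ll X z) * X"
proof -
  show z: "z1 (XX X z) = b1 X z" "z2 (XX X z) = b2 X z"
    unfolding XX_def using z_PP[OF b_norm[OF nz] Re_b2[OF nz ex]] by auto
  show w: "ww (XX X z) = of_real (sqrt (ll X z)) * z"
    unfolding ww_def z by (simp add: b2_def cis_mult mult.assoc)
  have "FF (XX X z) = of_real (ll X z) * z\<^sup>2 + of_real (ll X z) * (of_real kap * cis (pi/4) * AA X z)"
    unfolding FF_def w z using ll_root(1)[OF nz]
    by (simp add: power_mult_distrib b1_def mult.left_commute flip: of_real_power)
  also have "\<dots> = of_real (ll X z) * X" unfolding AA_eq by (simp add: algebra_simps)
  finally show "FF (XX X z) = of_real (ll X z) * X" .
qed

lemma lift_surjective:
  assumes "\<not> (cis a = 1 \<and> z = 1)"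
  obtains p where "FF p \<noteq> 0" "sgn (FF p) = cis a" "zeta p = z" "z1 p = b1 (cis a) z" "z2 p = b2 (cis a) z"
proof -
  have nz: "cis a \<noteq> 0 \<or> z \<noteq> 0" by simp
  have ex: "\<not> (cis a = z\<^sup>2 \<and> Im z = 0 \<and> Re z > 0)"
  proof
    assume a: "cis a = z\<^sup>2 \<and> Im z = 0 \<and> Re z > 0"
    then have "z = of_real (Re z)" by (simp add: complex_eq_iff)
    moreover have "cmod z = 1" using a by (metis norm_cis norm_power power2_eq_1_iff norm_ge_zero le_minus_one_simps(3) norm_power power2_eq_square not_one_le_zero neg_0_le_iff_le zero_neq_one order_trans zero_le_one)
    ultimately have "z = 1" using a by (metis norm_of_real abs_of_pos of_real_1)
    then show False using a assms by simp
  qed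
  note p = XX_props[OF nz ex]
  have l: "ll (cis a) z > 0" using ll_root[OF nz] by simp
  have "FF (XX (cis a) z) \<noteq> 0" unfolding p using l by simp
  moreover have "sgn (FF (XX (cis a) z)) = cis a" unfolding p using l by (simp add: sgn_mult sgn_of_real)
  moreover have "zeta (XX (cis a) z) = z" unfolding zeta_def p using l by (simp add: norm_mult)
  ultimately show thesis using that p by blast
qed

text \<open>With t = |z1| the unit norm reads t^2 + kap t = 1, whose only nonnegative root is
  \<open>rad\<close>.\<close>

lemma FF_zero:
  assumes "FF p = 0"
  shows "cmod (ww p) = d" "cmod (z1 p) = rad" "z1 p = - (ww p)\<^sup>2 * cis (- (pi/4)) / of_real kap"
proof -
  have e: "(ww p)\<^sup>2 = - (of_real kap * cis (pi/4) * z1 p)" using assms by (simp add: FF_def add_eq_0_iff)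
  then have "cmod ((ww p)\<^sup>2) = kap * cmod (z1 p)" using kap by (simp add: norm_mult)
  then have e2: "(cmod (ww p))\<^sup>2 = kap * cmod (z1 p)" by (simp add: norm_power)
  define t where "t = cmod (z1 p)"
  have t: "t \<ge> 0" "t\<^sup>2 + kap * t = 1" using z_norm[of p] e2 by (auto simp: t_def ww_norm)
  have r: "rad\<^sup>2 + kap * rad = 1" using rad dsq by (simp add: kap_def)
  have "(t - rad) * (t + rad + kap) = 0" using t(2) r by (simp add: algebra_simps power2_eq_square)
  moreover have "t + rad + kap > 0" using t rad kap by linarith
  ultimately have "t = rad" by simp
  then show "cmod (z1 p) = rad" by (simp add: t_def)
  then have "(cmod (ww p))\<^sup>2 = d\<^sup>2" using e2 rad by (simp add: kap_def)
  then show "cmod (ww p) = d" using d0 by (simp add: power2_eq_iff_nonneg)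
  have "- (ww p)\<^sup>2 * cis (- (pi/4)) / of_real kap = z1 p * (cis (pi/4) * cis (- (pi/4)))"
    unfolding e using kap by simp
  then show "z1 p = - (ww p)\<^sup>2 * cis (- (pi/4)) / of_real kap" by (simp add: cis_mult)
qed

text \<open>These data belong to the orbit through z2 = 1, the image of infinity. So the lift misses
  this value, and its preimages in the cover are the base points.\<close>

lemma FF_not_one: "\<not> (sgn (FF p) = 1 \<and> zeta p = 1)"
proof
  assume a: "sgn (FF p) = 1 \<and> zeta p = 1"
  then have F0: "FF p \<noteq> 0" by auto
  have F: "FF p = of_real (cmod (FF p))" using a F0 by (simp add: sgn_eq)
  have w: "ww p = of_real (sqrt (cmod (FF p)))" using a F0 by (simp add: zeta_def)
  have "(ww p)\<^sup>2 = FF p" unfolding w by (subst F) (simp flip: of_real_power)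
  then have "z1 p = 0" using z1_FF[of p] kc_nz by simp
  then have "z2 p = ww p" "(cmod (z2 p))\<^sup>2 = 1" using z_norm[of p] by (auto simp: ww_def psi_def tstep_simps)
  then have "z2 p = ww p" "cmod (z2 p) = 1" using norm_ge_zero[of "ww p"] by (auto simp: power2_eq_1_iff)
  then have "z2 p = 1" unfolding w by (simp add: norm_of_real)
  then show False using z2_Re(2)[of p] by simp
qed

text \<open>Since 1 - Re z2 = 2/NN, both |z2 - 1| and |z1| are at most 2/sqrt NN. The bound 16 keeps
  Re z1 below 3/5, where no twist has begun.\<close>

lemma FF_near_infinity:
  assumes "NN p \<ge> 16"
  shows "cmod (FF p - 1) \<le> 5 / sqrt (NN p)" "cmod (ww p - 1) \<le> 2 / sqrt (NN p)"
proof -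
  have N: "NN p > 0" "sqrt (NN p) > 0" using assms by auto
  have n1: "cmod (z2 p) \<le> 1" "cmod (z1 p) \<le> 1"
    using z_norm[of p] by (smt (verit) norm_ge_zero one_less_power pos2 zero_le_power2)+
  have "(cmod (z2 p - 1))\<^sup>2 = (cmod (z2 p))\<^sup>2 + 1 - 2 * Re (z2 p)"
    by (simp only: cmod_power2) (simp add: power2_eq_square algebra_simps)
  also have "\<dots> \<le> 2 * (1 - Re (z2 p))" using n1 by (simp add: power_le_one)
  also have "\<dots> = (2 / sqrt (NN p))\<^sup>2" unfolding z2_Re using N by (simp add: power_divide)
  finally have a: "cmod (z2 p - 1) \<le> 2 / sqrt (NN p)" by (rule power2_le_imp_le) (use N in simp)
  have "Re (z2 p) \<ge> -1" using abs_Re_le_cmod[of "z2 p"] n1 by linarith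
  have "(cmod (z1 p))\<^sup>2 \<le> 1 - (Re (z2 p))\<^sup>2" using z_norm[of p] zero_le_power2[of "Im (z2 p)"] unfolding cmod_power2 by linarith
  also have "\<dots> = (1 - Re (z2 p)) * (1 + Re (z2 p))" by (simp add: power2_eq_square algebra_simps)
  also have "\<dots> \<le> (1 - Re (z2 p)) * 2" using z2_Re(2)[of p] by (intro mult_left_mono) auto
  also have "\<dots> = (2 / sqrt (NN p))\<^sup>2" unfolding z2_Re using N by (simp add: power_divide)
  finally have b: "cmod (z1 p) \<le> 2 / sqrt (NN p)" by (rule power2_le_imp_le) (use N in simp)
  have "sqrt (NN p) \<ge> 4" using real_sqrt_le_mono[OF assms] by simp
  then have "2 / sqrt (NN p) \<le> 2 / 4" using N by (intro divide_left_mono) auto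
  then have "Re (z1 p) \<le> 3/5" using b abs_Re_le_cmod[of "z1 p"] by linarith
  then have w: "ww p = z2 p" by (simp add: ww_def psi_def tstep_simps)
  then show "cmod (ww p - 1) \<le> 2 / sqrt (NN p)" using a by simp
  have "FF p - 1 = (z2 p - 1) * (z2 p + 1) + of_real kap * cis (pi/4) * z1 p"
    by (simp add: FF_def w power2_eq_square algebra_simps)
  then have "cmod (FF p - 1) \<le> cmod (z2 p - 1) * cmod (z2 p + 1) + kap * cmod (z1 p)"
    using kap norm_triangle_ineq[of "(z2 p - 1) * (z2 p + 1)" "of_real kap * cis (pi/4) * z1 p"]
    by (simp add: norm_mult)
  also have "\<dots> \<le> (2 / sqrt (NN p)) * 2 + 1/100 * (2 / sqrt (NN p))"
    using a b kap n1 norm_triangle_ineq[of "z2 p" 1] N by (intro add_mono mult_mono) auto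
  also have "\<dots> \<le> 5 / sqrt (NN p)" using N by (simp add: field_simps)
  finally show "cmod (FF p - 1) \<le> 5 / sqrt (NN p)" .
qed

text \<open>Near the coordinate axes the twist is trivial, so z2^2 = -kap e^(i pi/4) z1. With z1
  close to a real or imaginary number of modulus \<open>rad\<close>, the phase pi/4 keeps z2 away
  from the real axis, by a multiple of \<open>d\<close>. The vertical stretch turns this into a
  height independent of \<open>d\<close>.\<close>

lemma FF_zero_height:
  assumes F: "FF p = 0" and xy: "\<bar>p $ 1\<bar> \<le> 1/100 \<or> \<bar>p $ 2\<bar> \<le> 1/100"
  shows "\<bar>p $ 3\<bar> \<ge> 1/8"
proof -
  note z = FF_zero[OF F]
  have n1: "cmod (z2 p) = d" using z ww_norm by simp
  have Nb: "1 / NN p \<ge> 49/100" "1 / NN p \<le> 51/100"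
  proof -
    have "\<bar>Re (z2 p)\<bar> \<le> 1/100" using abs_Re_le_cmod[of "z2 p"] n1 d1 by linarith
    then show "1 / NN p \<ge> 49/100" "1 / NN p \<le> 51/100" using z2_Re(1)[of p] by (auto simp: field_simps)
  qed
  have comp: "Re (z1 p) = 2 * p $ 1 * (1 / NN p)" "Im (z1 p) = 2 * p $ 2 * (1 / NN p)" by (auto simp: z1_def)
  have sm: "\<bar>2 * t * (1 / NN p)\<bar> \<le> 2/100" if "\<bar>t\<bar> \<le> 1/100" for t
  proof -
    have "\<bar>2 * t * (1 / NN p)\<bar> \<le> 2 * (1/100) * 1" unfolding abs_mult using that Nb by (intro mult_mono) auto
    then show ?thesis by simp
  qed
  have small: "\<bar>Re (z1 p)\<bar> \<le> 2/100 \<or> \<bar>Im (z1 p)\<bar> \<le> 2/100" unfolding comp using xy sm by blast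
  have r2: "(Re (z1 p))\<^sup>2 + (Im (z1 p))\<^sup>2 = rad\<^sup>2" using z(2) by (simp flip: cmod_power2)
  have bnd: "\<bar>Re (z1 p)\<bar> \<le> rad" "\<bar>Im (z1 p)\<bar> \<le> rad" using z(2) abs_Re_le_cmod abs_Im_le_cmod by metis+
  \<comment> \<open>One of Re z1, Im z1 is small and the modulus is nearly 1, so the point is clear
    of the windows of both twist and spreading.\<close>
  have far: "p $ 1 \<le> 1/2 \<and> Re (z1 p) \<le> 3/5 \<or> p $ 1 \<ge> 9/10 \<and> Re (z1 p) \<ge> 4/5"
  proof (cases "\<bar>Re (z1 p)\<bar> \<le> 2/100")
    case True
    have "p $ 1 = Re (z1 p) / (2 * (1 / NN p))" unfolding comp using NN_nz[of p] by simp
    moreover have "Re (z1 p) / (2 * (1 / NN p)) \<le> 1/2"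
    proof -
      have "Re (z1 p) \<le> 1/2 * (2 * (1 / NN p))" using True Nb by simp
      then show ?thesis using NN_pos[of p] by (simp add: field_simps)
    qed
    ultimately show ?thesis using True by auto
  next
    case False
    then have "\<bar>Im (z1 p)\<bar> \<le> 2/100" using small by blast
    then have "(Im (z1 p))\<^sup>2 \<le> (2/100)\<^sup>2" by (metis abs_le_square_iff abs_of_nonneg zero_le_divide_iff zero_le_numeral)
    moreover have "rad\<^sup>2 \<ge> 9999/10000" using rad dsq by simp
    ultimately have "(Re (z1 p))\<^sup>2 \<ge> (97/100)\<^sup>2" using r2 by (simp add: power2_eq_square)
    then have "\<bar>Re (z1 p)\<bar> \<ge> 97/100" by (metis abs_le_square_iff abs_of_nonneg zero_le_divide_iff zero_le_numeral)
    then consider "Re (z1 p) \<ge> 97/100" | "Re (z1 p) \<le> - 97/100" by linarith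
    then show ?thesis
    proof cases
      case 1
      have "p $ 1 \<ge> 9/10"
      proof (rule ccontr)
        assume "\<not> p $ 1 \<ge> 9/10"
        then have "2 * p $ 1 * (1 / NN p) \<le> 2 * (9/10) * (1 / NN p)" using NN_pos[of p] by (intro mult_right_mono) auto
        also have "\<dots> \<le> 2 * (9/10) * (51/100)" using Nb by (intro mult_left_mono) auto
        finally show False using 1 comp by simp
      qed
      then show ?thesis using 1 by simp
    next
      case 2
      have "p $ 1 \<le> 0"
      proof (rule ccontr)
        assume "\<not> p $ 1 \<le> 0"
        then have "2 * p $ 1 * (1 / NN p) \<ge> 0" using NN_pos[of p] by simp
        then show False using 2 comp by simp
      qed
      then show ?thesis using 2 by simp
    qed
  qed
  then have spr: "spread (p $ 1) = 1" and ts: "tstep (Re (z1 p)) = 0 \<or> tstep (Re (z1 p)) = 1"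
    by (auto simp: spread_simps tstep_simps)
  have cw: "ww p = z2 p"
  proof -
    have "cis (- psi (Re (z1 p))) = 1"
      using ts
    proof
      assume "tstep (Re (z1 p)) = 1"
      then have "- psi (Re (z1 p)) = 2 * pi * of_int (- 2 * int n)" by (simp add: psi_def)
      then show ?thesis using cis_multiple_2pi[of "of_int (- 2 * int n)"] by (simp only: Ints_of_int)
    qed (simp add: psi_def)
    then show ?thesis by (simp add: ww_def)
  qed
  have "(z2 p)\<^sup>2 = - (of_real kap * cis (pi/4) * z1 p)" using F cw by (simp add: FF_def add_eq_0_iff)
  then have "Re ((z2 p)\<^sup>2) = - (kap * (Re (z1 p) - Im (z1 p)) / sqrt 2)"
    by (simp add: cos_45 sin_45 field_simps)
  moreover have "Re ((z2 p)\<^sup>2) = d\<^sup>2 - 2 * (Im (z2 p))\<^sup>2"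
  proof -
    have "d\<^sup>2 = (Re (z2 p))\<^sup>2 + (Im (z2 p))\<^sup>2" using cmod_power2[of "z2 p"] n1 by simp
    then show ?thesis by (simp add: power2_eq_square)
  qed
  ultimately have I: "2 * (Im (z2 p))\<^sup>2 = d\<^sup>2 + kap * (Re (z1 p) - Im (z1 p)) / sqrt 2" by linarith
  have "Re (z1 p) - Im (z1 p) \<ge> - (102/100)" using small bnd rad by linarith
  then have "(Re (z1 p) - Im (z1 p)) / sqrt 2 \<ge> - (102/100) / sqrt 2" by (rule divide_right_mono) simp
  moreover have "(102/100) / sqrt 2 \<le> 8/10"
  proof -
    have "102/80 \<le> sqrt (2::real)" by (rule real_le_rsqrt) (simp add: power2_eq_square)
    then show ?thesis by (simp add: field_simps)
  qed
  ultimately have "(Re (z1 p) - Im (z1 p)) / sqrt 2 \<ge> - (8/10)" by linarith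
  then have "kap * ((Re (z1 p) - Im (z1 p)) / sqrt 2) \<ge> kap * - (8/10)" using kap by (intro mult_left_mono) auto
  then have "2 * (Im (z2 p))\<^sup>2 \<ge> d\<^sup>2 - kap * (8/10)" using I by simp
  moreover have "kap * (8/10) \<le> d\<^sup>2 * (85/100)"
  proof -
    have "kap = d\<^sup>2 * (1 / rad)" by (simp add: kap_def)
    moreover have "1 / rad \<le> 100/99" using rad by (simp add: field_simps)
    then have "d\<^sup>2 * (1 / rad) \<le> d\<^sup>2 * (100/99)" by (intro mult_left_mono) auto
    ultimately show ?thesis using dsq by linarith
  qed
  \<comment> \<open>At least 15/100 of d^2 remains for 2 (Im z2)^2, which exceeds d^2/8.\<close>
  ultimately have "(Im (z2 p))\<^sup>2 \<ge> d\<^sup>2 / 16" using dsq(1) by linarith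
  then have "(Im (z2 p))\<^sup>2 \<ge> (d/4)\<^sup>2" by (simp add: power2_eq_square)
  then have "\<bar>Im (z2 p)\<bar> \<ge> d/4" using d0 by (metis abs_le_square_iff abs_of_pos zero_less_divide_iff zero_less_numeral)
  moreover have "Im (z2 p) = 2 * zz p * (1 / NN p)" by (simp add: z2_def)
  ultimately have "d/4 \<le> \<bar>2 * zz p * (1 / NN p)\<bar>" by simp
  also have "\<dots> = 2 * \<bar>zz p\<bar> * (1 / NN p)" using NN_pos[of p] by (simp add: abs_mult)
  also have "\<dots> \<le> 2 * \<bar>zz p\<bar> * (51/100)" using Nb by (intro mult_left_mono) auto
  finally have zb: "\<bar>zz p\<bar> \<ge> d / 8" using d0 by simp
  have "\<bar>p $ 3\<bar> = sc (p $ 1) * \<bar>zz p\<bar>" using sc_pos[of "p $ 1"] by (simp add: zz_def abs_mult)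
  also have "\<dots> \<ge> (1 / d) * (d / 8)"
    using zb d0 spr by (intro mult_mono) (auto simp: sc_def)
  finally show ?thesis using d0 by simp
qed

end

section \<open>Comparison of logarithms\<close>

text \<open>The values lie in 2 pi i times the integers, a discrete set. Applied to differences of
  logarithms of one function, it replaces winding numbers throughout.\<close>

lemma integer_valued_constant:
  fixes f :: "'a::topological_space \<Rightarrow> complex"
  assumes S: "connected S" and f: "continuous_on S f" and e: "\<And>x. x \<in> S \<Longrightarrow> exp (f x) = 1"
    and xy: "x \<in> S" "y \<in> S"
  shows "f x = f y"
proof -
  have "f constant_on S"
  proof (rule continuous_discrete_range_constant[OF S f])
    fix a assume a: "a \<in> S"
    have "1 \<le> norm (f b - f a)" if b: "b \<in> S" "f b \<noteq> f a" for b
    proof -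
      have "exp (f b - f a) = 1" using e a b by (simp add: exp_diff)
      then obtain k where k: "Re (f b - f a) = 0" "Im (f b - f a) = of_int (2 * k) * pi"
        unfolding exp_eq_1 by blast
      have "k \<noteq> 0" using b k by (auto simp: complex_eq_iff)
      then have "\<bar>real_of_int (2 * k)\<bar> \<ge> 2" by linarith
      then have "2 * pi \<le> \<bar>real_of_int (2 * k)\<bar> * pi" by (intro mult_right_mono) auto
      then have "\<bar>Im (f b - f a)\<bar> \<ge> 2 * pi" unfolding k by (simp add: abs_mult)
      then show ?thesis using pi_gt3 abs_Im_le_cmod[of "f b - f a"] by linarith
    qed
    then show "\<exists>e>0. \<forall>y. y \<in> S \<and> f y \<noteq> f a \<longrightarrow> e \<le> norm (f y - f a)"
      by (intro exI[of _ 1]) auto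
  qed
  then show ?thesis using xy by (auto simp: constant_on_def)
qed

text \<open>Off the slit the principal logarithm is continuous, so any other continuous logarithm
  differs from it by a constant.\<close>

lemma log_difference_Ln:
  fixes g :: "'a::topological_space \<Rightarrow> complex"
  assumes S: "connected S" and l: "continuous_on S l" and g: "continuous_on S g"
    and e: "\<And>x. x \<in> S \<Longrightarrow> g x = exp (l x)" and sl: "\<And>x. x \<in> S \<Longrightarrow> g x \<notin> \<real>\<^sub>\<le>\<^sub>0"
    and xy: "x \<in> S" "y \<in> S"
  shows "Im (l x) - Im (l y) = Arg (g x) - Arg (g y)"
proof -
  have nz: "g u \<noteq> 0" if "u \<in> S" for u using e[OF that] by simp
  have "l x - Ln (g x) = l y - Ln (g y)"
  proof (rule integer_valued_constant[OF S _ _ xy])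
    show "continuous_on S (\<lambda>x. l x - Ln (g x))"
      using sl by (intro continuous_intros l g) auto
    show "exp (l u - Ln (g u)) = 1" if "u \<in> S" for u
      using e[OF that] nz[OF that] by (simp add: exp_diff)
  qed
  then have "Im (l x) - Im (Ln (g x)) = Im (l y) - Im (Ln (g y))"
    by (metis minus_complex.simps(2))
  then show ?thesis using Arg_def nz xy by (simp add: Arg_eq_Im_Ln)
qed

text \<open>Adding i pi to the logarithm moves the left half-plane to the right one, where arguments
  stay within (-pi/2, pi/2).\<close>

lemma half_plane_log_difference:
  fixes g :: "'a::topological_space \<Rightarrow> complex"
  assumes S: "connected S" and l: "continuous_on S l" and g: "continuous_on S g"
    and e: "\<And>x. x \<in> S \<Longrightarrow> g x = exp (l x)" and neg: "\<And>x. x \<in> S \<Longrightarrow> Re (g x) < 0"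
    and xy: "x \<in> S" "y \<in> S"
  shows "\<bar>Im (l x) - Im (l y)\<bar> < pi"
proof -
  have "Im (l x + of_real pi * \<i>) - Im (l y + of_real pi * \<i>) = Arg (- g x) - Arg (- g y)"
  proof (rule log_difference_Ln[OF S _ _ _ _ xy])
    show "- g u = exp (l u + of_real pi * \<i>)" if "u \<in> S" for u
      using e[OF that] by (simp add: exp_add)
    show "- g u \<notin> \<real>\<^sub>\<le>\<^sub>0" if "u \<in> S" for u
      using neg[OF that] by (auto simp: complex_nonpos_Reals_iff)
  qed (intro continuous_intros l g)+
  moreover have "\<bar>Arg (- g u)\<bar> < pi/2" if "u \<in> S" for u
    using neg[OF that] unfolding Arg_Re_pos by simp
  then have "\<bar>Arg (- g x)\<bar> < pi/2" "\<bar>Arg (- g y)\<bar> < pi/2" using xy by blast+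
  ultimately show ?thesis by simp
qed

section \<open>The two coordinate axes lifted to the cyclic cover\<close>

context twist
begin

text \<open>The cosine on the single period around -4 pi n, frozen at -1 outside. This removes all
  other lifts of the second axis from the zero set of \<open>hh\<close>.\<close>

definition "Cw t = cos (max (- pi) (min pi (t + 4 * pi * n)))"
text \<open>On the second axis Re z1 = 0 and z2 is real. With fst v the argument of
  \<open>FF\<close> and snd v = zeta, these conditions become the vanishing of the two components;
  sqrt 2 arises from cos(pi/4).\<close>

definition "hh v = Complex (sqrt 2 * Cw (fst v - pi/4) - (Re (snd v))\<^sup>2) (Im (snd v))" for v :: "real \<times> complex"

lemma cos_shift: "cos (t + 4 * pi * real n) = cos t" "sin (t + 4 * pi * real n) = sin t"
proof -
  have e: "4 * pi * real n = real (2 * n) * (2 * pi)" by simp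
  show "cos (t + 4 * pi * real n) = cos t" "sin (t + 4 * pi * real n) = sin t"
    unfolding e cos_add sin_add using cos_2npi[of "2 * n"] sin_2npi[of "2 * n"] by (simp_all add: ac_simps)
qed

lemma Cw_in: "\<bar>t + 4 * pi * n\<bar> \<le> pi \<Longrightarrow> Cw t = cos t"
  using cos_shift[of t] by (simp add: Cw_def)

lemma Cw_out: "\<bar>t + 4 * pi * n\<bar> > pi \<Longrightarrow> Cw t = -1"
  using pi_gt_zero by (auto simp: Cw_def max_def min_def)

lemma continuous_Cw: "continuous_on S Cw"
  unfolding Cw_def by (intro continuous_intros)

lemma continuous_hh: "continuous_on S hh"
  unfolding hh_def Complex_eq
  by (intro continuous_intros continuous_on_compose2[OF continuous_Cw[of UNIV]]) auto

lemma Cw_nonneg: "Cw t \<ge> 0 \<Longrightarrow> \<bar>t + 4 * pi * n\<bar> \<le> pi/2 \<and> Cw t = cos t"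
proof -
  assume a: "Cw t \<ge> 0"
  have "\<bar>t + 4 * pi * n\<bar> \<le> pi" using Cw_out[of t] a by (cases "\<bar>t + 4 * pi * n\<bar> \<le> pi") auto
  then have b: "\<bar>t + 4 * pi * n\<bar> \<le> pi" "Cw t = cos t" using Cw_in by auto
  have "cos \<bar>t + 4 * pi * n\<bar> \<ge> 0" using a b cos_shift[of t] by (simp only: cos_abs_real)
  then have "\<bar>t + 4 * pi * n\<bar> \<le> pi/2"
    using b(1) cos_monotone_0_pi[of "pi/2" "\<bar>t + 4 * pi * n\<bar>"] by (force simp: not_le)
  then show ?thesis using b by simp
qed

text \<open>The zero set of \<open>hh\<close> is one lift of the second coordinate axis.\<close>

lemma hh_zeroD:
  assumes "hh v = 0"
  shows "\<bar>fst v - pi/4 + 4 * pi * n\<bar> \<le> pi/2" "sqrt 2 * cos (fst v - pi/4) = (Re (snd v))\<^sup>2" "Im (snd v) = 0"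
proof -
  have a: "sqrt 2 * Cw (fst v - pi/4) = (Re (snd v))\<^sup>2" "Im (snd v) = 0"
    using assms by (auto simp: hh_def complex_eq_iff)
  then have "Cw (fst v - pi/4) \<ge> 0"
    by (metis linorder_not_less mult_less_0_iff real_sqrt_gt_0_iff zero_le_power2 zero_less_numeral not_less)
  then show "\<bar>fst v - pi/4 + 4 * pi * n\<bar> \<le> pi/2" "sqrt 2 * cos (fst v - pi/4) = (Re (snd v))\<^sup>2" "Im (snd v) = 0"
    using Cw_nonneg[of "fst v - pi/4"] a by auto
qed

text \<open>The two signs of the square root give two arcs over the same interval of angles; they
  meet where the cosine vanishes.\<close>

lemma hh_zero_connected: "connected {v. hh v = 0}"
proof -
  define f where "f e c = (c + pi/4 - 4 * pi * n, Complex (e * sqrt (sqrt 2 * cos c)) 0)" for e c :: real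
  let ?I = "{-pi/2..pi/2}"
  have "continuous_on ?I (f e)" for e
    unfolding f_def Complex_eq by (intro continuous_intros)
  then have con: "connected (f e ` ?I)" for e
    by (intro connected_continuous_image) auto
  have z: "hh (f e c) = 0" if "e \<in> {-1, 1}" "c \<in> ?I" for e c
  proof -
    have c0: "cos c \<ge> 0" using that by (intro cos_ge_zero) auto
    have "Cw (c - 4 * pi * n) = cos c"
      using that cos_shift[of "c - 4 * pi * n"] by (subst Cw_in) auto
    moreover have "(e * sqrt (sqrt 2 * cos c))\<^sup>2 = sqrt 2 * cos c" using that c0 by (auto simp: power_mult_distrib)
    ultimately show ?thesis by (simp add: hh_def f_def complex_eq_iff)
  qed
  have "{v. hh v = 0} = f 1 ` ?I \<union> f (-1) ` ?I"
  proof
    show "f 1 ` ?I \<union> f (-1) ` ?I \<subseteq> {v. hh v = 0}" using z by blast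
    show "{v. hh v = 0} \<subseteq> f 1 ` ?I \<union> f (-1) ` ?I"
    proof
      fix v assume "v \<in> {v. hh v = 0}"
      then have v: "hh v = 0" by simp
      note h = hh_zeroD[OF v]
      define c where "c = fst v - pi/4 + 4 * pi * n"
      have c: "c \<in> ?I" using h(1) unfolding c_def atLeastAtMost_iff by linarith
      have "sqrt 2 * cos c = (Re (snd v))\<^sup>2" using h(2) cos_shift[of "fst v - pi/4"] by (simp add: c_def)
      then have "\<bar>Re (snd v)\<bar> = sqrt (sqrt 2 * cos c)" by simp
      then have "v = f 1 c \<or> v = f (-1) c"
        using h(3) by (cases v) (auto simp: f_def c_def complex_eq_iff)
      then show "v \<in> f 1 ` ?I \<union> f (-1) ` ?I" using c by blast
    qed
  qed
  moreover have "f 1 (pi/2) = f (-1) (pi/2)" by (simp add: f_def)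
  then have "f 1 ` ?I \<inter> f (-1) ` ?I \<noteq> {}" 
  proof -
    have "pi/2 \<in> ?I" using pi_gt_zero by simp
    then show ?thesis using \<open>f 1 (pi/2) = f (-1) (pi/2)\<close> by blast
  qed
  ultimately show ?thesis using con connected_Un by metis
qed

text \<open>The axis closes up at infinity, so its lift passes through a base point, the one of
  index 2n.\<close>

lemma hh_zero_base: "hh (- 4 * pi * n, 1) = 0"
proof -
  have "Cw (- 4 * pi * n - pi/4) = cos (- 4 * pi * n - pi/4)" using pi_gt_zero by (intro Cw_in) simp
  also have "\<dots> = cos (pi/4)" using cos_shift[of "- 4 * pi * n - pi/4"] by simp
  finally have e: "Cw (- 4 * pi * n - pi/4) = sqrt 2 / 2" by (simp add: cos_45)
  have "hh (- 4 * pi * n, 1) = Complex (sqrt 2 * Cw (- 4 * pi * n - pi/4) - 1) 0" by (simp add: hh_def)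
  also have "\<dots> = 0" unfolding e by (simp add: complex_eq_iff)
  finally show ?thesis .
qed

text \<open>The vanishing of \<open>hh\<close> makes \<open>AA\<close> imaginary and zeta real; the
  explicit preimage then has Re z1 = 0 and real z2.\<close>

lemma hh_zero_point:
  assumes h: "hh v = 0" and F: "FF p \<noteq> 0" "sgn (FF p) = cis (fst v)" "zeta p = snd v"
  shows "p $ 1 = 0" "p $ 3 = 0"
proof -
  note z = hh_zeroD[OF h]
  have nn: "\<not> (cis (fst v) = 1 \<and> snd v = 1)" using FF_not_one[of p] F by auto
  obtain q where q: "FF q \<noteq> 0" "sgn (FF q) = cis (fst v)" "zeta q = snd v" "z1 q = b1 (cis (fst v)) (snd v)"
    "z2 q = b2 (cis (fst v)) (snd v)"
    using lift_surjective[OF nn] by blast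
  have pq: "p = q" using lift_injective[OF F(1) q(1)] F q by simp
  let ?X = "cis (fst v)" and ?z = "snd v"
  have "Re ((?X - ?z\<^sup>2) * cis (- (pi/4))) = cos (fst v - pi/4) - (Re ?z)\<^sup>2 * cos (pi/4)"
    using z(3) by (simp add: cos_diff power2_eq_square algebra_simps)
  also have "\<dots> = 0" unfolding z(2)[symmetric] by (simp add: cos_45)
  finally have "Re (AA ?X ?z) = 0" by (simp add: AA_def)
  then have R: "Re (z1 p) = 0" unfolding pq q by (simp add: b1_def)
  then show "p $ 1 = 0" using NN_nz[of p] by (simp add: z1_def)
  have "Im (z2 p) = 0"
    using R z(3) unfolding pq q by (simp add: b2_def psi_def tstep_simps)
  then have "zz p = 0" using NN_nz[of p] by (simp add: z2_def)
  then show "p $ 3 = 0" using sc_nz by (simp add: zz_def)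
qed

definition "xax x = (vector [x, 0, 0] :: real^3)" for x :: real
definition "aa x = 2 * x / (1 + x\<^sup>2)" for x :: real
definition "bb x = (x\<^sup>2 - 1) / (1 + x\<^sup>2)" for x :: real
text \<open>The value of \<open>FF\<close> on the first axis with the twist factored out;
  \<open>aa\<close> and \<open>bb\<close> are the real values of \<open>z1\<close> and
  \<open>z2\<close> there.\<close>

definition "GG x = of_real ((bb x)\<^sup>2) + of_real (kap * aa x) * cis (pi/4 + 2 * psi (aa x))" for x :: real

lemma ab: "(aa x)\<^sup>2 + (bb x)\<^sup>2 = 1" "1 + x\<^sup>2 > 0" "1 + x\<^sup>2 \<noteq> 0"
proof -
  show p: "1 + x\<^sup>2 > 0" by (simp add: add_pos_nonneg)
  then show p': "1 + x\<^sup>2 \<noteq> 0" by linarith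
  have "(aa x)\<^sup>2 + (bb x)\<^sup>2 = ((2 * x)\<^sup>2 + (x\<^sup>2 - 1)\<^sup>2) / (1 + x\<^sup>2)\<^sup>2"
    by (simp add: aa_def bb_def power_divide add_divide_distrib)
  also have "(2 * x)\<^sup>2 + (x\<^sup>2 - 1)\<^sup>2 = (1 + x\<^sup>2)\<^sup>2" by (simp add: power2_eq_square algebra_simps)
  finally show "(aa x)\<^sup>2 + (bb x)\<^sup>2 = 1" using p' by simp
qed

lemma xax_z: "z1 (xax x) = of_real (aa x)" "z2 (xax x) = of_real (bb x)"
  "ww (xax x) = of_real (bb x) * cis (- psi (aa x))" "FF (xax x) = GG x * cis (- 2 * psi (aa x))"
proof -
  have N: "NN (xax x) = 1 + x\<^sup>2" "zz (xax x) = 0" by (auto simp: NN_def zz_def xax_def vector_3)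
  show a: "z1 (xax x) = of_real (aa x)" "z2 (xax x) = of_real (bb x)"
    unfolding z1_def z2_def N by (auto simp: complex_eq_iff xax_def vector_3 aa_def bb_def)
  show w: "ww (xax x) = of_real (bb x) * cis (- psi (aa x))" unfolding ww_def a by simp
  have "GG x * cis (- 2 * psi (aa x)) = of_real ((bb x)\<^sup>2) * cis (- 2 * psi (aa x)) + of_real (kap * aa x) * cis (pi/4)"
    unfolding GG_def by (simp add: algebra_simps cis_mult)
  then show "FF (xax x) = GG x * cis (- 2 * psi (aa x))"
    unfolding FF_def w a by (simp add: power_mult_distrib cis_mult power2_eq_square ac_simps)
qed

lemma cis_psi_const:
  assumes "t \<le> 3/5 \<or> t \<ge> 4/5"
  shows "cis (c + 2 * psi t) = cis c" "sin (psi t) = 0" "psi t = 0 \<or> psi t = 4 * pi * n"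
proof -
  show p: "psi t = 0 \<or> psi t = 4 * pi * n" using assms by (auto simp: psi_def tstep_simps)
  have "cis (c + 2 * (4 * pi * n)) = cis c"
    using cos_shift[of c] cos_shift[of "c + 4 * pi * n"] by (simp add: complex_eq_iff mult_2 add.assoc)
  then show "cis (c + 2 * psi t) = cis c" using p by auto
  show "sin (psi t) = 0" using p cos_shift[of 0] by auto
qed

text \<open>Outside the twist the imaginary part vanishes only for aa = 0, where the value is 1.
  Inside, bb^2 is at least 9/25 and outweighs the term with \<open>kap\<close>.\<close>

lemma GG_slit: "GG x \<notin> \<real>\<^sub>\<le>\<^sub>0"
proof (cases "aa x \<le> 3/5 \<or> aa x \<ge> 4/5")
  case True
  have G: "GG x = of_real ((bb x)\<^sup>2) + of_real (kap * aa x) * cis (pi/4)"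
    unfolding GG_def cis_psi_const(1)[OF True] ..
  show ?thesis
  proof
    assume "GG x \<in> \<real>\<^sub>\<le>\<^sub>0"
    then have I: "Im (GG x) = 0" "Re (GG x) \<le> 0" by (auto simp: complex_nonpos_Reals_iff)
    then have "aa x = 0" unfolding G using kap by (simp add: sin_45)
    then show False using I(2) ab(1)[of x] unfolding G by simp
  qed
next
  case False
  then have a: "\<bar>aa x\<bar> \<le> 4/5" by auto
  then have "(aa x)\<^sup>2 \<le> (4/5)\<^sup>2" by (metis abs_le_square_iff abs_of_nonneg zero_le_divide_iff zero_le_numeral)
  then have b: "(bb x)\<^sup>2 \<ge> 9/25" using ab(1)[of x] by (simp add: power2_eq_square)
  have "\<bar>Re (of_real (kap * aa x) * cis (pi/4 + 2 * psi (aa x)))\<bar> \<le> cmod (of_real (kap * aa x) * cis (pi/4 + 2 * psi (aa x)))"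
    by (rule abs_Re_le_cmod)
  also have "\<dots> = kap * \<bar>aa x\<bar>" using kap by (simp add: norm_mult abs_mult)
  also have "\<dots> \<le> 1/100 * 1" using a kap by (intro mult_mono) auto
  finally have "Re (GG x) > 0" using b unfolding GG_def by simp
  then show ?thesis by (auto simp: complex_nonpos_Reals_iff)
qed

lemma GG_nz: "GG x \<noteq> 0" using GG_slit[of x] by auto
lemma FF_xax_nz: "FF (xax x) \<noteq> 0" unfolding xax_z using GG_nz by simp
lemma FF_xax_norm: "cmod (FF (xax x)) = cmod (GG x)" unfolding xax_z by (simp add: norm_mult)

text \<open>Continuous choice of the argument of \<open>FF\<close> along the first axis:
  \<open>GG\<close> avoids the slit, so its principal argument is continuous, and the rotation
  factored out is added back.\<close>

definition "alx x = Arg (GG x) - 2 * psi (aa x)"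

lemma continuous_GG: "continuous_on S GG"
  unfolding GG_def aa_def bb_def cis_conv_exp using ab(3)
  by (intro continuous_intros continuous_on_compose2[OF continuous_psi[of UNIV]]) auto

lemma continuous_alx: "continuous_on S alx"
  unfolding alx_def aa_def using ab(3) GG_slit
  by (intro continuous_intros continuous_on_compose2[OF continuous_psi[of UNIV]] continuous_on_Arg' continuous_GG) auto

end

section \<open>Winding of the first axis around the lifted second axis\<close>

lemma log_difference_Ln_minus:
  fixes g :: "'a::topological_space \<Rightarrow> complex"
  assumes S: "connected S" and l: "continuous_on S l" and g: "continuous_on S g"
    and e: "\<And>x. x \<in> S \<Longrightarrow> g x = exp (l x)" and sl: "\<And>x. x \<in> S \<Longrightarrow> - g x \<notin> \<real>\<^sub>\<le>\<^sub>0"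
    and xy: "x \<in> S" "y \<in> S"
  shows "Im (l x) - Im (l y) = Arg (- g x) - Arg (- g y)"
proof -
  have "Im (l x + of_real pi * \<i>) - Im (l y + of_real pi * \<i>) = Arg (- g x) - Arg (- g y)"
  proof (rule log_difference_Ln[OF S _ _ _ sl xy])
    show "- g u = exp (l u + of_real pi * \<i>)" if "u \<in> S" for u
      using e[OF that] by (simp add: exp_add)
  qed (intro continuous_intros l g)+
  then show ?thesis by simp
qed

lemma continuous_on_vector3:
  fixes f g h :: "'a::topological_space \<Rightarrow> real"
  assumes "continuous_on S f" "continuous_on S g" "continuous_on S h"
  shows "continuous_on S (\<lambda>x. vector [f x, g x, h x] :: real^3)"
proof -
  have "(vector [a, b, c] :: real^3) = a *\<^sub>R axis 1 1 + b *\<^sub>R axis 2 1 + c *\<^sub>R axis 3 1" for a b c :: real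
    by (simp add: vec_eq_iff forall_3 axis_def vector_3)
  then show ?thesis using assms by (simp only:) (intro continuous_intros)
qed

lemma Arg_minus_lower: "Im z < 0 \<Longrightarrow> Arg (- z) = Arg z + pi"
  using Arg_minus[of z] Arg_neg_iff[of z] by (cases "z = 0") auto
lemma Arg_minus_upper: "Im z > 0 \<Longrightarrow> Arg (- z) = Arg z - pi"
  using Arg_minus[of z] Arg_pos_iff[of z] by (cases "z = 0") auto

context twist
begin

definition "uax x = (alx x, zeta (xax x))"

lemma zeta_xax: "Re (zeta (xax x)) = bb x * cos (psi (aa x)) / sqrt (cmod (GG x))"
  "Im (zeta (xax x)) = - bb x * sin (psi (aa x)) / sqrt (cmod (GG x))"
  by (simp_all add: zeta_def FF_xax_norm xax_z(3))

lemma Im_hh_uax: "Im (hh (uax x)) = - bb x * sin (psi (aa x)) / sqrt (cmod (GG x))"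
  by (simp add: hh_def uax_def zeta_xax)

lemma bb_zero: "bb x = 0 \<Longrightarrow> sin (psi (aa x)) = 0"
proof -
  assume "bb x = 0"
  then have "aa x = 1 \<or> aa x = -1" using ab(1)[of x] by (simp add: power2_eq_1_iff)
  then show ?thesis using cis_psi_const(2)[of "aa x"] by auto
qed

lemma Arg_bounds:
  assumes "Im z \<ge> 0" "Im z \<le> Re z" "z \<noteq> 0"
  shows "0 \<le> Arg z" "Arg z \<le> pi/4"
proof -
  show a0: "0 \<le> Arg z" using assms Arg_less_0 by blast
  have zz: "Re z = cmod z * cos (Arg z)" "Im z = cmod z * sin (Arg z)"
    by (metis Re_rcis rcis_cmod_Arg, metis Im_rcis rcis_cmod_Arg)
  have "sin (Arg z - pi/4) = (sin (Arg z) - cos (Arg z)) * (sqrt 2 / 2)"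
    unfolding sin_diff sin_45 cos_45 by (simp add: left_diff_distrib)
  then have "cmod z * sin (Arg z - pi/4) = (Im z - Re z) * (sqrt 2 / 2)"
    by (simp only: zz mult.assoc right_diff_distrib left_diff_distrib)
  also have "\<dots> \<le> 0" using assms by (intro mult_nonpos_nonneg) auto
  finally have "sin (Arg z - pi/4) \<le> 0" using assms(3) by (simp add: mult_le_0_iff)
  then show "Arg z \<le> pi/4"
    using sin_gt_zero[of "Arg z - pi/4"] Arg_le_pi[of z] pi_gt_zero by (smt (verit) divide_pos_pos)
qed

text \<open>When the value is real, psi is a multiple of pi and the lift is at the angle of
  \<open>GG\<close> shifted by a multiple of 2 pi. Only psi = 2 pi n falls into the window of
  \<open>Cw\<close>, so the positive half-line is crossed at that level only.\<close>

lemma hh_uax_real: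
  assumes I: "Im (hh (uax x)) = 0"
  shows "psi (aa x) = 2 * pi * n \<Longrightarrow> Re (hh (uax x)) > 0" "psi (aa x) \<noteq> 2 * pi * n \<Longrightarrow> Re (hh (uax x)) < 0"
proof -
  have s0: "sin (psi (aa x)) = 0" using I bb_zero[of x] GG_nz[of x] by (auto simp: Im_hh_uax)
  then obtain i :: int where i: "psi (aa x) = of_int i * pi" using sin_zero_iff_int2 by blast
  have c2: "cis (pi/4 + 2 * psi (aa x)) = cis (pi/4)"
  proof -
    have "cis (2 * psi (aa x)) = 1"
      unfolding i using cis_multiple_2pi[of "of_int i"] by (simp add: mult.commute mult.left_commute)
    then show ?thesis by (simp flip: cis_mult)
  qed
  have G: "GG x = of_real ((bb x)\<^sup>2) + of_real (kap * aa x) * cis (pi/4)" unfolding GG_def c2 ..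
  have ReG: "Re (GG x) = (bb x)\<^sup>2 + kap * aa x / sqrt 2" and ImG: "Im (GG x) = kap * aa x / sqrt 2"
    unfolding G by (simp_all add: cos_45 sin_45 field_simps)
  define g where "g = cmod (GG x)"
  have g: "g > 0" using GG_nz by (simp add: g_def)
  have cos2: "(cos (psi (aa x)))\<^sup>2 = 1" using s0 sin_cos_squared_add[of "psi (aa x)"] by simp
  have rez: "(Re (zeta (xax x)))\<^sup>2 = (bb x)\<^sup>2 / g"
    unfolding zeta_xax using g cos2 by (simp add: power_divide power_mult_distrib g_def)
  have Rh: "Re (hh (uax x)) = sqrt 2 * Cw (alx x - pi/4) - (bb x)\<^sup>2 / g"
    using rez by (simp add: hh_def uax_def)
  have neg: "Re (hh (uax x)) < 0" if "Cw (alx x - pi/4) = -1"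
    unfolding Rh that using g zero_le_power2[of "bb x"] by (smt (verit) divide_nonneg_pos real_sqrt_gt_zero)
  have t: "alx x - pi/4 + 4 * pi * n = (Arg (GG x) - pi/4) + 2 * pi * of_int (2 * int n - i)"
    unfolding alx_def i by (simp add: algebra_simps)
  have n1': "real n \<ge> 1" using n1 by simp
  show "Re (hh (uax x)) < 0" if ne: "psi (aa x) \<noteq> 2 * pi * n"
  proof (rule neg)
    have i2: "i \<noteq> 2 * int n" using ne i by auto
    show "Cw (alx x - pi/4) = -1"
    proof (cases "aa x \<ge> 0")
      case True
      then have "0 \<le> Arg (GG x)" "Arg (GG x) \<le> pi/4"
        using Arg_bounds[of "GG x"] ReG ImG kap GG_nz[of x] by simp_all
      moreover have "\<bar>2 * pi * of_int (2 * int n - i)\<bar> \<ge> 2 * pi"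
      proof -
        have "1 \<le> \<bar>real_of_int (2 * int n - i)\<bar>" using i2 by linarith
        then have "2 * pi * 1 \<le> 2 * pi * \<bar>real_of_int (2 * int n - i)\<bar>" by (intro mult_left_mono) auto
        then show ?thesis by (simp add: abs_mult)
      qed
      ultimately have "\<bar>alx x - pi/4 + 4 * pi * n\<bar> > pi" unfolding t using pi_gt_zero by linarith
      then show ?thesis by (rule Cw_out)
    next
      case False
      then have "psi (aa x) = 0" by (simp add: psi_def tstep_simps)
      then have "alx x - pi/4 + 4 * pi * n = Arg (GG x) - pi/4 + 4 * pi * n" by (simp add: alx_def)
      moreover have "4 * pi * n \<ge> 4 * pi * 1" using n1' by (intro mult_left_mono) auto
      ultimately have "alx x - pi/4 + 4 * pi * n > pi" using mpi_less_Arg[of "GG x"] pi_gt_zero by linarith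
      then show ?thesis by (intro Cw_out) linarith
    qed
  qed
  show "Re (hh (uax x)) > 0" if eq: "psi (aa x) = 2 * pi * n"
  proof -
    have "of_int i * pi = real_of_int (2 * int n) * pi" using eq i by simp
    then have i2: "i = 2 * int n" by (metis mult_right_cancel of_int_eq_iff pi_neq_zero)
    have apos: "aa x > 0"
    proof (rule ccontr)
      assume "\<not> aa x > 0"
      then have "psi (aa x) = 0" by (simp add: psi_def tstep_simps)
      then show False using eq n1 by simp
    qed
    then have A: "0 \<le> Arg (GG x)" "Arg (GG x) \<le> pi/4"
      using Arg_bounds[of "GG x"] ReG ImG kap GG_nz[of x] by simp_all
    have "\<bar>alx x - pi/4 + 4 * pi * n\<bar> \<le> pi" unfolding t i2 using A pi_gt_zero by simp
    then have "Cw (alx x - pi/4) = cos (alx x - pi/4)" by (rule Cw_in)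
    also have "\<dots> = cos (Arg (GG x) - pi/4)"
      using cos_shift[of "alx x - pi/4"] unfolding t i2 by simp
    finally have C: "Cw (alx x - pi/4) = cos (Arg (GG x) - pi/4)" .
    have zz: "Re (GG x) = g * cos (Arg (GG x))" "Im (GG x) = g * sin (Arg (GG x))"
      unfolding g_def by (metis Re_rcis rcis_cmod_Arg, metis Im_rcis rcis_cmod_Arg)
    \<comment> \<open>The sum of sine and cosine turns the real part of \<open>hh\<close> into (Re
      GG + Im GG - bb^2)/|GG|. The squares of bb cancel, and a positive multiple of
      \<open>kap\<close> is left.\<close>
    have "g * (sqrt 2 * cos (Arg (GG x) - pi/4)) = Re (GG x) + Im (GG x)"
    proof -
      have *: "s * (a * (s / 2) + b * (s / 2)) = (s * s) * (a + b) / 2" for s a b :: real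
        by (simp add: algebra_simps)
      have "sqrt 2 * cos (Arg (GG x) - pi/4) = cos (Arg (GG x)) + sin (Arg (GG x))"
        unfolding cos_diff sin_45 cos_45 * by simp
      then show ?thesis unfolding zz by (simp add: distrib_left)
    qed
    then have "sqrt 2 * cos (Arg (GG x) - pi/4) = (Re (GG x) + Im (GG x)) / g" using g by (simp add: field_simps)
    then have "Re (hh (uax x)) = (Re (GG x) + Im (GG x) - (bb x)\<^sup>2) / g" unfolding Rh C by (simp add: diff_divide_distrib)
    also have "Re (GG x) + Im (GG x) - (bb x)\<^sup>2 = 2 * (kap * aa x / sqrt 2)" unfolding ReG ImG by simp
    finally show ?thesis using g kap apos by simp
  qed
qed

lemma aa_mono: "0 \<le> x \<Longrightarrow> x \<le> y \<Longrightarrow> y \<le> 1 \<Longrightarrow> aa x \<le> aa y"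
proof -
  assume a: "0 \<le> x" "x \<le> y" "y \<le> 1"
  have "x * y \<le> 1" using a by (simp add: mult_le_one)
  then have "0 \<le> (y - x) * (1 - x * y)" using a by simp
  then have "x * (1 + y\<^sup>2) \<le> y * (1 + x\<^sup>2)" by (simp add: power2_eq_square algebra_simps)
  then show ?thesis unfolding aa_def using ab(2)[of x] ab(2)[of y] by (simp add: divide_simps)
qed

lemma ab_inverse: "x \<noteq> 0 \<Longrightarrow> aa (1/x) = aa x" "x \<noteq> 0 \<Longrightarrow> bb (1/x) = - bb x"
proof -
  assume x: "x \<noteq> 0"
  have e: "1 + (1/x)\<^sup>2 = (1 + x\<^sup>2) / x\<^sup>2" using x by (simp add: field_simps)
  show "aa (1/x) = aa x" unfolding aa_def e using x ab(3)[of x] by (simp add: field_simps power2_eq_square)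
  have "(1/x)\<^sup>2 - 1 = (1 - x\<^sup>2) / x\<^sup>2" using x by (simp add: diff_divide_distrib power_divide)
  then have "bb (1/x) = ((1 - x\<^sup>2) / x\<^sup>2) / ((1 + x\<^sup>2) / x\<^sup>2)" unfolding bb_def e by simp
  also have "\<dots> = (1 - x\<^sup>2) / (1 + x\<^sup>2)" using x by simp
  also have "\<dots> = - bb x" unfolding bb_def by (simp only: minus_divide_left minus_diff_eq)
  finally show "bb (1/x) = - bb x" .
qed

lemma psi_mono: "s \<le> t \<Longrightarrow> psi s \<le> psi t"
  unfolding psi_def using tstep_mono by (intro mult_left_mono) auto

text \<open>The level psi = 2 pi n is passed twice, once before x = 1 and once after. The sign of bb
  and the direction of psi both change in between, so each passage crosses the positive half-line
  upwards. Both ends are on the negative half-line, which gives two full turns.\<close>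

lemma axis_winding:
  obtains R0 where "\<And>R l. R \<ge> R0 \<Longrightarrow> continuous_on {-R..R} l \<Longrightarrow>
    (\<And>x. x \<in> {-R..R} \<Longrightarrow> hh (uax x) = exp (l x)) \<Longrightarrow> Im (l R) - Im (l (-R)) = 4 * pi"
proof -
  define P where "P x = psi (aa x)" for x
  have contP: "continuous_on S P" for S
    unfolding P_def aa_def using ab(3) by (intro continuous_on_compose2[OF continuous_psi[of UNIV]] continuous_intros) auto
  have P0: "P x = 0" if "x \<le> 0" for x
  proof -
    have "aa x \<le> 0" using that ab(2)[of x] by (simp add: aa_def divide_nonpos_pos)
    then show ?thesis by (simp add: P_def psi_def tstep_simps)
  qed
  have P1: "P 1 = 4 * pi * n" by (simp add: P_def aa_def psi_def tstep_simps)
  have Pm: "P x \<le> P y" if "0 \<le> x" "x \<le> y" "y \<le> 1" for x y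
    unfolding P_def using aa_mono that by (intro psi_mono) auto
  have Pi: "P (1/x) = P x" if "x \<noteq> 0" for x using ab_inverse that by (simp add: P_def)
  define c where "c = 2 * pi * n"
  have c: "c \<ge> 2 * pi" using n1 by (simp add: c_def)
  have P1': "P 1 = 2 * c" using P1 by (simp add: c_def)
  have cs: "sin (c - pi/2) = -1" "sin (c + pi/2) = 1"
  proof -
    have "c = real n * (2 * pi)" by (simp add: c_def)
    then have "cos c = 1" using cos_2npi[of n] by (simp add: ac_simps)
    then show "sin (c - pi/2) = -1" "sin (c + pi/2) = 1" by (simp_all add: sin_diff sin_add)
  qed
  \<comment> \<open>At a quarter turn before and after the critical level the imaginary part is
    nonzero. These points and their reciprocals cut the axis into five pieces, each avoiding one of
    the two half-lines.\<close>
  obtain x1 where x1: "0 \<le> x1" "x1 \<le> 1" "P x1 = c - pi/2"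
  proof -
    have "P 0 \<le> c - pi/2" "c - pi/2 \<le> P 1" using P0[of 0] P1' c pi_gt_zero by linarith+
    then show ?thesis using IVT'[of P 0 "c - pi/2" 1] contP that by auto
  qed
  obtain x2 where x2: "x1 \<le> x2" "x2 \<le> 1" "P x2 = c + pi/2"
  proof -
    have "P x1 \<le> c + pi/2" "c + pi/2 \<le> P 1" using x1 P1' c pi_gt_zero by linarith+
    then show ?thesis using IVT'[of P x1 "c + pi/2" 1] contP x1 that by auto
  qed
  have x1p: "x1 > 0" using x1 P0[of 0] c pi_gt_zero by (cases "x1 = 0") auto
  have x12: "x1 < x2" using x1 x2 pi_gt_zero by (cases "x1 = x2") auto
  have x2l: "x2 < 1"
  proof -
    have "x2 \<noteq> 1"
    proof
      assume "x2 = 1"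
      then have "2 * c = c + pi/2" using x2(3) P1' by simp
      then show False using c pi_gt_zero by linarith
    qed
    then show ?thesis using x2 by simp
  qed
  have bn: "bb x < 0" if "0 \<le> x" "x < 1" for x
    using that ab(2)[of x] by (simp add: bb_def divide_neg_pos power_less_one_iff abs_square_less_1)
  have Ims: "Im (hh (uax x1)) < 0" "Im (hh (uax x2)) > 0" "Im (hh (uax (1/x2))) < 0" "Im (hh (uax (1/x1))) > 0"
  proof -
    have s: "sin (psi (aa x1)) = -1" "sin (psi (aa x2)) = 1" "sin (psi (aa (1/x2))) = 1" "sin (psi (aa (1/x1))) = -1"
      using x1 x2 cs Pi[of x1] Pi[of x2] x1p x12 by (simp_all add: P_def)
    show "Im (hh (uax x1)) < 0" "Im (hh (uax x2)) > 0" "Im (hh (uax (1/x2))) < 0" "Im (hh (uax (1/x1))) > 0"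
      unfolding Im_hh_uax s ab_inverse(2)[OF less_imp_neq[OF x1p, symmetric]]
      using ab_inverse(2)[of x2] x1p x12 x2l bn[of x1] bn[of x2] GG_nz
      by (simp_all add: divide_neg_pos)
  qed
  have slit_out: "- hh (uax x) \<notin> \<real>\<^sub>\<le>\<^sub>0" if "P x \<noteq> c" for x
    using hh_uax_real(2)[of x] that by (auto simp: complex_nonpos_Reals_iff P_def c_def)
  have slit_in: "hh (uax x) \<notin> \<real>\<^sub>\<le>\<^sub>0" if "P x \<ge> c - pi/2" "P x \<le> c + pi/2" "bb x \<noteq> 0" for x
  proof
    assume "hh (uax x) \<in> \<real>\<^sub>\<le>\<^sub>0"
    then have I: "Im (hh (uax x)) = 0" "Re (hh (uax x)) \<le> 0" by (auto simp: complex_nonpos_Reals_iff)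
    then have "sin (P x) = 0" using that(3) GG_nz[of x] by (auto simp: Im_hh_uax P_def)
    then have "sin (P x - c) = 0"
      using sin_diff[of "P x" c] cs by (simp add: c_def sin_diff) (metis mult.commute sin_2npi mult.left_commute mult_zero_right)
    moreover have "- pi < P x - c" "P x - c < pi" using that(1,2) pi_gt_zero by linarith+
    ultimately have "P x - c = 0" using sin_eq_0_pi by blast
    then show False using hh_uax_real(1)[OF I(1)] I(2) by (simp add: P_def c_def)
  qed
  have chu: "continuous_on S (\<lambda>x. hh (uax x))" for S
  proof -
    have xc: "continuous_on S xax" unfolding xax_def by (intro continuous_on_vector3 continuous_intros)
    have "continuous_on S (\<lambda>x. zeta (xax x))"
      using FF_xax_nz by (intro continuous_on_compose2[OF continuous_zeta[of "range xax"] xc]) auto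
    then show ?thesis unfolding uax_def
      by (intro continuous_on_compose2[OF continuous_hh[of UNIV]] continuous_intros continuous_alx) auto
  qed
  show thesis
  proof (rule that[of "max 4 (1/x1)"])
    fix R l assume R: "R \<ge> max 4 (1/x1)" and l: "continuous_on {-R..R} l"
      and e: "\<And>x. x \<in> {-R..R} \<Longrightarrow> hh (uax x) = exp (l x)"
    define g where "g x = hh (uax x)" for x
    have ord: "1 < 1/x2" "1/x2 < 1/x1" "1/x1 \<le> R" "4 \<le> R" using x1p x12 x2l R by (auto simp: field_simps)
    have ord2: "x2 \<le> 1/x2" "1/x2 \<le> R" "-R \<le> x2" "-R \<le> 1/x2" "-R \<le> 1/x1" "x1 \<le> R" "x2 \<le> R" "-R \<le> x1" "-R \<le> -R" "R \<le> R" "1/x2 \<le> 1/x1"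
      using ord x2l x12 x1p by linarith+
    have sub: "continuous_on {a..b} l" "\<And>x. x \<in> {a..b} \<Longrightarrow> g x = exp (l x)" if "-R \<le> a" "b \<le> R" for a b
      using that continuous_on_subset[OF l, of "{a..b}"] e by (auto simp: g_def)
    have out: "Im (l b) - Im (l a) = Arg (- g b) - Arg (- g a)"
      if ab: "-R \<le> a" "a \<le> b" "b \<le> R" "\<And>x. x \<in> {a..b} \<Longrightarrow> P x \<noteq> c" for a b
    proof (rule log_difference_Ln_minus[of "{a..b}"])
      show "continuous_on {a..b} g" unfolding g_def by (rule chu)
      show "- g x \<notin> \<real>\<^sub>\<le>\<^sub>0" if "x \<in> {a..b}" for x unfolding g_def by (rule slit_out[OF ab(4)[OF that]])
    qed (use sub[OF ab(1,3)] ab(2) in \<open>simp_all\<close>)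
    have inn: "Im (l b) - Im (l a) = Arg (g b) - Arg (g a)"
      if ab: "-R \<le> a" "a \<le> b" "b \<le> R" "\<And>x. x \<in> {a..b} \<Longrightarrow> g x \<notin> \<real>\<^sub>\<le>\<^sub>0" for a b
    proof (rule log_difference_Ln[of "{a..b}"])
      show "continuous_on {a..b} g" unfolding g_def by (rule chu)
    qed (use sub[OF ab(1,3)] ab(2,4) in \<open>simp_all\<close>)
    have s1: "Im (l x1) - Im (l (-R)) = Arg (- g x1) - Arg (- g (-R))"
    proof (rule out)
      fix x assume "x \<in> {-R..x1}"
      then have xx: "x \<le> x1" by simp
      have "P x \<le> c - pi/2"
      proof (cases "x \<le> 0")
        case True then show ?thesis using P0[of x] c pi_gt_zero by linarith
      next
        case False then show ?thesis using Pm[of x x1] x1 xx by simp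
      qed
      then show "P x \<noteq> c" using pi_gt_zero by linarith
    qed (use ord ord2 x12 in linarith)+
    have s2: "Im (l x2) - Im (l x1) = Arg (g x2) - Arg (g x1)"
    proof (rule inn)
      fix x assume x: "x \<in> {x1..x2}"
      then have "P x \<ge> c - pi/2" "P x \<le> c + pi/2" using Pm[of x1 x] Pm[of x x2] x1 x2 by auto
      moreover have "bb x \<noteq> 0" using bn[of x] x x1p x2l by auto
      ultimately show "g x \<notin> \<real>\<^sub>\<le>\<^sub>0" unfolding g_def by (rule slit_in)
    qed (use ord ord2 x12 in linarith)+
    have s3: "Im (l (1/x2)) - Im (l x2) = Arg (- g (1/x2)) - Arg (- g x2)"
    proof (rule out)
      fix x assume x: "x \<in> {x2..1/x2}"
      have "P x \<ge> c + pi/2"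
      proof (cases "x \<le> 1")
        case True then show ?thesis using Pm[of x2 x] x x1p x12 x2 by auto
      next
        case False
        then have "1/x \<ge> x2" "1/x \<le> 1" using x x1p x12 by (auto simp: field_simps)
        then have "P (1/x) \<ge> c + pi/2" using Pm[of x2 "1/x"] x1p x12 x2 by auto
        then show ?thesis using Pi[of x] False by auto
      qed
      then show "P x \<noteq> c" using pi_gt_zero by linarith
    qed (use ord ord2 x12 in linarith)+
    have s4: "Im (l (1/x1)) - Im (l (1/x2)) = Arg (g (1/x1)) - Arg (g (1/x2))"
    proof (rule inn)
      fix x assume x: "x \<in> {1/x2..1/x1}"
      have xp: "x > 1" using x ord by auto
      have i: "1/x \<in> {x1..x2}" using x xp x1p x12 by (auto simp: field_simps)
      then have "P (1/x) \<ge> c - pi/2" "P (1/x) \<le> c + pi/2" using Pm[of x1 "1/x"] Pm[of "1/x" x2] x1 x2 xp by auto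
      then have "P x \<ge> c - pi/2" "P x \<le> c + pi/2" using Pi[of x] xp by auto
      moreover have "bb x \<noteq> 0" using bn[of "1/x"] ab_inverse(2)[of x] i x1p x2l xp by auto
      ultimately show "g x \<notin> \<real>\<^sub>\<le>\<^sub>0" unfolding g_def by (rule slit_in)
    qed (use ord ord2 x12 in linarith)+
    have s5: "Im (l R) - Im (l (1/x1)) = Arg (- g R) - Arg (- g (1/x1))"
    proof (rule out)
      fix x assume x: "x \<in> {1/x1..R}"
      have xp: "x > 1" using x ord by auto
      have "1/x \<le> x1" using x xp x1p by (auto simp: field_simps)
      then have "P (1/x) \<le> c - pi/2" using Pm[of "1/x" x1] x1 xp by auto
      then have "P x \<le> c - pi/2" using Pi[of x] xp by simp
      then show "P x \<noteq> c" using pi_gt_zero by linarith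
    qed (use ord ord2 x12 in linarith)+
    have ends: "Arg (- g R) = 0" "Arg (- g (-R)) = 0"
    proof -
      have "Arg (- g x) = 0" if x: "P x = 0" for x
      proof -
        have "Im (g x) = 0" using x by (simp add: g_def Im_hh_uax P_def)
        moreover have "Re (g x) < 0"
          using hh_uax_real(2)[of x] calculation x c pi_gt_zero by (auto simp: g_def P_def c_def)
        ultimately have "- g x = of_real (- Re (g x))" "- Re (g x) > 0" by (auto simp: complex_eq_iff)
        then show ?thesis by (metis Arg_of_real not_less_iff_gr_or_eq)
      qed
      moreover have "P (-R) = 0" using P0 ord by simp
      moreover have "P R = 0"
      proof -
        have "aa R \<le> 3/5"
        proof -
          define q where "q = R\<^sup>2"
          have "R * 4 \<le> q" unfolding q_def power2_eq_square using ord(4) by (intro mult_left_mono) auto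
          then have "10 * R \<le> 3 + 3 * q" using ord(4) by linarith
          then have "10 * R \<le> 3 * (1 + R\<^sup>2)" by (simp add: q_def)
          then show ?thesis unfolding aa_def using ab(2)[of R] by (simp add: divide_simps)
        qed
        then show ?thesis by (simp add: P_def psi_def tstep_simps)
      qed
      ultimately show "Arg (- g R) = 0" "Arg (- g (-R)) = 0" by auto
    qed
    \<comment> \<open>Changing between g and -g at the four cut points contributes pi each time, and
      the principal arguments telescope.\<close>
    have A: "Arg (- g x1) = Arg (g x1) + pi" "Arg (- g x2) = Arg (g x2) - pi"
      "Arg (- g (1/x2)) = Arg (g (1/x2)) + pi" "Arg (- g (1/x1)) = Arg (g (1/x1)) - pi"
      using Ims Arg_minus_lower Arg_minus_upper unfolding g_def by blast+
    show "Im (l R) - Im (l (-R)) = 4 * pi"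
      using s1 s2 s3 s4 s5 ends A by linarith
  qed
qed

end

section \<open>The lift of a spanning disk\<close>

text \<open>Here \<open>k\<close> is a topological disk parametrised by the complex unit disk, with
  the zero set of \<open>FF\<close> as its boundary; its smoothness enters only in the area
  estimate.\<close>

locale twist_disk = twist +
  fixes k :: "complex \<Rightarrow> real^3"
  assumes contk: "continuous_on (cball 0 1) k" and injk: "inj_on k (cball 0 1)"
    and bdk: "k ` sphere 0 1 = {p. FF p = 0}"
begin

lemma FF_ball: "x \<in> ball 0 1 \<Longrightarrow> FF (k x) \<noteq> 0"
proof
  assume x: "x \<in> ball 0 1" "FF (k x) = 0"
  then obtain y where y: "y \<in> sphere 0 1" "k x = k y" using bdk by blast
  then have "x = y" using injk x(1) by (auto dest!: inj_onD)
  then show False using x y by simp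
qed

definition "lg = (SOME l. continuous_on (ball 0 1) l \<and> (\<forall>x\<in>ball 0 1. FF (k x) = exp (l x)))"

lemma lg: "continuous_on (ball 0 1) lg" "\<And>x. x \<in> ball 0 1 \<Longrightarrow> FF (k x) = exp (lg x)"
proof -
  have "continuous_on (ball 0 1) (\<lambda>x. FF (k x))"
    by (intro continuous_on_compose2[OF continuous_FF[of UNIV]] continuous_on_subset[OF contk]) auto
  then have "\<exists>l. continuous_on (ball 0 1) l \<and> (\<forall>x\<in>ball 0 1. FF (k x) = exp (l x))"
    using continuous_logarithm_on_ball[of 0 1 "\<lambda>x. FF (k x)"] FF_ball by (metis Ball_def)
  then have "continuous_on (ball 0 1) lg \<and> (\<forall>x\<in>ball 0 1. FF (k x) = exp (lg x))"
    unfolding lg_def by (rule someI_ex)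
  then show "continuous_on (ball 0 1) lg" "\<And>x. x \<in> ball 0 1 \<Longrightarrow> FF (k x) = exp (lg x)" by auto
qed

definition "ee x = (Im (lg x), zeta (k x))"
text \<open>The minus sign lets indices grow as the argument falls, in step with the descent along
  the first axis.\<close>

definition "tt = (- (2 * pi), 0 :: complex)"
definition "EE i = (\<lambda>v. v + of_int i *\<^sub>R tt) ` ee ` ball 0 1" for i :: int
definition "bs i = (- (2 * pi * of_int i), 1 :: complex)" for i :: int

lemma sgn_ball: "x \<in> ball 0 1 \<Longrightarrow> sgn (FF (k x)) = cis (Im (lg x))"
  using lg(2)[of x] by (simp add: exp_eq_polar sgn_mult sgn_of_real)

lemma ee_cont: "continuous_on (ball 0 1) ee"
  unfolding ee_def
proof (intro continuous_intros lg)
  show "continuous_on (ball 0 1) (\<lambda>x. zeta (k x))"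
    using FF_ball by (intro continuous_on_compose2[OF continuous_zeta[of "k ` ball 0 1"]] continuous_on_subset[OF contk]) auto
qed

lemma ee_inj: "inj_on ee (ball 0 1)"
proof (rule inj_onI)
  fix x y assume xy: "x \<in> ball 0 1" "y \<in> ball 0 1" "ee x = ee y"
  then have "k x = k y"
    using lift_injective[OF FF_ball FF_ball] sgn_ball by (simp add: ee_def)
  then show "x = y" using injk xy by (auto dest!: inj_onD)
qed

lemma cis_eqD: "cis a = cis b \<Longrightarrow> \<exists>m::int. a = b + 2 * pi * of_int m"
proof -
  assume "cis a = cis b"
  then have "sin a = sin b \<and> cos a = cos b" by (simp add: complex_eq_iff)
  then show ?thesis using sin_cos_eq_iff[of a b] by (auto simp: ac_simps)
qed

lemma cis_shift: "cis (a + 2 * pi * of_int m) = cis a"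
  using cis_multiple_2pi[of "of_int m"] by (simp flip: cis_mult)

lemma mem_EE_D:
  assumes "v \<in> EE i" obtains x where "x \<in> ball 0 1" "sgn (FF (k x)) = cis (fst v)" "zeta (k x) = snd v"
    "fst v = Im (lg x) - 2 * pi * of_int i"
proof -
  obtain x where x: "x \<in> ball 0 1" "v = ee x + of_int i *\<^sub>R tt" using assms by (auto simp: EE_def)
  have f: "fst v = Im (lg x) + 2 * pi * of_int (- i)" "snd v = zeta (k x)"
    using x(2) by (auto simp: ee_def tt_def)
  have "cis (fst v) = sgn (FF (k x))" unfolding f cis_shift using sgn_ball[OF x(1)] by simp
  then show thesis using that x f by (simp add: algebra_simps)
qed

lemma mem_EE_I:
  assumes "x \<in> ball 0 1" "sgn (FF (k x)) = cis (fst v)" "zeta (k x) = snd v"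
  shows "\<exists>i. v \<in> EE i"
proof -
  obtain m :: int where m: "fst v = Im (lg x) + 2 * pi * of_int m"
    using cis_eqD[of "fst v" "Im (lg x)"] assms sgn_ball by metis
  have "v = ee x + of_int (- m) *\<^sub>R tt"
    using m assms(3) by (cases v) (auto simp: ee_def tt_def)
  then show ?thesis using assms(1) unfolding EE_def by blast
qed

lemma EE_disjoint: "i \<noteq> j \<Longrightarrow> EE i \<inter> EE j = {}"
proof (rule ccontr)
  assume ij: "i \<noteq> j" "EE i \<inter> EE j \<noteq> {}"
  then obtain v where v: "v \<in> EE i" "v \<in> EE j" by blast
  obtain x where x: "x \<in> ball 0 1" "sgn (FF (k x)) = cis (fst v)" "zeta (k x) = snd v"
    "fst v = Im (lg x) - 2 * pi * of_int i" using mem_EE_D[OF v(1)] by blast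
  obtain y where y: "y \<in> ball 0 1" "sgn (FF (k y)) = cis (fst v)" "zeta (k y) = snd v"
    "fst v = Im (lg y) - 2 * pi * of_int j" using mem_EE_D[OF v(2)] by blast
  have "k x = k y" using lift_injective[OF FF_ball[OF x(1)] FF_ball[OF y(1)]] x y by simp
  then have "x = y" using injk x(1) y(1) by (auto dest!: inj_onD)
  then show False using x(4) y(4) ij(1) by simp
qed

text \<open>At the boundary \<open>FF\<close> tends to 0 while |ww| tends to d > 0, so
  \<open>zeta\<close> blows up. This makes the lifted open disk a properly embedded plane.\<close>

lemma zeta_escape:
  assumes x: "\<And>n. x n \<in> ball 0 1" and lim: "x \<longlonglongrightarrow> l" and zB: "\<And>n. cmod (zeta (k (x n))) \<le> B"
  shows "l \<in> ball 0 1"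
proof (rule ccontr)
  have l: "l \<in> cball 0 1"
    using closed_sequentially[OF closed_cball _ lim] x by (meson ball_subset_cball subsetD)
  assume "l \<notin> ball 0 1"
  then have "l \<in> sphere 0 1" using l by auto
  then have F0: "FF (k l) = 0" using bdk by blast
  have kx: "(\<lambda>n. k (x n)) \<longlonglongrightarrow> k l"
    using subsetD[OF ball_subset_cball x] by (intro continuous_on_tendsto_compose[OF contk lim l]) simp
  have Fx: "(\<lambda>n. FF (k (x n))) \<longlonglongrightarrow> 0"
    using continuous_on_tendsto_compose[OF continuous_FF[of UNIV] kx] F0 by simp
  have wx: "(\<lambda>n. ww (k (x n))) \<longlonglongrightarrow> ww (k l)"
    using continuous_on_tendsto_compose[OF continuous_ww[of UNIV] kx] by simp
  have "cmod (ww (k (x n))) \<le> B * sqrt (cmod (FF (k (x n))))" for n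
  proof -
    have "ww (k (x n)) = zeta (k (x n)) * of_real (sqrt (cmod (FF (k (x n)))))"
      using FF_ball[OF x] by (simp add: zeta_def)
    then have "cmod (ww (k (x n))) = cmod (zeta (k (x n))) * sqrt (cmod (FF (k (x n))))"
      by (simp add: norm_mult)
    then show ?thesis using zB[of n] by (simp add: mult_right_mono)
  qed
  moreover have "(\<lambda>n. B * sqrt (cmod (FF (k (x n))))) \<longlonglongrightarrow> B * sqrt (cmod 0)"
    by (intro tendsto_intros Fx)
  moreover have "(\<lambda>n. cmod (ww (k (x n)))) \<longlonglongrightarrow> cmod (ww (k l))" by (intro tendsto_intros wx)
  ultimately have "cmod (ww (k l)) \<le> B * sqrt (cmod 0)"
    by (intro LIMSEQ_le[of "\<lambda>n. cmod (ww (k (x n)))" _ "\<lambda>n. B * sqrt (cmod (FF (k (x n))))"]) auto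
  then show False using FF_zero(1)[OF F0] d0 by simp
qed

lemma EE_proper: "closed (ee ` ball 0 1)" "ball (0::complex) 1 homeomorphic (ee ` ball 0 1)"
proof -
  have pr: "l \<in> ball 0 1" if x: "\<And>n. x n \<in> ball 0 1" and lim: "x \<longlonglongrightarrow> l"
    and bd: "bounded (range (\<lambda>n. ee (x n)))" for x :: "nat \<Rightarrow> complex" and l
  proof -
    obtain B where B: "\<And>n. norm (ee (x n)) \<le> B" using bd by (auto simp: bounded_iff)
    have "cmod (zeta (k (x n))) \<le> B" for n
      using B[of n] norm_snd_le[of "zeta (k (x n))" "Im (lg (x n))"] by (simp add: ee_def)
    then show ?thesis using zeta_escape x lim by blast
  qed
  show "closed (ee ` ball 0 1)"
    by (rule proper_embedding(1)[OF compact_cball ball_subset_cball ee_cont ee_inj]) (blast intro: pr)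
  show "ball (0::complex) 1 homeomorphic (ee ` ball 0 1)"
    by (rule proper_embedding(2)[OF compact_cball ball_subset_cball ee_cont ee_inj]) (blast intro: pr)
qed

lemma EE_0: "EE 0 = ee ` ball 0 1" by (simp add: EE_def)

text \<open>Bounded \<open>zeta\<close> confines the parameter to a compact part of the open disk,
  on which the argument is bounded. So bounded sets meet few shifts.\<close>

lemma EE_locfin:
  assumes K: "compact K" shows "finite {i. EE i \<inter> K \<noteq> {}}"
proof -
  obtain R where R: "R \<ge> 0" "\<And>v. v \<in> K \<Longrightarrow> norm v \<le> R"
    using compact_imp_bounded[OF K] bounded_iff by (metis bounded_pos less_imp_le)
  have Zc: "compact {x \<in> ball 0 1. cmod (zeta (k x)) \<le> R}"
  proof -
    define S where "S = {x \<in> ball 0 1. cmod (zeta (k x)) \<le> R}"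
    have "closed S"
      unfolding closed_sequential_limits
    proof (intro allI impI, elim conjE)
      fix x l assume x: "\<forall>n. x n \<in> S" and lim: "x \<longlonglongrightarrow> l"
      have xb: "x n \<in> ball 0 1" "cmod (zeta (k (x n))) \<le> R" for n using x by (auto simp: S_def)
      have "l \<in> ball 0 1" using zeta_escape[OF xb(1) lim xb(2)] .
      moreover have "(\<lambda>n. ee (x n)) \<longlonglongrightarrow> ee l"
        using xb(1) by (intro continuous_on_tendsto_compose[OF ee_cont lim calculation]) auto
      then have "(\<lambda>n. cmod (snd (ee (x n)))) \<longlonglongrightarrow> cmod (snd (ee l))" by (intro tendsto_intros)
      then have "cmod (zeta (k l)) \<le> R" using xb(2) by (intro LIMSEQ_le_const2) (auto simp: ee_def)
      ultimately show "l \<in> S" by (simp add: S_def)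
    qed
    moreover have "bounded S" by (rule bounded_subset[OF bounded_ball[of 0 1]]) (auto simp: S_def)
    ultimately show ?thesis unfolding S_def by (simp add: compact_eq_bounded_closed)
  qed
  have "continuous_on {x \<in> ball 0 1. cmod (zeta (k x)) \<le> R} (\<lambda>x. Im (lg x))"
    by (intro continuous_intros continuous_on_subset[OF lg(1)]) auto
  then have "compact ((\<lambda>x. Im (lg x)) ` {x \<in> ball 0 1. cmod (zeta (k x)) \<le> R})"
    using Zc by (rule compact_continuous_image)
  then obtain B where B: "\<And>x. x \<in> ball 0 1 \<Longrightarrow> cmod (zeta (k x)) \<le> R \<Longrightarrow> \<bar>Im (lg x)\<bar> \<le> B"
    using compact_imp_bounded by (force simp: bounded_iff)
  have "\<bar>i\<bar> \<le> \<lceil>B + R\<rceil>" if i: "EE i \<inter> K \<noteq> {}" for i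
  proof -
    obtain v where v: "v \<in> EE i" "v \<in> K" using i by blast
    obtain x where x: "x \<in> ball 0 1" "zeta (k x) = snd v" "fst v = Im (lg x) - 2 * pi * of_int i"
      using mem_EE_D[OF v(1)] by metis
    have nv: "norm v \<le> R" using R(2)[OF v(2)] .
    have fv: "\<bar>fst v\<bar> \<le> R" "cmod (snd v) \<le> R"
      using nv norm_fst_le[of "fst v" "snd v"] norm_snd_le[of "snd v" "fst v"] by auto
    have "\<bar>Im (lg x)\<bar> \<le> B" using B[OF x(1)] fv x(2) by simp
    then have "2 * pi * \<bar>real_of_int i\<bar> \<le> B + R" using x(3) fv(1) by (simp add: abs_mult flip: abs_mult)
    moreover have "1 * \<bar>real_of_int i\<bar> \<le> 2 * pi * \<bar>real_of_int i\<bar>" using pi_gt3 by (intro mult_right_mono) auto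
    ultimately have "\<bar>real_of_int i\<bar> \<le> B + R" by linarith
    then show ?thesis by linarith
  qed
  then have "{i. EE i \<inter> K \<noteq> {}} \<subseteq> {i. \<bar>i\<bar> \<le> \<lceil>B + R\<rceil>}" by (rule Collect_mono[OF impI])
  moreover have "{i. \<bar>i\<bar> \<le> \<lceil>B + R\<rceil>} \<subseteq> {- \<lceil>B + R\<rceil>..\<lceil>B + R\<rceil>}" by (auto simp: abs_le_iff)
  ultimately show ?thesis using finite_subset finite_atLeastAtMost_int by metis
qed

lemma bs_EE: "bs i \<notin> EE j"
proof
  assume "bs i \<in> EE j"
  then obtain x where x: "x \<in> ball 0 1" "sgn (FF (k x)) = cis (fst (bs i))" "zeta (k x) = snd (bs i)"
    using mem_EE_D by metis
  have "cis (fst (bs i)) = 1" using cis_shift[of 0 "- i"] by (simp add: bs_def)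
  then show False using FF_not_one[of "k x"] x by (simp add: bs_def)
qed

lemma EE_shift: "EE i = (\<lambda>v. v + of_int i *\<^sub>R tt) ` EE 0" by (simp add: EE_def image_image)
lemma bs_shift: "bs i = bs 0 + of_int i *\<^sub>R tt" by (simp add: bs_def tt_def)

lemma EE_closed: "closed (EE i)"
  using closed_translation[OF EE_proper(1), of "of_int i *\<^sub>R tt"] by (simp add: EE_def add.commute image_image)

lemma EE_contractible: "contractible (EE i)"
proof -
  have "contractible (ee ` ball 0 1)"
    using homeomorphic_contractible_eq[OF EE_proper(2)] convex_imp_contractible[OF convex_ball] by blast
  moreover have "ee ` ball 0 1 homeomorphic ((\<lambda>v. (of_int i *\<^sub>R tt) + v) ` ee ` ball 0 1)"
    by (rule homeomorphic_translation)
  ultimately show ?thesis using homeomorphic_contractible_eq by (auto simp: EE_def add.commute image_image)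
qed

text \<open>Local finiteness gives a radius at the base point of index 0; the deck translation
  permutes the \<open>EE\<close> and the base points, so it serves at all of them.\<close>

lemma EE_base_ball: "\<exists>r>0. \<forall>i. ball (bs i) r \<inter> (\<Union>j. EE j) = {}"
proof -
  define I where "I = {j. EE j \<inter> cball (bs 0) 1 \<noteq> {}}"
  define U where "U = (\<Union>j\<in>I. EE j)"
  have fin: "finite I" unfolding I_def by (rule EE_locfin) simp
  then have "closed U" unfolding U_def using EE_closed by (intro closed_UN) auto
  moreover have "bs 0 \<in> - U" unfolding U_def using bs_EE by blast
  ultimately obtain r where r: "r > 0" "ball (bs 0) r \<subseteq> - U"
    using open_contains_ball[of "- U"] open_Compl by metis
  define s where "s = min r 1"
  have s0: "ball (bs 0) s \<inter> EE j = {}" for j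
  proof (rule ccontr)
    assume "ball (bs 0) s \<inter> EE j \<noteq> {}"
    then obtain v where v: "v \<in> EE j" "dist (bs 0) v < s" by auto
    have v1: "v \<in> cball (bs 0) 1" "v \<in> ball (bs 0) r" using v(2) by (simp_all add: s_def)
    then have "j \<in> I" using v(1) unfolding I_def by blast
    then have "v \<in> U" using v(1) unfolding U_def by blast
    then show False using r(2) v1(2) by blast
  qed
  have "ball (bs i) s \<inter> EE j = {}" for i j
  proof (rule ccontr)
    assume "ball (bs i) s \<inter> EE j \<noteq> {}"
    then obtain v where v: "v \<in> EE j" "dist (bs i) v < s" by auto
    obtain u where u: "u \<in> EE 0" "v = u + of_int j *\<^sub>R tt" using v(1) EE_shift[of j] by auto
    let ?w = "u + of_int (j - i) *\<^sub>R tt"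
    have "?w \<in> EE (j - i)" using u(1) EE_shift[of "j - i"] by blast
    moreover have "dist (bs 0) ?w = dist (bs i) v"
      using bs_shift[of i] u(2) by (simp add: dist_norm scaleR_diff_left algebra_simps)
    ultimately have "?w \<in> ball (bs 0) s \<inter> EE (j - i)" using v(2) by (metis IntI mem_ball)
    then show False using s0[of "j - i"] by blast
  qed
  moreover have "s > 0" using r by (simp add: s_def)
  ultimately show ?thesis by (intro exI[of _ s]) auto
qed

text \<open>Continuity at (1, 1) of the map from (FF, ww) to (Arg FF, zeta), which sends it to (0,
  1).\<close>

lemma near_base:
  assumes "r > 0"
  obtains e where "e > 0" "\<And>p. FF p \<noteq> 0 \<Longrightarrow> cmod (FF p - 1) < e \<Longrightarrow> cmod (ww p - 1) < e \<Longrightarrow> dist (0, 1) (Arg (FF p), zeta p) < r"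
proof -
  define h where "h v = (Arg (fst v), snd v / complex_of_real (sqrt (cmod (fst v))))" for v :: "complex \<times> complex"
  have "continuous (at (1, 1)) h"
    unfolding h_def by (intro continuous_intros) (auto simp: complex_nonpos_Reals_iff intro!: continuous_intros isCont_o2[of "(1, 1)" fst Arg] continuous_at_Arg)
  then obtain e where e: "e > 0" "\<And>v. dist v (1, 1) < e \<Longrightarrow> dist (h v) (h (1, 1)) < r"
    unfolding continuous_at_eps_delta using assms by metis
  show thesis
  proof (rule that[of "e / 2"])
    fix p assume p: "FF p \<noteq> 0" "cmod (FF p - 1) < e / 2" "cmod (ww p - 1) < e / 2"
    have "dist (FF p, ww p) (1, 1) \<le> dist (FF p) 1 + dist (ww p) 1"
      by (simp add: dist_Pair_Pair sqrt_sum_squares_le_sum)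
    also have "\<dots> < e" using p by (simp add: dist_norm)
    finally show "dist (0, 1) (Arg (FF p), zeta p) < r"
      using e(2)[of "(FF p, ww p)"] by (simp add: zeta_def dist_commute h_def)
  qed (use e in auto)
qed

lemma NN_large: "NN p \<ge> 1 + (p $ 1)\<^sup>2" by (simp add: NN_def)

lemma far_FF:
  assumes "e > 0"
  obtains R where "R \<ge> 4" "\<And>p. \<bar>p $ 1\<bar> \<ge> R \<Longrightarrow> cmod (FF p - 1) < e \<and> cmod (ww p - 1) < e \<and> Re (FF p) > 0"
proof -
  define R where "R = max 6 (6 / e)"
  show thesis
  proof (rule that[of R])
    fix p :: "real^3" assume p: "\<bar>p $ 1\<bar> \<ge> R"
    have R: "R \<ge> 6" "R \<ge> 6 / e" by (auto simp: R_def)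
    have "R\<^sup>2 \<le> (p $ 1)\<^sup>2" using p R by (metis abs_le_square_iff abs_of_nonneg order_trans zero_le_numeral)
    then have N: "NN p > R\<^sup>2" using NN_large[of p] by linarith
    then have sN: "sqrt (NN p) > R" using R by (metis real_less_rsqrt)
    have "R\<^sup>2 \<ge> 6\<^sup>2" using R by (intro power_mono) auto
    then have "NN p \<ge> 16" using N by simp
    note F = FF_near_infinity[OF this]
    have "5 / sqrt (NN p) < e" "2 / sqrt (NN p) < e" "5 / sqrt (NN p) < 1"
    proof -
      have "6 / e < sqrt (NN p)" "6 < sqrt (NN p)" using sN R by auto
      then have S: "0 < sqrt (NN p)" "6 < sqrt (NN p) * e" "6 < 1 * sqrt (NN p)"
        using assms pos_divide_less_eq[of e 6 "sqrt (NN p)"] by linarith+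
      show "5 / sqrt (NN p) < e" "2 / sqrt (NN p) < e" "5 / sqrt (NN p) < 1"
        unfolding pos_divide_less_eq[OF S(1)] using S(2,3) by (simp_all add: mult.commute)
    qed
    moreover have "Re (FF p) > 0" if "cmod (FF p - 1) < 1"
      using that abs_Re_le_cmod[of "FF p - 1"] by simp
    ultimately show "cmod (FF p - 1) < e \<and> cmod (ww p - 1) < e \<and> Re (FF p) > 0" using F by auto
  qed (simp add: R_def)
qed

lemma lift_avoids:
  assumes p: "p \<notin> k ` cball 0 1" "sgn (FF p) = cis (fst v)" "zeta p = snd v"
  shows "v \<notin> EE i"
proof
  assume "v \<in> EE i"
  then obtain x where x: "x \<in> ball 0 1" "sgn (FF (k x)) = cis (fst v)" "zeta (k x) = snd v"
    using mem_EE_D by metis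
  have "FF p \<noteq> 0"
  proof
    assume "FF p = 0"
    then have "p \<in> k ` sphere 0 1" using bdk by simp
    then show False using p(1) sphere_cball by blast
  qed
  then have "k x = p" using lift_injective[OF FF_ball[OF x(1)]] x p by simp
  then show False using p(1) x(1) ball_subset_cball by blast
qed

lemma connected_complement: "connected (- (k ` cball 0 1))"
proof -
  have "cball (0::complex) 1 homeomorphic (k ` cball 0 1)"
    using homeomorphic_compact[OF compact_cball contk refl injk] by blast
  then show ?thesis
    by (intro connected_complement_homeomorphic_convex_compact[OF homeomorphic_sym[THEN iffD1]]) auto
qed

text \<open>A compact disk does not separate space, so a point off the disk can be joined to one far
  out. The lift of the path avoids all translates and ends close to a base point.\<close>

lemma EE_reach:
  assumes v: "v \<notin> (\<Union>j. EE j)"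
  shows "\<exists>i. connected_component (- (\<Union>j. EE j)) v (bs i)"
proof (cases "cis (fst v) = 1 \<and> snd v = 1")
  case True
  then obtain m :: int where "fst v = 0 + 2 * pi * of_int m" using cis_eqD[of "fst v" 0] by auto
  then have "v = bs (- m)" using True by (cases v) (auto simp: bs_def)
  then show ?thesis using v by (intro exI[of _ "- m"]) (simp only: connected_component_refl_eq Compl_iff not_False_eq_True)
next
  case False
  obtain p where p: "FF p \<noteq> 0" "sgn (FF p) = cis (fst v)" "zeta p = snd v"
    using lift_surjective[OF False] by metis
  have pk: "p \<notin> k ` cball 0 1"
  proof
    assume "p \<in> k ` cball 0 1"
    then obtain x where x: "x \<in> cball 0 1" "p = k x" by blast
    show False
    proof (cases "x \<in> ball 0 1")
      case True then show False using mem_EE_I[of x v] p x v by blast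
    next
      case False
      then have "x \<in> sphere 0 1" using x by auto
      then show False using bdk p x by blast
    qed
  qed
  obtain r where r: "r > 0" "\<And>i. ball (bs i) r \<inter> (\<Union>j. EE j) = {}" using EE_base_ball by blast
  obtain e where e: "e > 0" "\<And>p. FF p \<noteq> 0 \<Longrightarrow> cmod (FF p - 1) < e \<Longrightarrow> cmod (ww p - 1) < e \<Longrightarrow> dist (0, 1) (Arg (FF p), zeta p) < r"
    using near_base[OF r(1)] by blast
  obtain R where R: "R \<ge> 4" "\<And>p. \<bar>p $ 1\<bar> \<ge> R \<Longrightarrow> cmod (FF p - 1) < e \<and> cmod (ww p - 1) < e \<and> Re (FF p) > 0"
    using far_FF[OF e(1)] by blast
  \<comment> \<open>The far point must lie both outside the disk and where the lift is within r of a
    base point, hence the maximum in its first coordinate.\<close>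
  have ck: "compact (k ` cball 0 1)" by (intro compact_continuous_image contk compact_cball)
  then obtain B where B: "\<And>q. q \<in> k ` cball 0 1 \<Longrightarrow> norm q \<le> B"
    using compact_imp_bounded bounded_iff by metis
  define q :: "real^3" where "q = vector [max R (B + 1), 0, 0]"
  have q1: "q $ 1 = max R (B + 1)" by (simp add: q_def vector_3)
  have qk: "q \<notin> k ` cball 0 1"
  proof
    assume "q \<in> k ` cball 0 1"
    then have "norm q \<le> B" by (rule B)
    then show False using component_le_norm_cart[of q 1] q1 by linarith
  qed
  have "\<bar>q $ 1\<bar> \<ge> R" using q1 R(1) by simp
  note q = R(2)[OF this]
  have "path_connected (- (k ` cball 0 1))"
    using connected_complement ck by (simp add: connected_open_path_connected open_Compl compact_imp_closed)
  then obtain g where g: "path g" "path_image g \<subseteq> - (k ` cball 0 1)" "pathstart g = p" "pathfinish g = q"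
    using pk qk unfolding path_connected_def by (metis ComplI)
  have gk: "g t \<notin> k ` cball 0 1" if "t \<in> {0..1}" for t using g(2) that unfolding path_image_def by blast
  have gF: "FF (g t) \<noteq> 0" if "t \<in> {0..1}" for t
  proof
    assume "FF (g t) = 0"
    then have "g t \<in> k ` sphere 0 1" using bdk by simp
    then show False using gk[OF that] sphere_cball by blast
  qed
  have cg: "continuous_on {0..1} g" using g(1) by (simp add: path_def)
  have "continuous_on {0..1} (\<lambda>t. FF (g t))"
    by (intro continuous_on_compose2[OF continuous_FF[of UNIV] cg]) auto
  then obtain l where l: "continuous_on {0..1} l" "\<And>t. t \<in> {0..1} \<Longrightarrow> FF (g t) = exp (l t)"
    using continuous_logarithm_on_contractible[of "{0..1::real}" "\<lambda>t. FF (g t)"] gF convex_imp_contractible[OF convex_real_interval(5)]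
    by metis
  have sg: "sgn (FF (g t)) = cis (Im (l t))" if "t \<in> {0..1}" for t
    using l(2)[OF that] by (simp add: exp_eq_polar sgn_mult sgn_of_real)
  have "cis (fst v) = cis (Im (l 0))" using p sg[of 0] g(3) by (simp add: pathstart_def)
  then obtain m :: int where m: "fst v = Im (l 0) + 2 * pi * of_int m" using cis_eqD by blast
  define u where "u t = (Im (l t) + 2 * pi * of_int m, zeta (g t))" for t
  have u0: "u 0 = v" using m p g(3) by (cases v) (auto simp: u_def pathstart_def)
  have su: "cis (fst (u t)) = sgn (FF (g t))" if "t \<in> {0..1}" for t
    using sg[OF that] by (simp add: u_def cis_shift)
  have uE: "u t \<notin> (\<Union>j. EE j)" if "t \<in> {0..1}" for t
  proof -
    have "u t \<notin> EE j" for j by (rule lift_avoids[OF gk[OF that] su[OF that, symmetric]]) (simp add: u_def)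
    then show ?thesis by blast
  qed
  have "continuous_on {0..1} (\<lambda>t. zeta (g t))"
    using gF by (intro continuous_on_compose2[OF continuous_zeta[of "g ` {0..1}"] cg]) auto
  then have "continuous_on {0..1} u" unfolding u_def by (intro continuous_intros l)
  then have cu: "connected (u ` {0..1})" by (intro connected_continuous_image) auto
  have "cis (fst (u 1)) = cis (Arg (FF q))"
    using su[of 1] g(4) gF[of 1] by (simp add: pathfinish_def cis_Arg)
  then obtain i :: int where i: "fst (u 1) = Arg (FF q) + 2 * pi * of_int i" using cis_eqD by blast
  have "dist (0, 1) (Arg (FF q), zeta q) < r"
    using e(2)[of q] q gF[of 1] g(4) by (auto simp: pathfinish_def)
  moreover have "u 1 - bs (- i) = (Arg (FF q), zeta q) - (0, 1)"
    using i g(4) by (auto simp: u_def bs_def pathfinish_def)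
  ultimately have ub: "u 1 \<in> ball (bs (- i)) r"
    by (metis dist_commute dist_norm mem_ball)
  have "connected (u ` {0..1} \<union> ball (bs (- i)) r)"
  proof (rule connected_Un[OF cu connected_ball])
    have "u 1 \<in> u ` {0..1}" by simp
    then show "u ` {0..1} \<inter> ball (bs (- i)) r \<noteq> {}" using ub by blast
  qed
  moreover have "u ` {0..1} \<union> ball (bs (- i)) r \<subseteq> - (\<Union>j. EE j)" using uE r(2) by blast
  moreover have "v \<in> u ` {0..1}" using u0 by (metis atLeastAtMost_iff imageI order_refl zero_le_one)
  moreover have "bs (- i) \<in> ball (bs (- i)) r" using r(1) by simp
  ultimately show ?thesis unfolding connected_component_def by blast
qed

lemma separators: "periodic_separators EE bs tt"
proof
  show "EE i = (\<lambda>v. v + of_int i *\<^sub>R tt) ` EE 0" for i by (rule EE_shift)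
  show "bs i = bs 0 + of_int i *\<^sub>R tt" for i by (rule bs_shift)
  show "closed (EE 0)" by (rule EE_closed)
  show "connected (EE 0)" unfolding EE_0 by (intro connected_continuous_image ee_cont connected_ball)
  show "EE 0 \<noteq> {}" unfolding EE_0 by simp
  show "\<not> connected (- EE 0)"
  proof (rule closed_plane_separates[where c="bs 0"])
    have "ball (0::complex) 1 homeomorphic (UNIV::complex set)" by (rule homeomorphic_ball_UNIV) simp
    then show "EE 0 homeomorphic (UNIV::complex set)"
      unfolding EE_0 using EE_proper(2) homeomorphic_sym homeomorphic_trans by blast
  qed (auto simp: EE_closed bs_EE)
  show "EE i \<inter> EE j = {}" if "i \<noteq> j" for i j using EE_disjoint[OF that] .
  show "finite {i. EE i \<inter> K \<noteq> {}}" if "compact K" for K using EE_locfin[OF that] .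
  show "bs i \<notin> EE j" for i j by (rule bs_EE)
  show "\<exists>i. connected_component (- (\<Union>j. EE j)) v (bs i)" if "v \<notin> (\<Union>j. EE j)" for v using EE_reach[OF that] .
qed

end

section \<open>Counting intersections for a pair of lines\<close>

context twist_disk
begin

text \<open>Of the translates, 2n separate \<open>bs 0\<close> from \<open>bs (2 * n)\<close>. If
  there were fewer intersection points, one of these would miss both the lift of the first line and
  the zero set of \<open>hh\<close>. The zero set is then on the far side, so \<open>hh\<close> has
  a logarithm on the near side, which contains the lift of the first line closed up near
  \<open>bs 0\<close>. The winding computed on the axis excludes this.\<close>

lemma crossing_bound:
  assumes y0: "\<bar>y0\<bar> \<le> 1/100" and z0: "1/50 \<le> z0" "z0 \<le> 1/25"
    and fA: "finite {p \<in> k ` cball 0 1. p $ 2 = y0 \<and> p $ 3 = z0}" 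
    and fB: "finite {p \<in> k ` cball 0 1. p $ 1 = 0 \<and> p $ 3 = 0}" 
  shows "2 * n \<le> card {p \<in> k ` cball 0 1. p $ 2 = y0 \<and> p $ 3 = z0} + card {p \<in> k ` cball 0 1. p $ 1 = 0 \<and> p $ 3 = 0}"
proof (rule ccontr)
  let ?A = "{p \<in> k ` cball 0 1. p $ 2 = y0 \<and> p $ 3 = z0}" and ?B = "{p \<in> k ` cball 0 1. p $ 1 = 0 \<and> p $ 3 = 0}"
  assume "\<not> 2 * n \<le> card ?A + card ?B"
  then have lt: "card ?A + card ?B < 2 * n" by simp
  interpret periodic_separators EE bs tt by (rule separators)
  obtain K where K: "finite K" "card K = 2 * n"
    "\<And>j. j \<in> K \<Longrightarrow> \<not> connected_component (- EE j) (bs 0) (bs (int (2 * n)))"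
    using many_separators[of "2 * n"] n1 by auto
  obtain r0 where r0: "r0 > 0" "\<And>i. ball (bs i) r0 \<inter> (\<Union>j. EE j) = {}" using EE_base_ball by blast
  define r where "r = min r0 1"
  have r: "r > 0" "r \<le> 1" and rE: "ball (bs 0) r \<inter> EE j = {}" for j
  proof -
    show "r > 0" "r \<le> 1" using r0(1) by (auto simp: r_def)
    have "ball (bs 0) r \<subseteq> ball (bs 0) r0" by (rule subset_ball) (simp add: r_def)
    then show "ball (bs 0) r \<inter> EE j = {}" using r0(2)[of 0] by blast
  qed
  obtain e where e: "e > 0" "\<And>p. FF p \<noteq> 0 \<Longrightarrow> cmod (FF p - 1) < e \<Longrightarrow> cmod (ww p - 1) < e \<Longrightarrow> dist (0, 1) (Arg (FF p), zeta p) < r"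
    using near_base[OF r(1)] by blast
  obtain R1 where R1: "R1 \<ge> 4" "\<And>p. \<bar>p $ 1\<bar> \<ge> R1 \<Longrightarrow> cmod (FF p - 1) < e \<and> cmod (ww p - 1) < e \<and> Re (FF p) > 0"
    using far_FF[OF e(1)] by blast
  obtain R2 where R2: "\<And>R l. R \<ge> R2 \<Longrightarrow> continuous_on {-R..R} l \<Longrightarrow>
    (\<And>x. x \<in> {-R..R} \<Longrightarrow> hh (uax x) = exp (l x)) \<Longrightarrow> Im (l R) - Im (l (-R)) = 4 * pi"
    using axis_winding by blast
  define R where "R = max R1 R2"
  have R: "R \<ge> 4" "R \<ge> R1" "R \<ge> R2" using R1(1) by (auto simp: R_def)
  \<comment> \<open>Rectangle that moves the axis at parameter 0 to the given line at parameter 1.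
    It stays below height 1/25 and so misses the curve, whose height near the first axis is at least
    1/8.\<close>
  define G where "G q = (vector [snd q, fst q * y0, fst q * z0] :: real^3)" for q :: "real \<times> real"
  define Q where "Q = {0..1::real} \<times> {-R..R}"
  have Gc: "G q $ 1 = snd q" "G q $ 2 = fst q * y0" "G q $ 3 = fst q * z0" for q
    by (auto simp: G_def vector_3)
  have contG: "continuous_on S G" for S unfolding G_def by (intro continuous_on_vector3 continuous_intros)
  have G0: "G (0, x) = xax x" for x by (simp add: G_def xax_def)
  have cvQ: "convex Q" unfolding Q_def by (intro convex_Times) auto
  have FG: "FF (G q) \<noteq> 0" if "q \<in> Q" for q
  proof
    assume F: "FF (G q) = 0"
    have t: "0 \<le> fst q" "fst q \<le> 1" using that by (auto simp: Q_def)
    have "\<bar>G q $ 2\<bar> \<le> 1 * (1/100)" unfolding Gc abs_mult using t y0 by (intro mult_mono) auto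
    then have "\<bar>G q $ 3\<bar> \<ge> 1/8" using FF_zero_height[OF F] by simp
    moreover have "\<bar>G q $ 3\<bar> \<le> 1 * (1/25)" unfolding Gc abs_mult using t z0 by (intro mult_mono) auto
    ultimately show False by simp
  qed
  have cFG: "continuous_on Q (\<lambda>q. FF (G q))"
    by (intro continuous_on_compose2[OF continuous_FF[of UNIV] contG]) auto
  obtain l where l: "continuous_on Q l" "\<And>q. q \<in> Q \<Longrightarrow> FF (G q) = exp (l q)"
    using continuous_logarithm_on_contractible[OF cFG convex_imp_contractible[OF cvQ] FG] by metis
  have sl: "sgn (FF (G q)) = cis (Im (l q))" if "q \<in> Q" for q
    using l(2)[OF that] by (simp add: exp_eq_polar sgn_mult sgn_of_real)
  have sx: "sgn (FF (xax x)) = cis (alx x)" for x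
  proof -
    have "sgn (FF (xax x)) = sgn (GG x) * cis (- 2 * psi (aa x))"
      unfolding xax_z sgn_mult by (simp add: sgn_eq[of "cis _"])
    also have "sgn (GG x) = cis (Arg (GG x))" using GG_nz by (simp add: cis_Arg)
    finally show ?thesis by (simp add: cis_mult alx_def)
  qed
  have q0: "(0, -R) \<in> Q" using R by (auto simp: Q_def)
  \<comment> \<open>The integer adjusts the continuous argument on the rectangle to agree with
    \<open>alx\<close> along the axis.\<close>
  obtain m :: int where m: "alx (-R) = Im (l (0, -R)) + 2 * pi * of_int m"
    using sl[OF q0] sx[of "-R"] cis_eqD unfolding G0 by metis
  define al where "al q = Im (l q) + 2 * pi * of_int m" for q
  have cal: "continuous_on Q al" unfolding al_def by (intro continuous_intros l)
  have sal: "sgn (FF (G q)) = cis (al q)" if "q \<in> Q" for q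
    using sl[OF that] by (simp add: al_def cis_shift)
  have const: "al (a x) - f x = al (a y) - f y"
    if "connected S" "continuous_on S a" "a ` S \<subseteq> Q" "continuous_on S f"
      "\<And>x. x \<in> S \<Longrightarrow> sgn (FF (G (a x))) = cis (f x)" "x \<in> S" "y \<in> S" for a :: "real \<Rightarrow> real \<times> real" and f S x y
  proof -
    have "\<i> * of_real (al (a x) - f x) = \<i> * of_real (al (a y) - f y)"
    proof (rule integer_valued_constant[OF that(1) _ _ that(6,7)])
      show "continuous_on S (\<lambda>x. \<i> * of_real (al (a x) - f x))"
        using that by (intro continuous_intros continuous_on_compose2[OF cal]) auto
      show "exp (\<i> * of_real (al (a u) - f u)) = 1" if "u \<in> S" for u
      proof -
        have "cis (al (a u)) = cis (f u)" using sal[of "a u"] \<open>a ` S \<subseteq> Q\<close> that \<open>\<And>x. x \<in> S \<Longrightarrow> sgn (FF (G (a x))) = cis (f x)\<close> by fastforce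
        then have "cis (al (a u) - f u) = 1" by (simp flip: cis_divide)
        then show ?thesis by (simp add: cis_conv_exp)
      qed
    qed
    then show ?thesis by (simp flip: of_real_diff)
  qed
  have al0: "al (0, x) = alx x" if x: "x \<in> {-R..R}" for x
  proof -
    have "al (0, x) - alx x = al (0, -R) - alx (-R)"
      by (rule const[of "{-R..R}" "\<lambda>x. (0, x)"])
         (use x R sx G0 in \<open>auto simp: Q_def intro!: continuous_intros continuous_alx\<close>)
    then show ?thesis using m by (simp add: al_def)
  qed
  \<comment> \<open>At both short ends the real part of \<open>FF\<close> is positive and no twist
    is left, so the lift returns to the sheet of the principal argument.\<close>
  have alR: "al (t, s) = Arg (FF (G (t, s)))" if t: "t \<in> {0..1}" and s: "s = R \<or> s = -R" for t s
  proof -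
    have ReF: "Re (FF (G (t, s))) > 0" for t using R1(2)[of "G (t, s)"] s R by (auto simp: Gc)
    have "al (t, s) - Arg (FF (G (t, s))) = al (0, s) - Arg (FF (G (0, s)))"
    proof (rule const[of "{0..1}" "\<lambda>t. (t, s)"])
      show "continuous_on {0..1} (\<lambda>t. Arg (FF (G (t, s))))"
        using ReF by (intro continuous_intros continuous_on_compose2[OF cFG])
          (use s R in \<open>auto simp: Q_def complex_nonpos_Reals_iff not_le\<close>)
      show "sgn (FF (G (u, s))) = cis (Arg (FF (G (u, s))))" if "u \<in> {0..1}" for u
        using FG[of "(u, s)"] that s R by (auto simp: Q_def cis_Arg)
    qed (use t s R in \<open>auto simp: Q_def intro!: continuous_intros\<close>)
    moreover have "al (0, s) = Arg (FF (G (0, s)))"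
    proof -
      have "aa s \<le> 3/5"
      proof -
        define q where "q = s\<^sup>2"
        have "\<bar>s\<bar> * 4 \<le> \<bar>s\<bar> * \<bar>s\<bar>" using s R(1) by (intro mult_left_mono) auto
        then have "\<bar>s\<bar> * 4 \<le> q" unfolding q_def power2_eq_square by simp
        then have "10 * s \<le> 3 + 3 * q" by linarith
        then have "10 * s \<le> 3 * (1 + s\<^sup>2)" by (simp add: q_def)
        then show ?thesis unfolding aa_def using ab(2)[of s] by (simp add: divide_simps)
      qed
      then have "psi (aa s) = 0" by (simp add: psi_def tstep_simps)
      then show ?thesis using al0[of s] s R unfolding G0 xax_z alx_def by auto
    qed
    ultimately show ?thesis by simp
  qed
  define v where "v q = (al q, zeta (G q))" for q
  have cv: "continuous_on Q v"
    unfolding v_def using FG by (intro continuous_intros cal continuous_on_compose2[OF continuous_zeta[of "G ` Q"] contG]) auto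
  have v0: "v (0, x) = uax x" if "x \<in> {-R..R}" for x using al0[OF that] by (simp add: v_def uax_def G0)
  \<comment> \<open>Close to the sheet of \<open>bs 0\<close> the angle is outside the window of
    \<open>Cw\<close>, which makes the real part at most -sqrt 2.\<close>
  have negB: "Re (hh u) < 0" if "\<bar>fst u\<bar> < pi/2" for u
  proof -
    have "4 * pi * 1 \<le> 4 * pi * real n" using n1 by (intro mult_left_mono) auto
    then have "fst u - pi/4 + 4 * pi * real n > pi" using that pi_gt_zero by linarith
    then have "Cw (fst u - pi/4) = -1" by (intro Cw_out) linarith
    then have "Re (hh u) = - sqrt 2 - (Re (snd u))\<^sup>2" by (simp add: hh_def)
    then show ?thesis using zero_le_power2[of "Re (snd u)"] by (smt (verit) real_sqrt_gt_zero)
  qed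
  have negS: "Re (hh (v (t, s))) < 0" if "t \<in> {0..1}" "s = R \<or> s = -R" for t s
  proof -
    have "Re (FF (G (t, s))) > 0" using R1(2)[of "G (t, s)"] that R by (auto simp: Gc)
    then have "\<bar>Arg (FF (G (t, s)))\<bar> < pi/2" unfolding Arg_Re_pos by simp
    then show ?thesis using alR[OF that] by (intro negB) (simp add: v_def)
  qed
  \<comment> \<open>A zero would project to the second axis. The rectangle meets that axis at the
    origin only, and there the lift is at angle 0, far from the chosen lift of the axis.\<close>
  have nz: "hh (v q) \<noteq> 0" if q: "q \<in> Q" for q
  proof
    assume h: "hh (v q) = 0"
    have s: "sgn (FF (G q)) = cis (fst (v q))" "zeta (G q) = snd (v q)" using sal[OF q] by (simp_all add: v_def)
    have "G q $ 1 = 0" "G q $ 3 = 0" using hh_zero_point[OF h FG[OF q] s] by simp_all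
    then have "q = (0, 0)" using z0 by (cases q) (auto simp: Gc)
    then have "v q = uax 0" using v0[of 0] R by simp
    moreover have "alx 0 = 0" by (simp add: alx_def GG_def aa_def bb_def psi_def tstep_simps)
    ultimately have "\<bar>fst (v q)\<bar> < pi/2" using pi_gt_zero by (simp add: uax_def)
    then show False using negB[of "v q"] h by simp
  qed
  have chv: "continuous_on Q (\<lambda>q. hh (v q))"
    by (intro continuous_on_compose2[OF continuous_hh[of UNIV] cv]) auto
  obtain la where la: "continuous_on Q la" "\<And>q. q \<in> Q \<Longrightarrow> hh (v q) = exp (la q)"
    using continuous_logarithm_on_contractible[OF chv convex_imp_contractible[OF cvQ] nz] by metis
  have W: "Im (la (0, R)) - Im (la (0, -R)) = 4 * pi"
  proof (rule R2[of R "\<lambda>x. la (0, x)"])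
    show "continuous_on {-R..R} (\<lambda>x. la (0, x))"
      by (intro continuous_on_compose2[OF la(1)] continuous_intros) (auto simp: Q_def)
    show "hh (uax x) = exp (la (0, x))" if "x \<in> {-R..R}" for x
      using la(2)[of "(0, x)"] v0[OF that] that by (simp add: Q_def)
  qed (rule R)
  have side: "\<bar>Im (la (1, s)) - Im (la (0, s))\<bar> < pi" if s: "s = R \<or> s = -R" for s
  proof (rule half_plane_log_difference[of "{0..1}" "\<lambda>t. la (t, s)" "\<lambda>t. hh (v (t, s))"])
    show "continuous_on {0..1} (\<lambda>t. la (t, s))" "continuous_on {0..1} (\<lambda>t. hh (v (t, s)))"
      using s R by (intro continuous_on_compose2[OF la(1)] continuous_on_compose2[OF chv] continuous_intros; auto simp: Q_def)+
    show "hh (v (t, s)) = exp (la (t, s))" if "t \<in> {0..1}" for t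
      using la(2)[of "(t, s)"] that s R by (auto simp: Q_def)
    show "Re (hh (v (t, s))) < 0" if "t \<in> {0..1}" for t using negS that s by blast
  qed auto
  have in1: "(1, x) \<in> Q" if "x \<in> {-R..R}" for x using that by (simp add: Q_def)
  \<comment> \<open>Translates that meet the lifted line; \<open>Bad2\<close> collects those that
    meet the lifted second axis. Each yields its own point of the disk on the corresponding
    line.\<close>
  define Bad1 where "Bad1 = {j. \<exists>x\<in>{-R..R}. v (1, x) \<in> EE j}"
  define Bad2 where "Bad2 = {j. \<exists>u. hh u = 0 \<and> u \<in> EE j}"
  have c1: "card Bad1 \<le> card ?A"
  proof -
    have "\<exists>x. x \<in> {-R..R} \<and> v (1, x) \<in> EE j" if "j \<in> Bad1" for j using that by (auto simp: Bad1_def)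
    then obtain x where x: "\<And>j. j \<in> Bad1 \<Longrightarrow> x j \<in> {-R..R}" "\<And>j. j \<in> Bad1 \<Longrightarrow> v (1, x j) \<in> EE j" by metis
    show ?thesis
    proof (rule card_inj_on_le[of "\<lambda>j. G (1, x j)"])
      show "inj_on (\<lambda>j. G (1, x j)) Bad1"
      proof (rule inj_onI)
        fix i j assume ij: "i \<in> Bad1" "j \<in> Bad1" "G (1, x i) = G (1, x j)"
        then have "x i = x j" using arg_cong[OF ij(3), of "\<lambda>p. p $ 1"] unfolding Gc snd_conv by blast
        then have "v (1, x i) \<in> EE i \<inter> EE j" using x(2)[OF ij(1)] x(2)[OF ij(2)] by (metis IntI)
        then show "i = j" using EE_disjoint by blast
      qed
      show "(\<lambda>j. G (1, x j)) ` Bad1 \<subseteq> ?A"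
      proof (rule image_subsetI)
        fix j assume j: "j \<in> Bad1"
        obtain y where y: "y \<in> ball 0 1" "sgn (FF (k y)) = cis (fst (v (1, x j)))" "zeta (k y) = snd (v (1, x j))"
          using mem_EE_D[OF x(2)[OF j]] by metis
        have "k y = G (1, x j)"
          using lift_injective[OF FF_ball[OF y(1)] FG[OF in1[OF x(1)[OF j]]]] y sal[OF in1[OF x(1)[OF j]]]
          by (simp add: v_def)
        then have "G (1, x j) \<in> k ` cball 0 1" using y(1) by (metis ball_subset_cball imageI subsetD)
        then show "G (1, x j) \<in> ?A" by (simp add: Gc)
      qed
    qed (rule fA)
  qed
  have c2: "card Bad2 \<le> card ?B"
  proof -
    have "\<exists>u y. hh u = 0 \<and> u \<in> EE j \<and> y \<in> ball 0 1 \<and> sgn (FF (k y)) = cis (fst u) \<and> zeta (k y) = snd u" if "j \<in> Bad2" for j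
      using that mem_EE_D unfolding Bad2_def by (smt (verit) mem_Collect_eq)
    then obtain u y where u: "\<And>j. j \<in> Bad2 \<Longrightarrow> hh (u j) = 0" "\<And>j. j \<in> Bad2 \<Longrightarrow> u j \<in> EE j"
      and y: "\<And>j. j \<in> Bad2 \<Longrightarrow> y j \<in> ball 0 1" "\<And>j. j \<in> Bad2 \<Longrightarrow> sgn (FF (k (y j))) = cis (fst (u j))"
        "\<And>j. j \<in> Bad2 \<Longrightarrow> zeta (k (y j)) = snd (u j)" by metis
    show ?thesis
    proof (rule card_inj_on_le[of "\<lambda>j. k (y j)"])
      show "inj_on (\<lambda>j. k (y j)) Bad2"
      proof (rule inj_onI)
        fix i j assume ij: "i \<in> Bad2" "j \<in> Bad2" "k (y i) = k (y j)"
        have "cis (fst (u i)) = cis (fst (u j))" and s: "snd (u i) = snd (u j)"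
          using y(2)[OF ij(1)] y(2)[OF ij(2)] y(3)[OF ij(1)] y(3)[OF ij(2)] ij(3) by auto
        then obtain m :: int where m: "fst (u i) = fst (u j) + 2 * pi * of_int m" using cis_eqD by blast
        \<comment> \<open>The zero set of \<open>hh\<close> spans an interval of angles of length at
          most pi, so distinct points of it never lie over the same point of space.\<close>
        have "\<bar>fst (u i) - fst (u j)\<bar> \<le> pi"
          using hh_zeroD(1)[OF u(1)[OF ij(1)]] hh_zeroD(1)[OF u(1)[OF ij(2)]] by linarith
        then have "pi * \<bar>2 * real_of_int m\<bar> \<le> pi * 1" using m by (simp add: abs_mult)
        then have "\<bar>2 * real_of_int m\<bar> \<le> 1" using pi_gt_zero mult_le_cancel_left_pos by blast
        then have "m = 0" by linarith
        then have "u i = u j" using m s by (simp add: prod_eq_iff)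
        then have "u i \<in> EE i \<inter> EE j" using u(2)[OF ij(1)] u(2)[OF ij(2)] by (metis IntI)
        then show "i = j" using EE_disjoint by blast
      qed
      show "(\<lambda>j. k (y j)) ` Bad2 \<subseteq> ?B"
      proof (rule image_subsetI)
        fix j assume j: "j \<in> Bad2"
        have "k (y j) $ 1 = 0" "k (y j) $ 3 = 0"
          using hh_zero_point[OF u(1)[OF j] FF_ball[OF y(1)[OF j]] y(2)[OF j] y(3)[OF j]] by auto
        moreover have "k (y j) \<in> k ` cball 0 1" using y(1)[OF j] by (metis ball_subset_cball imageI subsetD)
        ultimately show "k (y j) \<in> ?B" by simp
      qed
    qed (rule fB)
  qed
  have "\<not> K \<subseteq> Bad1 \<union> Bad2"
  proof
    assume sub: "K \<subseteq> Bad1 \<union> Bad2"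
    have f1: "finite Bad1"
    proof -
      have "compact ((\<lambda>x. v (1, x)) ` {-R..R})"
        using in1 by (intro compact_continuous_image continuous_on_compose2[OF cv] continuous_intros) auto
      from EE_locfin[OF this] show ?thesis by (rule rev_finite_subset) (auto simp: Bad1_def)
    qed
    have f2: "finite Bad2"
    proof -
      have "bounded {u. hh u = 0}"
      proof (rule boundedI)
        fix u assume "u \<in> {u. hh u = 0}"
        then have z: "\<bar>fst u - pi/4 + 4 * pi * n\<bar> \<le> pi/2" "sqrt 2 * cos (fst u - pi/4) = (Re (snd u))\<^sup>2" "Im (snd u) = 0"
          using hh_zeroD by auto
        have "0 \<le> 4 * pi * n" by simp
        then have "\<bar>fst u\<bar> \<le> pi + 4 * pi * n" using z(1) pi_gt_zero by linarith
        moreover have "(Re (snd u))\<^sup>2 \<le> 2\<^sup>2"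
        proof -
          have "sqrt 2 * cos (fst u - pi/4) \<le> sqrt 2 * 1" by (intro mult_left_mono) auto
          also have "\<dots> \<le> 2" using real_sqrt_le_mono[of 2 4] by simp
          finally show ?thesis using z(2) by simp
        qed
        then have "\<bar>Re (snd u)\<bar> \<le> 2" by (metis abs_le_square_iff abs_numeral)
        then have "cmod (snd u) \<le> 2" using z(3) cmod_le[of "snd u"] by simp
        ultimately show "norm u \<le> (pi + 4 * pi * n) + 2"
          using norm_Pair_le[of "fst u" "snd u"] by simp
      qed
      moreover have "closed {u. hh u = 0}"
        using continuous_closed_preimage_constant[of UNIV hh 0] continuous_hh[of UNIV] by simp
      ultimately have "compact {u. hh u = 0}" by (simp add: compact_eq_bounded_closed)
      from EE_locfin[OF this] show ?thesis by (rule rev_finite_subset) (auto simp: Bad2_def)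
    qed
    have "card K \<le> card (Bad1 \<union> Bad2)" using sub f1 f2 by (intro card_mono) auto
    also have "\<dots> \<le> card Bad1 + card Bad2" by (rule card_Un_le)
    finally show False using K(2) c1 c2 lt by linarith
  qed
  then obtain j where j: "j \<in> K" "j \<notin> Bad1" "j \<notin> Bad2" by blast
  \<comment> \<open>The zero set is connected, misses \<open>EE j\<close> and contains the base
    point of index 2n, so it lies beyond the separator.\<close>
  have nzj: "hh u \<noteq> 0" if u: "connected_component (- EE j) (bs 0) u \<or> u \<in> EE j" for u
  proof
    assume h: "hh u = 0"
    then have "u \<notin> EE j" using j(3) unfolding Bad2_def by blast
    then have cu: "connected_component (- EE j) (bs 0) u" using u by blast
    have "connected_component (- EE j) u (bs (int (2 * n)))"
    proof (rule connected_subset_component[OF hh_zero_connected])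
      show "{v. hh v = 0} \<inter> EE j = {}" using j(3) by (auto simp: Bad2_def)
      show "bs (int (2 * n)) \<in> {v. hh v = 0}" using hh_zero_base by (simp add: bs_def mult.assoc)
    qed (use h in auto)
    then show False using K(3)[OF j(1)] connected_component_trans[OF cu] by blast
  qed
  obtain mm where mm: "continuous_on UNIV mm" "\<And>u. connected_component (- EE j) (bs 0) u \<Longrightarrow> hh u = exp (mm u)"
    using logarithm_on_side[OF EE_closed EE_contractible continuous_hh[of UNIV] nzj] by blast
  have vb: "v (1, s) \<in> ball (bs 0) r" if s: "s = R \<or> s = -R" for s
  proof -
    have "FF (G (1, s)) \<noteq> 0" using FG[of "(1, s)"] s R by (auto simp: Q_def)
    moreover have "\<bar>G (1, s) $ 1\<bar> \<ge> R1" using s R by (auto simp: Gc)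
    ultimately have "dist (0, 1) (Arg (FF (G (1, s))), zeta (G (1, s))) < r" using e(2) R1(2) by blast
    then show ?thesis using alR[of 1 s] s by (simp add: v_def bs_def)
  qed
  let ?P = "(\<lambda>x. v (1, x)) ` {-R..R}"
  have "connected ?P" using in1
    by (intro connected_continuous_image continuous_on_compose2[OF cv] continuous_intros) auto
  moreover have "v (1, R) \<in> ?P" using R by auto
  ultimately have con: "connected (ball (bs 0) r \<union> ?P)" using vb[of R] by (intro connected_Un) auto
  have disj: "(ball (bs 0) r \<union> ?P) \<inter> EE j = {}" using rE[of j] j(2) by (auto simp: Bad1_def)
  have cc: "connected_component (- EE j) (bs 0) u" if "u \<in> ball (bs 0) r \<union> ?P" for u
    using connected_subset_component[OF con disj _ that] r(1) by simp
  \<comment> \<open>Along the lifted line both functions are logarithms of \<open>hh\<close>: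
    \<open>la\<close> from the rectangle, \<open>mm\<close> from the near side of the
    separator.\<close>
  have "la (1, R) - mm (v (1, R)) = la (1, -R) - mm (v (1, -R))"
  proof (rule integer_valued_constant[of "{-R..R}" "\<lambda>x. la (1, x) - mm (v (1, x))"])
    show "continuous_on {-R..R} (\<lambda>x. la (1, x) - mm (v (1, x)))"
      using in1 by (intro continuous_intros continuous_on_compose2[OF la(1)] continuous_on_compose2[OF mm(1)] continuous_on_compose2[OF cv]) auto
    show "exp (la (1, x) - mm (v (1, x))) = 1" if "x \<in> {-R..R}" for x
      using la(2)[OF in1[OF that]] mm(2)[OF cc, of "v (1, x)"] that nz[OF in1[OF that]] by (simp add: exp_diff)
  qed (use R in auto)
  then have eq: "Im (la (1, R)) - Im (la (1, -R)) = Im (mm (v (1, R))) - Im (mm (v (1, -R)))"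
    by (simp add: complex_eq_iff algebra_simps)
  have "\<bar>Im (mm (v (1, R))) - Im (mm (v (1, -R)))\<bar> < pi"
  proof (rule half_plane_log_difference[of "ball (bs 0) r" mm hh])
    show "hh u = exp (mm u)" if "u \<in> ball (bs 0) r" for u using mm(2)[OF cc] that by blast
    show "Re (hh u) < 0" if "u \<in> ball (bs 0) r" for u
    proof (rule negB)
      have "dist (fst (bs 0)) (fst u) < r" using that dist_fst_le[of "bs 0" u] by simp
      then show "\<bar>fst u\<bar> < pi/2" using r(2) pi_gt3 by (simp add: bs_def dist_real_def)
    qed
    show "v (1, R) \<in> ball (bs 0) r" "v (1, -R) \<in> ball (bs 0) r" using vb by blast+
  qed (use continuous_on_subset[OF mm(1)] continuous_hh in auto)
  \<comment> \<open>Moving from the axis to the line changes 4 pi by less than pi at each end,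
    leaving more than 2 pi. Near \<open>bs 0\<close>, however, \<open>hh\<close> has negative real
    part, so the change is below pi.\<close>
  then show False using eq W side[of R] side[of "-R"] by linarith
qed

end

section \<open>Curvature bounds uniform in the number of twists\<close>

text \<open>Bounds value and first two derivatives at one point by one constant. The first
  derivative is required only nearby, so that locally different formulas can be used.\<close>

definition jet2 :: "real \<Rightarrow> (real \<Rightarrow> real) \<Rightarrow> real \<Rightarrow> bool" where
  "jet2 K f t \<longleftrightarrow> (\<exists>f1 f2. (\<forall>\<^sub>F s in nhds t. (f has_real_derivative f1 s) (at s)) \<and>
     (f1 has_real_derivative f2) (at t) \<and> \<bar>f t\<bar> \<le> K \<and> \<bar>f1 t\<bar> \<le> K \<and> \<bar>f2\<bar> \<le> K)"

lemma jet2_mono: "jet2 K f t \<Longrightarrow> K \<le> L \<Longrightarrow> jet2 L f t"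
  unfolding jet2_def by (meson order_trans)

lemma jet2_cong:
  assumes "\<forall>\<^sub>F s in nhds t. f s = g s" "jet2 K f t" shows "jet2 K g t"
proof -
  obtain f1 f2 where f: "\<forall>\<^sub>F s in nhds t. (f has_real_derivative f1 s) (at s)" "(f1 has_real_derivative f2) (at t)"
    "\<bar>f t\<bar> \<le> K" "\<bar>f1 t\<bar> \<le> K" "\<bar>f2\<bar> \<le> K" using assms(2) by (auto simp: jet2_def)
  obtain U where U: "open U" "t \<in> U" "\<And>s. s \<in> U \<Longrightarrow> f s = g s"
    using assms(1) unfolding eventually_nhds by blast
  have "\<forall>\<^sub>F s in nhds t. s \<in> U" using U eventually_nhds by blast
  then have "\<forall>\<^sub>F s in nhds t. (g has_real_derivative f1 s) (at s)"
    using f(1)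
  proof eventually_elim
    case (elim s)
    then show ?case using has_field_derivative_transform_within_open[of f "f1 s" s U g] U by blast
  qed
  then show ?thesis using f U(3)[OF U(2)] unfolding jet2_def by metis
qed

lemma jet2_const: "\<bar>c\<bar> \<le> K \<Longrightarrow> jet2 K (\<lambda>s. c) t"
  unfolding jet2_def by (rule exI[of _ "\<lambda>_. 0"], rule exI[of _ 0]) (auto intro: order_trans[OF abs_ge_zero])

lemma jet2_add:
  assumes "jet2 K f t" "jet2 L g t" shows "jet2 (K + L) (\<lambda>s. f s + g s) t"
proof -
  obtain f1 f2 where f: "\<forall>\<^sub>F s in nhds t. (f has_real_derivative f1 s) (at s)" "(f1 has_real_derivative f2) (at t)"
    "\<bar>f t\<bar> \<le> K" "\<bar>f1 t\<bar> \<le> K" "\<bar>f2\<bar> \<le> K" using assms(1) by (auto simp: jet2_def)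
  obtain g1 g2 where g: "\<forall>\<^sub>F s in nhds t. (g has_real_derivative g1 s) (at s)" "(g1 has_real_derivative g2) (at t)"
    "\<bar>g t\<bar> \<le> L" "\<bar>g1 t\<bar> \<le> L" "\<bar>g2\<bar> \<le> L" using assms(2) by (auto simp: jet2_def)
  have "\<forall>\<^sub>F s in nhds t. ((\<lambda>s. f s + g s) has_real_derivative f1 s + g1 s) (at s)"
    using f(1) g(1) by eventually_elim (rule DERIV_add)
  moreover have "((\<lambda>s. f1 s + g1 s) has_real_derivative f2 + g2) (at t)" using f(2) g(2) by (rule DERIV_add)
  moreover have "\<bar>f t + g t\<bar> \<le> K + L" "\<bar>f1 t + g1 t\<bar> \<le> K + L" "\<bar>f2 + g2\<bar> \<le> K + L"
    using f(3-5) g(3-5) by linarith+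
  ultimately show ?thesis unfolding jet2_def
    by (intro exI[of _ "\<lambda>s. f1 s + g1 s"] exI[of _ "f2 + g2"]) blast
qed

text \<open>The second derivative of a product has four terms, each at most K L.\<close>

lemma jet2_mult:
  assumes "jet2 K f t" "jet2 L g t" shows "jet2 (4 * K * L) (\<lambda>s. f s * g s) t"
proof -
  obtain f1 f2 where f: "\<forall>\<^sub>F s in nhds t. (f has_real_derivative f1 s) (at s)" "(f1 has_real_derivative f2) (at t)"
    "\<bar>f t\<bar> \<le> K" "\<bar>f1 t\<bar> \<le> K" "\<bar>f2\<bar> \<le> K" using assms(1) by (auto simp: jet2_def)
  obtain g1 g2 where g: "\<forall>\<^sub>F s in nhds t. (g has_real_derivative g1 s) (at s)" "(g1 has_real_derivative g2) (at t)"
    "\<bar>g t\<bar> \<le> L" "\<bar>g1 t\<bar> \<le> L" "\<bar>g2\<bar> \<le> L" using assms(2) by (auto simp: jet2_def)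
  have b: "\<bar>x * y\<bar> \<le> K * L" if "\<bar>x\<bar> \<le> K" "\<bar>y\<bar> \<le> L" for x y
    unfolding abs_mult using that by (intro mult_mono) auto
  have df: "(f has_real_derivative f1 t) (at t)" "(g has_real_derivative g1 t) (at t)"
    using f(1) g(1) eventually_nhds_x_imp_x by blast+
  have "\<forall>\<^sub>F s in nhds t. ((\<lambda>s. f s * g s) has_real_derivative f1 s * g s + g1 s * f s) (at s)"
    using f(1) g(1) by eventually_elim (rule DERIV_mult)
  moreover have "((\<lambda>s. f1 s * g s + g1 s * f s) has_real_derivative (f2 * g t + g1 t * f1 t) + (g2 * f t + f1 t * g1 t)) (at t)"
    using f(2) g(2) df by (intro DERIV_add DERIV_mult)
  moreover have "\<bar>f t * g t\<bar> \<le> 4 * K * L" "\<bar>f1 t * g t + g1 t * f t\<bar> \<le> 4 * K * L"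
    "\<bar>(f2 * g t + g1 t * f1 t) + (g2 * f t + f1 t * g1 t)\<bar> \<le> 4 * K * L"
    using b[OF f(3) g(3)] b[OF f(4) g(3)] b[OF f(3) g(4)] b[OF f(5) g(3)] b[OF f(4) g(4)] b[OF f(3) g(5)]
    unfolding mult.commute[of "g1 t" "f t"] mult.commute[of g2] mult.commute[of "g1 t" "f1 t"] mult.assoc[of 4] by linarith+
  ultimately show ?thesis unfolding jet2_def
    by (intro exI[of _ "\<lambda>s. f1 s * g s + g1 s * f s"] exI[of _ "(f2 * g t + g1 t * f1 t) + (g2 * f t + f1 t * g1 t)"]) blast
qed

lemma jet2_inverse:
  assumes "jet2 K f t" "f t \<ge> 1/2" shows "jet2 (8 * K + 16 * K\<^sup>2 + 2) (\<lambda>s. inverse (f s)) t"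
proof -
  obtain f1 f2 where f: "\<forall>\<^sub>F s in nhds t. (f has_real_derivative f1 s) (at s)" "(f1 has_real_derivative f2) (at t)"
    "\<bar>f t\<bar> \<le> K" "\<bar>f1 t\<bar> \<le> K" "\<bar>f2\<bar> \<le> K" using assms(1) by (auto simp: jet2_def)
  have K: "K \<ge> 0" using f by linarith
  have df: "(f has_real_derivative f1 t) (at t)" using f(1) eventually_nhds_x_imp_x by blast
  have ev: "\<forall>\<^sub>F s in nhds t. f s \<noteq> 0"
  proof -
    have "isCont f t" using df DERIV_isCont by blast
    then have "(f \<longlongrightarrow> f t) (nhds t)" by (simp add: isCont_def filterlim_at_within_not_equal tendsto_at_iff_tendsto_nhds)
    then show ?thesis using tendsto_imp_eventually_ne[of f "f t" "nhds t" 0] assms(2) by auto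
  qed
  have d1: "\<forall>\<^sub>F s in nhds t. ((\<lambda>s. inverse (f s)) has_real_derivative - (f1 s * (inverse (f s) * inverse (f s)))) (at s)"
    using f(1) ev
  proof eventually_elim
    case (elim s)
    then show ?case using DERIV_inverse_fun[of f "f1 s" s UNIV] by (simp add: power2_eq_square)
  qed
  then have di: "((\<lambda>s. inverse (f s)) has_real_derivative - (f1 t * (inverse (f t) * inverse (f t)))) (at t)"
    using eventually_nhds_x_imp_x by blast
  define u where "u = inverse (f t)"
  have u: "0 < u" "u \<le> 2" using assms(2) by (auto simp: u_def field_simps)
  have d2: "((\<lambda>s. - (f1 s * (inverse (f s) * inverse (f s)))) has_real_derivative
      - (f2 * (u * u) + (- (f1 t * (u * u)) * u + - (f1 t * (u * u)) * u) * f1 t)) (at t)"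
    unfolding u_def using f(2) di by (intro DERIV_minus DERIV_mult)
  have uu: "0 \<le> u * u" "u * u \<le> 4" using u mult_mono[of u 2 u 2] by auto
  have uuu: "0 \<le> u * u * u" "u * u * u \<le> 8" using u uu mult_mono[of "u * u" 4 u 2] by auto
  have "\<bar>f1 t * (u * u)\<bar> \<le> K * 4" unfolding abs_mult[of "f1 t"] using f(4) uu K by (intro mult_mono) auto
  moreover have "\<bar>f2 * (u * u)\<bar> \<le> K * 4" unfolding abs_mult[of f2] using f(5) uu K by (intro mult_mono) auto
  moreover have "\<bar>(- (f1 t * (u * u)) * u + - (f1 t * (u * u)) * u) * f1 t\<bar> \<le> 16 * K\<^sup>2"
  proof -
    have "(- (f1 t * (u * u)) * u + - (f1 t * (u * u)) * u) * f1 t = - (2 * (u * u * u) * (f1 t)\<^sup>2)"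
      by (simp add: power2_eq_square algebra_simps)
    moreover have "2 * (u * u * u) * (f1 t)\<^sup>2 \<le> 16 * K\<^sup>2"
    proof (rule mult_mono)
      show "(f1 t)\<^sup>2 \<le> K\<^sup>2" using f(4) K by (metis abs_le_square_iff abs_of_nonneg)
    qed (use uuu in auto)
    moreover have "0 \<le> 2 * (u * u * u) * (f1 t)\<^sup>2" using uuu(1) by simp
    ultimately show ?thesis by linarith
  qed
  moreover have "\<bar>u\<bar> \<le> 8 * K + 16 * K\<^sup>2 + 2" using u K zero_le_power2[of K] by linarith
  moreover have "K\<^sup>2 \<ge> 0" by simp
  ultimately have "\<bar>inverse (f t)\<bar> \<le> 8 * K + 16 * K\<^sup>2 + 2" "\<bar>- (f1 t * (inverse (f t) * inverse (f t)))\<bar> \<le> 8 * K + 16 * K\<^sup>2 + 2"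
    "\<bar>- (f2 * (u * u) + (- (f1 t * (u * u)) * u + - (f1 t * (u * u)) * u) * f1 t)\<bar> \<le> 8 * K + 16 * K\<^sup>2 + 2"
    unfolding u_def[symmetric] using K by linarith+
  with d1 d2 show ?thesis unfolding jet2_def
    by (intro exI[of _ "\<lambda>s. - (f1 s * (inverse (f s) * inverse (f s)))"]
       exI[of _ "- (f2 * (u * u) + (- (f1 t * (u * u)) * u + - (f1 t * (u * u)) * u) * f1 t)"]) blast
qed

lemma jet2_compose:
  assumes f: "jet2 K f t" and g: "\<And>x. (g has_real_derivative g1 x) (at x)" "\<And>x. (g1 has_real_derivative g2 x) (at x)"
    and B: "\<And>x. \<bar>g x\<bar> \<le> B" "\<And>x. \<bar>g1 x\<bar> \<le> B" "\<And>x. \<bar>g2 x\<bar> \<le> B"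
  shows "jet2 (B + B * K + B * K\<^sup>2) (\<lambda>s. g (f s)) t"
proof -
  obtain f1 f2 where f: "\<forall>\<^sub>F s in nhds t. (f has_real_derivative f1 s) (at s)" "(f1 has_real_derivative f2) (at t)"
    "\<bar>f t\<bar> \<le> K" "\<bar>f1 t\<bar> \<le> K" "\<bar>f2\<bar> \<le> K" using assms(1) by (auto simp: jet2_def)
  have K: "K \<ge> 0" "B \<ge> 0" using f B(1)[of 0] by linarith+
  have df: "(f has_real_derivative f1 t) (at t)" using f(1) eventually_nhds_x_imp_x by blast
  have "\<forall>\<^sub>F s in nhds t. ((\<lambda>s. g (f s)) has_real_derivative g1 (f s) * f1 s) (at s)"
    using f(1) by eventually_elim (rule DERIV_chain2[OF g(1)])
  moreover have "((\<lambda>s. g1 (f s) * f1 s) has_real_derivative (g2 (f t) * f1 t) * f1 t + f2 * g1 (f t)) (at t)"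
    using f(2) DERIV_chain2[OF g(2) df] by (intro DERIV_mult)
  moreover have "\<bar>g1 (f t) * f1 t\<bar> \<le> B * K" "\<bar>f2 * g1 (f t)\<bar> \<le> B * K"
    unfolding abs_mult mult.commute[of "\<bar>f2\<bar>"] using B f K by (intro mult_mono; simp)+
  moreover have "\<bar>(g2 (f t) * f1 t) * f1 t\<bar> \<le> B * K\<^sup>2"
    unfolding abs_mult power2_eq_square mult.assoc using B f K by (intro mult_mono) auto
  moreover have "B * K \<ge> 0" "B * K\<^sup>2 \<ge> 0" using K by auto
  ultimately show ?thesis unfolding jet2_def using B(1)[of "f t"] K
    by (intro exI[of _ "\<lambda>s. g1 (f s) * f1 s"] exI[of _ "(g2 (f t) * f1 t) * f1 t + f2 * g1 (f t)"]) (intro conjI; linarith)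
qed

text \<open>Outside a compact interval the function is locally constant, so its derivatives vanish
  there; inside they are continuous.\<close>

lemma Cinf_on_real_derivatives:
  fixes g :: "real \<Rightarrow> real"
  assumes g: "Cinf_on UNIV g" and c: "\<And>x. x \<notin> {a..b} \<Longrightarrow> (\<exists>v. \<forall>\<^sub>F y in nhds x. g y = v)" and bd: "\<And>x. \<bar>g x\<bar> \<le> C"
  obtains g1 g2 B where "\<And>x. (g has_real_derivative g1 x) (at x)" "\<And>x. (g1 has_real_derivative g2 x) (at x)"
    "\<And>x. \<bar>g x\<bar> \<le> B" "\<And>x. \<bar>g1 x\<bar> \<le> B" "\<And>x. \<bar>g2 x\<bar> \<le> B"
proof -
  define g1 where "g1 x = vector_derivative g (at x)" for x
  define g2 where "g2 x = vector_derivative g1 (at x)" for x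
  have g1C: "Cinf_on UNIV g1" and d1: "\<And>x. (g has_real_derivative g1 x) (at x)"
    using Cinf_on_vector_derivative[OF g] unfolding g1_def has_real_derivative_iff_has_vector_derivative by auto
  have g2C: "Cinf_on UNIV g2" and d2: "\<And>x. (g1 has_real_derivative g2 x) (at x)"
    using Cinf_on_vector_derivative[OF g1C] unfolding g2_def has_real_derivative_iff_has_vector_derivative by auto
  have z: "\<forall>\<^sub>F y in nhds x. g1 y = 0" if x: "x \<notin> {a..b}" for x
  proof -
    obtain v where "\<forall>\<^sub>F y in nhds x. g y = v" using c[OF x] by blast
    then have "\<forall>\<^sub>F y in nhds x. \<forall>\<^sub>F w in nhds y. g w = v" by (simp add: eventually_eventually)
    then show ?thesis
    proof eventually_elim
      case (elim y)
      have "((\<lambda>_. v) has_real_derivative g1 y) (at y)"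
        using d1[of y] DERIV_cong_ev[of y y g "\<lambda>_. v" "g1 y" "g1 y"] elim by simp
      then show ?case using DERIV_unique[OF _ DERIV_const] by blast
    qed
  qed
  have z1: "g1 x = 0" if "x \<notin> {a..b}" for x using z[OF that] eventually_nhds_x_imp_x by blast
  have z2: "g2 x = 0" if x: "x \<notin> {a..b}" for x
  proof -
    have "((\<lambda>_. 0) has_real_derivative g2 x) (at x)"
      using d2[of x] DERIV_cong_ev[of x x g1 "\<lambda>_. 0" "g2 x" "g2 x"] z[OF x] by simp
    then show ?thesis using DERIV_unique[OF _ DERIV_const] by blast
  qed
  have "\<exists>B. \<forall>x\<in>{a..b}. \<bar>h x\<bar> \<le> B" if "Cinf_on UNIV h" for h :: "real \<Rightarrow> real"
  proof -
    have "compact (h ` {a..b})" using continuous_on_subset[OF Cinf_on_continuous[OF that]]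
      by (intro compact_continuous_image) auto
    then show ?thesis using compact_imp_bounded by (force simp: bounded_iff)
  qed
  then obtain B1 B2 where B: "\<And>x. x \<in> {a..b} \<Longrightarrow> \<bar>g1 x\<bar> \<le> B1" "\<And>x. x \<in> {a..b} \<Longrightarrow> \<bar>g2 x\<bar> \<le> B2"
    using g1C g2C by metis
  show thesis
  proof (rule that[OF d1 d2, of "\<bar>C\<bar> + \<bar>B1\<bar> + \<bar>B2\<bar>"])
    fix x
    show "\<bar>g x\<bar> \<le> \<bar>C\<bar> + \<bar>B1\<bar> + \<bar>B2\<bar>" using bd[of x] by linarith
    show "\<bar>g1 x\<bar> \<le> \<bar>C\<bar> + \<bar>B1\<bar> + \<bar>B2\<bar>" using B(1)[of x] z1[of x] by (cases "x \<in> {a..b}") auto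
    show "\<bar>g2 x\<bar> \<le> \<bar>C\<bar> + \<bar>B1\<bar> + \<bar>B2\<bar>" using B(2)[of x] z2[of x] by (cases "x \<in> {a..b}") auto
  qed
qed

lemma tstep_jets:
  obtains B g1 g2 where "\<And>x. (tstep has_real_derivative g1 x) (at x)" "\<And>x. (g1 has_real_derivative g2 x) (at x)"
    "\<And>x. \<bar>tstep x\<bar> \<le> B" "\<And>x. \<bar>g1 x\<bar> \<le> B" "\<And>x. \<bar>g2 x\<bar> \<le> B"
proof (rule Cinf_on_real_derivatives[OF Cinf_on_tstep, of "3/5" "4/5" 1])
  fix x :: real assume x: "x \<notin> {3/5..4/5}"
  show "\<exists>v. \<forall>\<^sub>F y in nhds x. tstep y = v"
  proof (cases "x < 3/5")
    case True
    then have "\<forall>\<^sub>F y in nhds x. y < 3/5" using eventually_nhds_in_open[of "{..<3/5}" x] by simp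
    then show ?thesis by (intro exI[of _ 0]) (auto elim!: eventually_mono simp: tstep_simps)
  next
    case False
    then have "x > 4/5" using x by auto
    then have "\<forall>\<^sub>F y in nhds x. y > 4/5" using eventually_nhds_in_open[of "{4/5<..}" x] by simp
    then show ?thesis by (intro exI[of _ 1]) (auto elim!: eventually_mono simp: tstep_simps)
  qed
qed (use stp_bounds in \<open>auto simp: tstep_def\<close>)

lemma spread_jets:
  obtains B g1 g2 where "\<And>x. (spread has_real_derivative g1 x) (at x)" "\<And>x. (g1 has_real_derivative g2 x) (at x)"
    "\<And>x. \<bar>spread x\<bar> \<le> B" "\<And>x. \<bar>g1 x\<bar> \<le> B" "\<And>x. \<bar>g2 x\<bar> \<le> B"
proof (rule Cinf_on_real_derivatives[OF Cinf_on_spread, of "1/2" "9/10" 2])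
  fix x :: real assume x: "x \<notin> {1/2..9/10}"
  show "\<exists>v. \<forall>\<^sub>F y in nhds x. spread y = v"
  proof (cases "x < 1/2")
    case True
    then have "\<forall>\<^sub>F y in nhds x. y < 1/2" using eventually_nhds_in_open[of "{..<1/2}" x] by simp
    then show ?thesis by (intro exI[of _ 1]) (auto elim!: eventually_mono simp: spread_simps)
  next
    case False
    then have "x > 9/10" using x by auto
    then have "\<forall>\<^sub>F y in nhds x. y > 9/10" using eventually_nhds_in_open[of "{9/10<..}" x] by simp
    then show ?thesis by (intro exI[of _ 1]) (auto elim!: eventually_mono simp: spread_simps)
  qed
next
  show "\<bar>spread x\<bar> \<le> 2" for x
    using stp_bounds[of "11 - 20 * x"] stp_bounds[of "20 * x - 17"] by (simp add: spread_def)
qed (rule that)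

definition jet_bound :: "real \<Rightarrow> (real \<Rightarrow> real) \<Rightarrow> bool" where
  "jet_bound B g \<longleftrightarrow> (\<exists>g1 g2. \<forall>x. (g has_real_derivative g1 x) (at x) \<and> (g1 has_real_derivative g2 x) (at x) \<and>
     \<bar>g x\<bar> \<le> B \<and> \<bar>g1 x\<bar> \<le> B \<and> \<bar>g2 x\<bar> \<le> B)"

lemma jet_bounds_exist: "\<exists>B\<ge>1. jet_bound B tstep \<and> jet_bound B spread"
proof -
  obtain B g1 g2 where g: "\<And>x. (tstep has_real_derivative g1 x) (at x)" "\<And>x. (g1 has_real_derivative g2 x) (at x)"
    "\<And>x. \<bar>tstep x\<bar> \<le> B" "\<And>x. \<bar>g1 x\<bar> \<le> B" "\<And>x. \<bar>g2 x\<bar> \<le> B" by (rule tstep_jets) (rule that)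
  obtain C h1 h2 where h: "\<And>x. (spread has_real_derivative h1 x) (at x)" "\<And>x. (h1 has_real_derivative h2 x) (at x)"
    "\<And>x. \<bar>spread x\<bar> \<le> C" "\<And>x. \<bar>h1 x\<bar> \<le> C" "\<And>x. \<bar>h2 x\<bar> \<le> C" by (rule spread_jets) (rule that)
  define D where "D = max 1 (max B C)"
  have D: "B \<le> D" "C \<le> D" "1 \<le> D" by (auto simp: D_def)
  have "jet_bound D tstep"
    unfolding jet_bound_def using g(1,2) order_trans[OF g(3) D(1)] order_trans[OF g(4) D(1)] order_trans[OF g(5) D(1)]
    by (intro exI[of _ g1] exI[of _ g2]) blast
  moreover have "jet_bound D spread"
    unfolding jet_bound_def using h(1,2) order_trans[OF h(3) D(2)] order_trans[OF h(4) D(2)] order_trans[OF h(5) D(2)]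
    by (intro exI[of _ h1] exI[of _ h2]) blast
  ultimately show ?thesis using D(3) by blast
qed

lemma jet2_compose_bound: "jet2 K f t \<Longrightarrow> jet_bound B g \<Longrightarrow> jet2 (B + B * K + B * K\<^sup>2) (\<lambda>s. g (f s)) t"
  unfolding jet_bound_def by (metis jet2_compose)

text \<open>The second derivative of an oscillation of amplitude d and frequency M is of order d
  M^2. So d may be as large as M^-2 without spoiling the bound.\<close>

lemma jet2_wave:
  assumes f: "\<And>s. (f has_real_derivative f1 s) (at s)" "(f1 has_real_derivative f2) (at t)"
    and M: "\<bar>f1 t\<bar> \<le> M" "\<bar>f2\<bar> \<le> M" "1 \<le> M" and d: "0 \<le> d" "d * M\<^sup>2 \<le> C"
  shows "jet2 (2 * C) (\<lambda>s. d * sin (f s + b)) t"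
proof -
  have M2: "1 \<le> M\<^sup>2" "M \<le> M\<^sup>2" using M(3) self_le_power[of M 2] by (auto simp: one_le_power)
  have dC: "d * 1 \<le> C" "d * M \<le> C" "0 \<le> C"
    using mult_left_mono[OF M2(1) d(1)] mult_left_mono[OF M2(2) d(1)] d M(3) by (auto intro: order_trans)
  have b: "\<bar>d * (u * v)\<bar> \<le> d * L" if "\<bar>u\<bar> \<le> 1" "\<bar>v\<bar> \<le> L" for u v L
  proof -
    have "\<bar>u * v\<bar> \<le> 1 * L" unfolding abs_mult using that by (intro mult_mono) auto
    then show ?thesis using d(1) by (simp add: abs_mult mult_left_mono)
  qed
  have "(f1 t)\<^sup>2 \<le> M\<^sup>2" using M(1,3) by (metis abs_le_square_iff abs_of_nonneg le_numeral_extra(1) order_trans zero_le_one)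
  then have f12: "\<bar>(f1 t)\<^sup>2\<bar> \<le> M\<^sup>2" by simp
  have "((\<lambda>s. d * sin (f s + b)) has_real_derivative d * (cos (f s + b) * f1 s)) (at s)" for s
    by (auto intro!: derivative_eq_intros f)
  moreover have "((\<lambda>s. d * (cos (f s + b) * f1 s)) has_real_derivative d * (- sin (f t + b) * (f1 t)\<^sup>2) + d * (cos (f t + b) * f2)) (at t)"
    by (auto intro!: derivative_eq_intros f simp: power2_eq_square algebra_simps)
  moreover have "\<bar>d * (sin (f t + b) * 1)\<bar> \<le> d * 1" by (rule b) auto
  moreover have "\<bar>d * (cos (f t + b) * f1 t)\<bar> \<le> d * M" by (rule b) (auto simp: M)
  moreover have "\<bar>d * (cos (f t + b) * f2)\<bar> \<le> d * M" by (rule b) (auto simp: M)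
  moreover have "\<bar>d * (- sin (f t + b) * (f1 t)\<^sup>2)\<bar> \<le> d * M\<^sup>2" by (rule b[OF _ f12]) auto
  ultimately show ?thesis
    unfolding jet2_def using dC d(2)
    by (intro exI[of _ "\<lambda>s. d * (cos (f s + b) * f1 s)"] exI[of _ "d * (- sin (f t + b) * (f1 t)\<^sup>2) + d * (cos (f t + b) * f2)"])
       (intro conjI always_eventually allI; simp)
qed

lemma vector_derivative_component:
  fixes c :: "real \<Rightarrow> real^'n"
  assumes "(c has_vector_derivative v) (at t)"
  shows "((\<lambda>s. c s $ i) has_real_derivative v $ i) (at t)"
  using bounded_linear.has_vector_derivative[OF bounded_linear_vec_nth assms]
  by (simp add: has_real_derivative_iff_has_vector_derivative)

lemma jet2_vector_bounds:
  fixes c :: "real \<Rightarrow> real^3"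
  assumes c: "Cinf_on UNIV c" and j: "\<And>i. jet2 K (\<lambda>s. c s $ i) t"
  shows "norm (vector_derivative c (at t)) \<le> 3 * K"
    "norm (vector_derivative (\<lambda>s. vector_derivative c (at s)) (at t)) \<le> 3 * K"
proof -
  define c1 where "c1 t = vector_derivative c (at t)" for t
  define c2 where "c2 t = vector_derivative c1 (at t)" for t
  have c1C: "Cinf_on UNIV c1" and d1: "\<And>t. (c has_vector_derivative c1 t) (at t)"
    using Cinf_on_vector_derivative[OF c] unfolding c1_def by auto
  have d2: "\<And>t. (c1 has_vector_derivative c2 t) (at t)"
    using Cinf_on_vector_derivative[OF c1C] unfolding c2_def by auto
  have "\<bar>c1 t $ i\<bar> \<le> K \<and> \<bar>c2 t $ i\<bar> \<le> K" for i
  proof -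
    obtain f1 f2 where f: "\<forall>\<^sub>F s in nhds t. ((\<lambda>s. c s $ i) has_real_derivative f1 s) (at s)" "(f1 has_real_derivative f2) (at t)"
      "\<bar>f1 t\<bar> \<le> K" "\<bar>f2\<bar> \<le> K" using j[of i] by (auto simp: jet2_def)
    have ev: "\<forall>\<^sub>F s in nhds t. f1 s = c1 s $ i"
      using f(1) by eventually_elim (rule DERIV_unique[OF _ vector_derivative_component[OF d1]])
    then have e1: "f1 t = c1 t $ i" by (rule eventually_nhds_x_imp_x)
    have "((\<lambda>s. c1 s $ i) has_real_derivative f2) (at t)"
      using f(2) DERIV_cong_ev[OF refl ev refl] by simp
    then have "f2 = c2 t $ i" by (rule DERIV_unique[OF _ vector_derivative_component[OF d2]])
    then show ?thesis using f e1 by simp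
  qed
  note b = this
  have "norm v \<le> 3 * K" if "\<And>i. \<bar>v $ i\<bar> \<le> K" for v :: "real^3"
    using norm_le_l1_cart[of v] that[of 1] that[of 2] that[of 3] by (simp add: sum_3)
  then show "norm (vector_derivative c (at t)) \<le> 3 * K"
    "norm (vector_derivative (\<lambda>s. vector_derivative c (at s)) (at t)) \<le> 3 * K"
    using b unfolding c1_def[symmetric] c2_def[symmetric] by blast+
qed

text \<open>The steps of the estimate in \<open>curve_jets\<close>, free of n and d; 16641 is 129
  squared.\<close>

definition curve_jet_constant :: "real \<Rightarrow> real" where
  "curve_jet_constant B = (let C = 16641 * B\<^sup>2; KD = 1 + 2 * C; KI = 8 * KD + 16 * KD\<^sup>2 + 2;
     Kx = 4 * 8 * KI; KS = B + B * Kx + B * Kx\<^sup>2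
     in Kx + 4 * (4 * (1 + KS) * 2) * KI + 4 * (2 * C) * KI)"

context twist
begin

text \<open>Parametrisation by t = arg ww: then z1 turns twice as fast, and 3 pi/4 is pi minus the
  phase pi/4 of \<open>FF\<close>.\<close>

definition "cX t = rad * cos (2 * t + 3 * pi/4)"
definition "cY t = rad * sin (2 * t + 3 * pi/4)"
definition "cth t = t + psi (cX t)"
definition "cD t = 1 - d * cos (cth t)"
definition "curve t = (vector [cX t / cD t, cY t / cD t, sc (cX t / cD t) * (d * sin (cth t) / cD t)] :: real^3)"

lemma curve_PP: "curve t = PP (of_real rad * cis (2 * t + 3 * pi/4)) (of_real d * cis (cth t))"
  by (simp add: curve_def PP_def Let_def cX_def cY_def cD_def)

lemma cD_bounds: "99/100 \<le> cD t" "cD t \<le> 101/100"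
proof -
  have "\<bar>d * cos (cth t)\<bar> \<le> 1/100 * 1" unfolding abs_mult using d0 d1 by (intro mult_mono) auto
  then show "99/100 \<le> cD t" "cD t \<le> 101/100" by (auto simp: cD_def)
qed

lemma curve_z: "z1 (curve t) = of_real rad * cis (2 * t + 3 * pi/4)" "z2 (curve t) = of_real d * cis (cth t)"
proof -
  have "(cmod (of_real rad * cis (2 * t + 3 * pi/4)))\<^sup>2 + (cmod (of_real d * cis (cth t)))\<^sup>2 = 1"
    using rad by (simp add: norm_mult power_mult_distrib)
  moreover have "Re (of_real d * cis (cth t)) < 1" using cD_bounds[of t] by (simp add: cD_def)
  ultimately show "z1 (curve t) = of_real rad * cis (2 * t + 3 * pi/4)" "z2 (curve t) = of_real d * cis (cth t)"
    unfolding curve_PP using z_PP by blast+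
qed

lemma curve_ww: "ww (curve t) = of_real d * cis t"
proof -
  have "Re (z1 (curve t)) = cX t" by (simp add: curve_z cX_def)
  then show ?thesis by (simp add: ww_def curve_z(2) cth_def mult.assoc cis_mult)
qed

lemma curve_FF: "FF (curve t) = 0"
proof -
  have "kap * rad = d\<^sup>2" using rad by (simp add: kap_def)
  then have kr: "complex_of_real kap * of_real rad = of_real (d\<^sup>2)" by (simp only: flip: of_real_mult)
  have "of_real kap * cis (pi/4) * z1 (curve t) = (of_real kap * of_real rad) * (cis (pi/4) * cis (2 * t + 3 * pi/4))"
    unfolding curve_z by (simp only: mult_ac)
  also have "\<dots> = of_real (d\<^sup>2) * (cis (pi/4) * cis (2 * t + 3 * pi/4))" unfolding kr ..
  also have "cis (pi/4) * cis (2 * t + 3 * pi/4) = - cis (2 * t)"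
  proof -
    have "pi/4 + (2 * t + 3 * pi/4) = 2 * t + pi" by simp
    then show ?thesis unfolding cis_mult by (simp add: complex_eq_iff)
  qed
  finally have "of_real kap * cis (pi/4) * z1 (curve t) = - (of_real (d\<^sup>2) * cis (2 * t))" by simp
  moreover have "(ww (curve t))\<^sup>2 = of_real (d\<^sup>2) * cis (2 * t)"
    unfolding curve_ww by (simp add: power_mult_distrib power2_eq_square cis_mult)
  ultimately show ?thesis by (simp add: FF_def)
qed

lemma curve_inj: "inj_on curve {0..<2 * pi}"
proof (rule inj_onI)
  fix s t assume st: "s \<in> {0..<2 * pi}" "t \<in> {0..<2 * pi}" "curve s = curve t"
  then have "cis s = cis t" using curve_ww[of s] curve_ww[of t] d0 by simp
  then have "sin s = sin t \<and> cos s = cos t" by (simp add: complex_eq_iff)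
  then obtain m :: int where m: "s = t + 2 * pi * m" using sin_cos_eq_iff[of s t] by auto
  have "\<bar>s - t\<bar> < 2 * pi" using st by auto
  then have "2 * pi * \<bar>real_of_int m\<bar> < 2 * pi * 1" using m by (simp add: abs_mult)
  then have "\<bar>real_of_int m\<bar> < 1" using mult_less_cancel_left_pos[of "2 * pi"] by simp
  then have "m = 0" by linarith
  then show "s = t" using m by simp
qed

text \<open>A zero of \<open>FF\<close> has |ww| = d, so the argument of \<open>ww\<close> is a
  parameter value. It determines \<open>z1\<close> through \<open>FF\<close> = 0 and then
  \<open>z2\<close>.\<close>

lemma curve_range: "range curve = {p. FF p = 0}"
proof (intro equalityI subsetI)
  fix p assume "p \<in> {p. FF p = 0}"
  then have F: "FF p = 0" by simp
  define t where "t = Arg (ww p)"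
  have w: "ww p = of_real d * cis t"
    using FF_zero(1)[OF F] rcis_cmod_Arg[of "ww p"] by (simp add: t_def rcis_def)
  have e: "of_real kap * cis (pi/4) * z1 p = - (ww p)\<^sup>2" using F by (simp add: FF_def add_eq_0_iff)
  have e': "of_real kap * cis (pi/4) * z1 (curve t) = - (ww p)\<^sup>2"
    using curve_FF[of t] w by (simp add: FF_def curve_ww add_eq_0_iff)
  have z: "z1 p = z1 (curve t)" using e e' kc_nz by (metis mult_left_cancel)
  then have "z2 p = z2 (curve t)" unfolding z2_ww by (simp add: w curve_ww)
  then have "p = curve t" using z PP_inverse by metis
  then show "p \<in> range curve" by simp
qed (auto simp: curve_FF)

lemma curve_period: "curve (t + 2 * pi) = curve t"
proof -
  have "2 * (t + 2 * pi) + 3 * pi/4 = (2 * t + 3 * pi/4) + 2 * pi + 2 * pi" by simp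
  then have c: "cX (t + 2 * pi) = cX t" "cY (t + 2 * pi) = cY t" by (simp_all only: cX_def cY_def sin_periodic cos_periodic)
  then have th: "cth (t + 2 * pi) = cth t + 2 * pi" by (simp add: cth_def)
  then have "cD (t + 2 * pi) = cD t" by (simp add: cD_def)
  then show ?thesis unfolding curve_def c th by simp
qed

lemma Cinf_on_curve: "Cinf_on UNIV curve"
proof -
  have X: "Cinf_on UNIV cX" "Cinf_on UNIV cY" unfolding cX_def cY_def by (intro Cinf_intros; simp)+
  have th: "Cinf_on UNIV cth" unfolding cth_def by (intro Cinf_intros Cinf_on_compose[OF Cinf_on_psi] X) auto
  have D: "Cinf_on UNIV cD" unfolding cD_def by (intro Cinf_intros th) auto
  have Dn: "cD t \<noteq> 0" for t using cD_bounds[of t] by auto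
  have "Cinf_on UNIV (\<lambda>t. curve t $ 1)" "Cinf_on UNIV (\<lambda>t. curve t $ 2)" "Cinf_on UNIV (\<lambda>t. curve t $ 3)"
    unfolding curve_def vector_3 by (intro Cinf_intros Cinf_on_compose[OF Cinf_on_sc] X th D Dn; simp)+
  then show ?thesis by (intro Cinf_on_vec) (use exhaust_3 in \<open>metis open_UNIV\<close>)+
qed

text \<open>The first two coordinates suffice: in polar form their angular part alone contributes 2
  rad/cD, which exceeds 1.\<close>

lemma curve_speed: "1 \<le> norm (vector_derivative curve (at t))"
proof -
  define c1 where "c1 = vector_derivative curve (at t)"
  have dc: "(curve has_vector_derivative c1) (at t)"
    using Cinf_on_vector_derivative[OF Cinf_on_curve] unfolding c1_def by auto
  have "Cinf_on UNIV (\<lambda>t. inverse (cD t))"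
  proof -
    have X: "Cinf_on UNIV cX" unfolding cX_def by (intro Cinf_intros; simp)
    have th: "Cinf_on UNIV cth" unfolding cth_def by (intro Cinf_intros Cinf_on_compose[OF Cinf_on_psi] X) auto
    have D: "Cinf_on UNIV cD" unfolding cD_def by (intro Cinf_intros th) auto
    have Dn: "cD t \<noteq> 0" for t using cD_bounds[of t] by auto
    show ?thesis using Cinf_on_divide[OF open_UNIV Cinf_on_const[OF open_UNIV, of 1] D Dn] by (simp add: inverse_eq_divide)
  qed
  then obtain G where G: "((\<lambda>t. inverse (cD t)) has_real_derivative G) (at t)"
    using Cinf_on_vector_derivative(2) unfolding has_real_derivative_iff_has_vector_derivative by blast
  define u where "u = inverse (cD t)"
  have dX: "(cX has_real_derivative - 2 * cY t) (at t)" "(cY has_real_derivative 2 * cX t) (at t)"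
    unfolding cX_def cY_def by (auto intro!: derivative_eq_intros)
  have "((\<lambda>t. curve t $ 1) has_real_derivative - 2 * cY t * u + G * cX t) (at t)"
    "((\<lambda>t. curve t $ 2) has_real_derivative 2 * cX t * u + G * cY t) (at t)"
    unfolding curve_def vector_3 divide_inverse u_def by (rule DERIV_mult dX G)+
  then have c1: "c1 $ 1 = - 2 * cY t * u + G * cX t" "c1 $ 2 = 2 * cX t * u + G * cY t"
    using vector_derivative_component[OF dc] DERIV_unique by blast+
  have "(c1 $ 1)\<^sup>2 + (c1 $ 2)\<^sup>2 = ((cX t)\<^sup>2 + (cY t)\<^sup>2) * (4 * u\<^sup>2 + G\<^sup>2)"
    unfolding c1 by (simp add: power2_eq_square algebra_simps)
  also have "(cX t)\<^sup>2 + (cY t)\<^sup>2 = rad\<^sup>2"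
    by (simp add: cX_def cY_def power_mult_distrib flip: distrib_left)
  finally have e: "(c1 $ 1)\<^sup>2 + (c1 $ 2)\<^sup>2 = rad\<^sup>2 * (4 * u\<^sup>2 + G\<^sup>2)" .
  have "9/10 \<le> u" using cD_bounds[of t] by (simp add: u_def field_simps)
  then have "(9/10)\<^sup>2 \<le> u\<^sup>2" by (intro power_mono) auto
  then have "81/100 \<le> u\<^sup>2" by (simp add: power_divide)
  then have "2 \<le> 4 * u\<^sup>2 + G\<^sup>2" using zero_le_power2[of G] by linarith
  moreover have "1/2 \<le> rad\<^sup>2" using rad dsq by simp
  ultimately have "1/2 * 2 \<le> rad\<^sup>2 * (4 * u\<^sup>2 + G\<^sup>2)" by (intro mult_mono) auto
  then have "1 \<le> (c1 $ 1)\<^sup>2 + (c1 $ 2)\<^sup>2" using e by simp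
  also have "\<dots> \<le> (norm c1)\<^sup>2" unfolding power2_norm_eq_inner by (simp add: inner_vec_def sum_3 power2_eq_square)
  finally have "1\<^sup>2 \<le> (norm c1)\<^sup>2" by simp
  then show ?thesis unfolding c1_def by (rule power2_le_imp_le) simp
qed

text \<open>The angle \<open>cth\<close> has derivatives of order n, harmless because its sine has
  amplitude d and d n^2 is at most 1. The height also carries the factor of order 1/d, but this acts
  only where there is no twist.\<close>

lemma curve_jets:
  assumes B: "B \<ge> 1" "jet_bound B tstep" "jet_bound B spread" and dn: "d * (real n)\<^sup>2 \<le> 1"
  shows "jet2 (curve_jet_constant B) (\<lambda>s. curve s $ i) t"
proof -
  define C where "C = 16641 * B\<^sup>2"
  define KD where "KD = 1 + 2 * C"
  define KI where "KI = 8 * KD + 16 * KD\<^sup>2 + 2"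
  define Kx where "Kx = 4 * 8 * KI"
  define KS where "KS = B + B * Kx + B * Kx\<^sup>2"
  have K: "curve_jet_constant B = Kx + 4 * (4 * (1 + KS) * 2) * KI + 4 * (2 * C) * KI"
    unfolding curve_jet_constant_def Let_def C_def KD_def KI_def Kx_def KS_def ..
  have pos: "0 \<le> C" "0 \<le> KD" "0 \<le> KI" "0 \<le> Kx" "0 \<le> KS"
    using B by (auto simp: C_def KD_def KI_def Kx_def KS_def)
  obtain g1 g2 where g: "\<And>x. (tstep has_real_derivative g1 x) (at x)" "\<And>x. (g1 has_real_derivative g2 x) (at x)"
     "\<And>x. \<bar>g1 x\<bar> \<le> B" "\<And>x. \<bar>g2 x\<bar> \<le> B" using B(2) unfolding jet_bound_def by metis
  have lin: "((\<lambda>s. 2 * s) has_real_derivative 2) (at s)" for s :: real by (auto intro!: derivative_eq_intros)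
  have jX: "jet2 8 cX t" "jet2 8 cY t"
  proof -
    have "jet2 (2 * 4) (\<lambda>s. rad * sin (2 * s + b)) t" for b
      by (rule jet2_wave[OF lin DERIV_const, of 2]) (use rad in auto)
    moreover have "cos (2 * s + 3 * pi/4) = sin (2 * s + (3 * pi/4 + pi/2))" for s
      using sin_add[of "2 * s + 3 * pi/4" "pi/2"] by (simp add: add.assoc)
    ultimately show "jet2 8 cX t" "jet2 8 cY t" unfolding cX_def cY_def by simp_all
  qed
  have dX: "(cX has_real_derivative - 2 * cY s) (at s)" "(cY has_real_derivative 2 * cX s) (at s)" for s
    unfolding cX_def cY_def by (auto intro!: derivative_eq_intros)
  have bX: "\<bar>cX t\<bar> \<le> 1" "\<bar>cY t\<bar> \<le> 1"
    using rad mult_mono[of "\<bar>rad\<bar>" 1 "\<bar>cos (2 * t + 3 * pi/4)\<bar>" 1] mult_mono[of "\<bar>rad\<bar>" 1 "\<bar>sin (2 * t + 3 * pi/4)\<bar>" 1]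
    by (auto simp: cX_def cY_def abs_mult)
  define q where "q = 4 * pi * real n"
  have q: "0 \<le> q" "q \<le> 16 * real n" using mult_right_mono[OF less_imp_le[OF pi_less_4], of "real n"] by (auto simp: q_def)
  have dth: "(cth has_real_derivative 1 + q * (g1 (cX s) * (- 2 * cY s))) (at s)" for s
    unfolding cth_def psi_def q_def
    by (auto intro!: derivative_eq_intros DERIV_chain2[OF g(1)] dX)
  have dth2: "((\<lambda>s. 1 + q * (g1 (cX s) * (- 2 * cY s))) has_real_derivative
     q * (g2 (cX t) * (- 2 * cY t) * (- 2 * cY t) + (- 2 * (2 * cX t)) * g1 (cX t))) (at t)"
    by (auto intro!: derivative_eq_intros DERIV_chain2[OF g(2)] dX simp: algebra_simps)
  \<comment> \<open>Bounds both derivatives of \<open>cth\<close>: the twist contributes at most 16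
    n times 8 B, with 4 pi below 16, and the derivative of t adds 1.\<close>
  define M where "M = 129 * (real n * B)"
  have nB: "1 \<le> real n * B" using n1 B(1) mult_mono[of 1 "real n" 1 B] by simp
  have ub: "\<bar>q * u\<bar> \<le> 128 * (real n * B)" if "\<bar>u\<bar> \<le> 8 * B" for u
  proof -
    have "\<bar>q * u\<bar> \<le> (16 * real n) * (8 * B)" unfolding abs_mult using q that by (intro mult_mono) auto
    then show ?thesis by simp
  qed
  have p1: "\<bar>g1 (cX t) * cY t\<bar> \<le> B * 1" "\<bar>g1 (cX t) * cX t\<bar> \<le> B * 1" "\<bar>g2 (cX t) * (cY t * cY t)\<bar> \<le> B * (1 * 1)"
    unfolding abs_mult using g(3,4) bX B(1) by (intro mult_mono; simp add: mult_le_one)+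
  have M1: "\<bar>1 + q * (g1 (cX t) * (- 2 * cY t))\<bar> \<le> M"
  proof -
    have "g1 (cX t) * (- 2 * cY t) = - 2 * (g1 (cX t) * cY t)" by simp
    then have "\<bar>g1 (cX t) * (- 2 * cY t)\<bar> \<le> 8 * B" using p1(1) B(1) by linarith
    from ub[OF this] show ?thesis using nB unfolding M_def by linarith
  qed
  have M2: "\<bar>q * (g2 (cX t) * (- 2 * cY t) * (- 2 * cY t) + (- 2 * (2 * cX t)) * g1 (cX t))\<bar> \<le> M"
  proof -
    have "g2 (cX t) * (- 2 * cY t) * (- 2 * cY t) + (- 2 * (2 * cX t)) * g1 (cX t)
      = 4 * (g2 (cX t) * (cY t * cY t)) - 4 * (g1 (cX t) * cX t)" by (simp add: algebra_simps)
    then have "\<bar>g2 (cX t) * (- 2 * cY t) * (- 2 * cY t) + (- 2 * (2 * cX t)) * g1 (cX t)\<bar> \<le> 8 * B"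
      using p1(2,3) by linarith
    from ub[OF this] show ?thesis using nB unfolding M_def by linarith
  qed
  have dM: "d * M\<^sup>2 \<le> C"
  proof -
    have "d * M\<^sup>2 = (16641 * B\<^sup>2) * (d * (real n)\<^sup>2)" by (simp add: M_def power_mult_distrib)
    also have "\<dots> \<le> (16641 * B\<^sup>2) * 1" using dn by (intro mult_left_mono) auto
    finally show ?thesis by (simp add: C_def)
  qed
  have wave: "jet2 (2 * C) (\<lambda>s. d * sin (cth s + b)) t" for b
    by (rule jet2_wave[OF dth dth2 M1 M2]) (use nB d0 dM in \<open>auto simp: M_def\<close>)
  have jD: "jet2 KD cD t"
  proof -
    have "jet2 (1 + 2 * C) (\<lambda>s. 1 + d * sin (cth s + - (pi/2))) t" by (intro jet2_add jet2_const wave) simp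
    then show ?thesis unfolding KD_def cD_def by (simp add: sin_diff)
  qed
  have jI: "jet2 KI (\<lambda>s. inverse (cD s)) t"
    unfolding KI_def using cD_bounds[of t] by (intro jet2_inverse jD) auto
  have jx: "jet2 Kx (\<lambda>s. cX s / cD s) t" "jet2 Kx (\<lambda>s. cY s / cD s) t"
    unfolding Kx_def divide_inverse by (intro jet2_mult jX jI)+
  have cD: "isCont cX t" "isCont cD t"
    using Cinf_on_continuous[OF Cinf_on_curve] dX(1) DERIV_isCont jD unfolding jet2_def
    by (metis eventually_nhds_x_imp_x)+
  define x where "x = cX t / cD t"
  have evx: "\<forall>\<^sub>F s in nhds t. cX s / cD s \<in> U" if "open U" "x \<in> U" for U
  proof -
    have "isCont (\<lambda>s. cX s / cD s) t" using cD cD_bounds[of t] by (intro continuous_intros) auto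
    then show ?thesis using that unfolding x_def continuous_at_open eventually_nhds by blast
  qed
  have evX: "\<forall>\<^sub>F s in nhds t. cX s \<in> U" if "open U" "cX t \<in> U" for U
    using cD(1) that unfolding continuous_at_open eventually_nhds by blast
  \<comment> \<open>Inside the twist the vertical factor is locally 1 and the wave estimate applies.
    Outside, the sine is locally that of t, and d cancels against 1/d in the factor.\<close>
  have jz: "jet2 (4 * (4 * (1 + KS) * 2) * KI + 4 * (2 * C) * KI) (\<lambda>s. sc (cX s / cD s) * (d * sin (cth s) / cD s)) t"
  proof (cases "3/5 \<le> cX t \<and> cX t \<le> 4/5")
    case True
    have "11/20 * cD t < cX t" "cX t < 17/20 * cD t" using True cD_bounds[of t] by linarith+
    then have "x \<in> {11/20<..<17/20}" using cD_bounds[of t] by (simp add: x_def field_simps)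
    then have "\<forall>\<^sub>F s in nhds t. cX s / cD s \<in> {11/20<..<17/20}" by (intro evx) auto
    then have ev: "\<forall>\<^sub>F s in nhds t. d * sin (cth s + 0) * inverse (cD s) = sc (cX s / cD s) * (d * sin (cth s) / cD s)"
      by eventually_elim (simp add: sc_def spread_simps field_simps)
    have "jet2 (4 * (2 * C) * KI) (\<lambda>s. d * sin (cth s + 0) * inverse (cD s)) t" by (intro jet2_mult wave jI)
    from jet2_mono[OF jet2_cong[OF ev this]] show ?thesis using pos by simp
  next
    case False
    have evc: "\<forall>\<^sub>F s in nhds t. sin (cth s) = sin s"
    proof (cases "cX t < 3/5")
      case True
      then have "\<forall>\<^sub>F s in nhds t. cX s \<in> {..<3/5}" by (intro evX) auto
      then show ?thesis by eventually_elim (simp add: cth_def psi_def tstep_simps)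
    next
      case False
      then have "\<forall>\<^sub>F s in nhds t. cX s \<in> {4/5<..}" using \<open>\<not> (3/5 \<le> cX t \<and> cX t \<le> 4/5)\<close> by (intro evX) auto
      then show ?thesis
      proof eventually_elim
        case (elim s)
        then have "cth s = s + 2 * pi * of_int (2 * int n)" by (simp add: cth_def psi_def tstep_simps)
        then show ?case using sin_cos_eq_iff by blast
      qed
    qed
    have ev: "\<forall>\<^sub>F s in nhds t. (d + spread (cX s / cD s)) * (1 * sin (s + 0)) * inverse (cD s) = sc (cX s / cD s) * (d * sin (cth s) / cD s)"
      using evc
    proof eventually_elim
      case (elim s)
      have "sc (cX s / cD s) * d = d + spread (cX s / cD s)" using d0 by (simp add: sc_def distrib_right)
      then have "(d + spread (cX s / cD s)) * (1 * sin (s + 0)) * inverse (cD s) = (sc (cX s / cD s) * d) * sin (cth s) * inverse (cD s)"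
        using elim by simp
      then show ?case by (simp add: divide_inverse mult.assoc)
    qed
    have js: "jet2 2 (\<lambda>s. 1 * sin (s + 0)) t"
      using jet2_wave[OF DERIV_ident DERIV_const, of 1 1 1 0 t] by simp
    have "jet2 (4 * (4 * (1 + KS) * 2) * KI) (\<lambda>s. (d + spread (cX s / cD s)) * (1 * sin (s + 0)) * inverse (cD s)) t"
      unfolding KS_def using d0 d1
      by (intro jet2_mult jet2_add jet2_const js jI jet2_compose_bound[OF _ B(3)] jx) auto
    from jet2_mono[OF jet2_cong[OF ev this]] show ?thesis using pos by simp
  qed
  have p: "0 \<le> 4 * (4 * (1 + KS) * 2) * KI" "0 \<le> 4 * (2 * C) * KI" using pos by auto
  have "jet2 (curve_jet_constant B) (\<lambda>s. curve s $ 1) t" "jet2 (curve_jet_constant B) (\<lambda>s. curve s $ 2) t"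
    "jet2 (curve_jet_constant B) (\<lambda>s. curve s $ 3) t"
    unfolding curve_def vector_3 K using p pos
    by (intro jet2_mono[OF jx(1)] jet2_mono[OF jx(2)] jet2_mono[OF jz]; linarith)+
  then show ?thesis using exhaust_3[of i] by metis
qed

end

section \<open>An explicit spanning disk\<close>

lemma left_inverse_inj_derivative:
  assumes f: "f differentiable (at x)" and h: "h differentiable (at (f x))"
    and U: "open U" "x \<in> U" and hf: "\<And>y. y \<in> U \<Longrightarrow> h (f y) = y"
  shows "inj (frechet_derivative f (at x))"
proof -
  let ?f = "frechet_derivative f (at x)" and ?h = "frechet_derivative h (at (f x))"
  have "((\<lambda>y. h (f y)) has_derivative (\<lambda>v. ?h (?f v))) (at x)"
    using diff_chain_at[OF f[unfolded frechet_derivative_works] h[unfolded frechet_derivative_works]] by (simp add: o_def)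
  then have "((\<lambda>y. y) has_derivative (\<lambda>v. ?h (?f v))) (at x)"
    by (rule has_derivative_transform_within_open[OF _ U]) (simp add: hf)
  then have "(\<lambda>v. ?h (?f v)) = (\<lambda>v. v)" by (rule has_derivative_unique[OF _ has_derivative_ident])
  then show ?thesis by (metis injI)
qed

lemma Cinf_on_scaled_vec2:
  fixes f g :: "'a::real_normed_vector \<Rightarrow> real"
  assumes "open U" "Cinf_on U f" "Cinf_on U g"
  shows "Cinf_on U (\<lambda>x. vector [f x, g x] :: real^2)"
proof (rule Cinf_on_vec[OF assms(1)])
  fix i :: 2
  show "Cinf_on U (\<lambda>x. (vector [f x, g x] :: real^2) $ i)"
    using exhaust_2[of i] assms by (auto simp: vector_2)
qed

definition square_triangle :: "real \<Rightarrow> real \<Rightarrow> (real^2) set" where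
  "square_triangle a b = {p. 0 \<le> a * p $ 1 \<and> 0 \<le> b * p $ 2 \<and> a * p $ 1 + b * p $ 2 \<le> 1}"

definition square_triangles :: "(real^2) set set" where
  "square_triangles = (\<lambda>(a, b). square_triangle a b) ` ({1, -1} \<times> {1, -1})"

definition diamond :: "(real^2) set" where
  "diamond = {p. \<bar>p $ 1\<bar> + \<bar>p $ 2\<bar> \<le> 1}"

lemma square_triangle_hull:
  assumes "a \<in> {1, -1}" "b \<in> {1, -1}"
  shows "square_triangle a b = convex hull {0, vector [a, 0], vector [0, b]}"
proof -
  have ab: "a * a = 1" "b * b = 1" using assms by auto
  show ?thesis
  proof (intro equalityI subsetI)
    fix p assume p: "p \<in> square_triangle a b"
    have "a * p $ 1 * a = p $ 1" "b * p $ 2 * b = p $ 2" using ab by (metis mult.assoc mult.commute mult_1)+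
    then have "p = 0 + (a * p $ 1) *\<^sub>R (vector [a, 0] - 0) + (b * p $ 2) *\<^sub>R (vector [0, b] - 0)"
      by (simp add: vec_eq_iff forall_2 vector_2)
    then show "p \<in> convex hull {0, vector [a, 0], vector [0, b]}"
      using p unfolding convex_hull_3_alt square_triangle_def by blast
  next
    fix p :: "real^2" assume "p \<in> convex hull {0, vector [a, 0], vector [0, b]}"
    then obtain u v where uv: "p = 0 + u *\<^sub>R (vector [a, 0] - 0) + v *\<^sub>R (vector [0, b] - 0)" "0 \<le> u" "0 \<le> v" "u + v \<le> 1"
      unfolding convex_hull_3_alt by blast
    have "p $ 1 = u * a" "p $ 2 = v * b" using uv(1) by (simp_all add: vector_2)
    then have "a * p $ 1 = u" "b * p $ 2 = v" using ab by (simp_all add: mult.left_commute)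
    then show "p \<in> square_triangle a b" using uv(2-4) by (simp add: square_triangle_def)
  qed
qed

lemma square_triangle_simplex:
  assumes "a \<in> {1, -1}" "b \<in> {1, -1}"
  shows "2 simplex square_triangle a b"
proof -
  let ?v = "vector [a, 0] :: real^2" and ?w = "vector [0, b] :: real^2"
  have c: "?v $ 1 = a" "?v $ 2 = 0" "?w $ 1 = 0" "?w $ 2 = b" by (simp_all add: vector_2)
  have "a \<noteq> 0" "b \<noteq> 0" using assms by auto
  then have ne: "?v \<noteq> 0" "?w \<noteq> 0" "?v \<noteq> ?w" using c by (metis zero_index)+
  have ind: "independent {?v, ?w}"
  proof (rule pairwise_orthogonal_independent)
    show "pairwise orthogonal {?v, ?w}"
      by (auto simp: pairwise_def orthogonal_def inner_vec_def sum_2 c)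
  qed (use ne in auto)
  have n0: "0 \<notin> {?v, ?w}" using ne by auto
  have "\<not> affine_dependent (insert 0 {?v, ?w})"
    unfolding affine_dependent_iff_dependent[OF n0] using ind by simp
  moreover have "card {0, ?v, ?w} = 3" using ne by auto
  ultimately show ?thesis unfolding simplex_def square_triangle_hull[OF assms]
    by (intro exI[of _ "{0, ?v, ?w}"]) auto
qed

text \<open>The linear functional with coefficients a - a', b - b' is nonnegative on the first
  triangle and vanishes exactly on the intersection.\<close>

lemma square_triangles_Int:
  assumes "a \<in> {1, -1}" "b \<in> {1, -1}" "a' \<in> {1, -1}" "b' \<in> {1, -1}"
  shows "(square_triangle a b \<inter> square_triangle a' b') face_of square_triangle a b"
proof -
  let ?w = "vector [a - a', b - b'] :: real^2"
  have w: "?w \<bullet> p = (a - a') * p $ 1 + (b - b') * p $ 2" for p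
    by (simp add: inner_vec_def sum_2 vector_2)
  have cv: "convex (square_triangle a b)" using square_triangle_hull[OF assms(1,2)] by (metis convex_convex_hull)
  have "(square_triangle a b \<inter> {p. ?w \<bullet> p = 0}) face_of square_triangle a b"
    by (rule face_of_Int_supporting_hyperplane_ge[OF cv])
       (use assms in \<open>auto simp: w square_triangle_def\<close>)
  moreover have "square_triangle a b \<inter> {p. ?w \<bullet> p = 0} = square_triangle a b \<inter> square_triangle a' b'"
    using assms by (auto simp: w square_triangle_def)
  ultimately show ?thesis by simp
qed

lemma square_triangulation: "triangulation square_triangles" "\<forall>T\<in>square_triangles. 2 simplex T"
proof -
  have e: "\<exists>a\<in>{1,-1}. \<exists>b\<in>{1,-1}. T = square_triangle a b" if "T \<in> square_triangles" for T
    using that unfolding square_triangles_def by blast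
  then show s: "\<forall>T\<in>square_triangles. 2 simplex T" using square_triangle_simplex by metis
  have "(T \<inter> T') face_of T" if "T \<in> square_triangles" "T' \<in> square_triangles" for T T'
    using e[OF that(1)] e[OF that(2)] square_triangles_Int by metis
  then show "triangulation square_triangles"
    unfolding triangulation_def using s by (auto simp: square_triangles_def)
qed

lemma Union_square_triangles: "\<Union>square_triangles = diamond"
proof (intro equalityI subsetI)
  fix p assume "p \<in> \<Union>square_triangles"
  then obtain a b where ab: "a \<in> {1, -1}" "b \<in> {1, -1}" "p \<in> square_triangle a b"
    unfolding square_triangles_def by blast
  then have "\<bar>p $ 1\<bar> = a * p $ 1" "\<bar>p $ 2\<bar> = b * p $ 2" by (auto simp: square_triangle_def)
  then show "p \<in> diamond" using ab(3) by (simp add: square_triangle_def diamond_def)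
next
  fix p assume p: "p \<in> diamond"
  define a b :: real where "a = (if p $ 1 \<ge> 0 then 1 else -1)" and "b = (if p $ 2 \<ge> 0 then 1 else -1)"
  have "a * p $ 1 = \<bar>p $ 1\<bar>" "b * p $ 2 = \<bar>p $ 2\<bar>" by (auto simp: a_def b_def)
  then have "p \<in> square_triangle a b" using p by (simp add: square_triangle_def diamond_def)
  moreover have "a \<in> {1, -1}" "b \<in> {1, -1}" by (auto simp: a_def b_def)
  ultimately show "p \<in> \<Union>square_triangles" unfolding square_triangles_def by blast
qed

lemma diamond_ineq:
  assumes "p \<in> diamond" shows "1/2 \<le> 1 - 2 * \<bar>p $ 1 * p $ 2\<bar>"
proof -
  define x y where "x = \<bar>p $ 1\<bar>" and "y = \<bar>p $ 2\<bar>"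
  have "0 \<le> x" "0 \<le> y" "x + y \<le> 1" using assms by (auto simp: x_def y_def diamond_def)
  then have "(x + y)\<^sup>2 \<le> 1" by (simp add: power_le_one)
  then have "4 * (x * y) \<le> 1" using zero_le_power2[of "x - y"] by (simp add: power2_eq_square algebra_simps)
  then show ?thesis by (simp add: x_def y_def abs_mult)
qed

lemma diamond_convex_compact: "convex diamond" "compact diamond" "interior diamond \<noteq> {}" "frontier diamond = {p. \<bar>p $ 1\<bar> + \<bar>p $ 2\<bar> = 1}"
proof -
  show "convex diamond"
  proof (rule convexI)
    fix x y :: "real^2" and u v :: real
    assume xy: "x \<in> diamond" "y \<in> diamond" "0 \<le> u" "0 \<le> v" "u + v = 1"
    have "\<bar>(u *\<^sub>R x + v *\<^sub>R y) $ i\<bar> \<le> u * \<bar>x $ i\<bar> + v * \<bar>y $ i\<bar>" for i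
      using xy abs_triangle_ineq[of "u * x $ i" "v * y $ i"] by (simp add: abs_mult)
    from this[of 1] this[of 2] have "\<bar>(u *\<^sub>R x + v *\<^sub>R y) $ 1\<bar> + \<bar>(u *\<^sub>R x + v *\<^sub>R y) $ 2\<bar>
       \<le> u * (\<bar>x $ 1\<bar> + \<bar>x $ 2\<bar>) + v * (\<bar>y $ 1\<bar> + \<bar>y $ 2\<bar>)" by (simp add: distrib_left)
    also have "\<dots> \<le> u * 1 + v * 1" using xy by (intro add_mono mult_left_mono) (auto simp: diamond_def)
    finally show "u *\<^sub>R x + v *\<^sub>R y \<in> diamond" using xy by (simp add: diamond_def)
  qed
  have cont: "continuous_on UNIV (\<lambda>p::real^2. \<bar>p $ 1\<bar> + \<bar>p $ 2\<bar>)" by (intro continuous_intros)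
  have cl: "closed diamond" unfolding diamond_def
    using closed_Collect_le[OF cont continuous_on_const[of UNIV 1]] by simp
  have "norm p \<le> 1" if "p \<in> diamond" for p using norm_le_l1_cart[of p] that by (simp add: diamond_def sum_2)
  then have "bounded diamond" by (auto simp: bounded_iff)
  then show "compact diamond" using cl by (simp add: compact_eq_bounded_closed)
  have op: "open {p::real^2. \<bar>p $ 1\<bar> + \<bar>p $ 2\<bar> < 1}"
    using open_Collect_less[OF cont continuous_on_const[of UNIV 1]] by simp
  have sub: "{p::real^2. \<bar>p $ 1\<bar> + \<bar>p $ 2\<bar> < 1} \<subseteq> interior diamond"
    by (rule interior_maximal[OF _ op]) (auto simp: diamond_def)
  moreover have "0 \<in> {p::real^2. \<bar>p $ 1\<bar> + \<bar>p $ 2\<bar> < 1}" by simp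
  ultimately show "interior diamond \<noteq> {}" by blast
  have "p \<notin> interior diamond" if p: "\<bar>p $ 1\<bar> + \<bar>p $ 2\<bar> = 1" for p :: "real^2"
  proof
    assume "p \<in> interior diamond"
    then obtain e where e: "e > 0" "ball p e \<subseteq> diamond" by (auto simp: mem_interior)
    have np: "norm p \<le> 1" using norm_le_l1_cart[of p] p by (simp add: sum_2)
    define q where "q = (1 + e/2) *\<^sub>R p"
    have "dist p q = e/2 * norm p" using e by (simp add: q_def dist_norm scaleR_left_distrib)
    also have "\<dots> \<le> e/2 * 1" using np e by (intro mult_left_mono) auto
    finally have "q \<in> diamond" using e by auto
    moreover have "\<bar>q $ 1\<bar> + \<bar>q $ 2\<bar> = (1 + e/2) * (\<bar>p $ 1\<bar> + \<bar>p $ 2\<bar>)"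
      using e by (simp add: q_def abs_mult distrib_left)
    ultimately show False using p e by (simp add: diamond_def)
  qed
  then show "frontier diamond = {p. \<bar>p $ 1\<bar> + \<bar>p $ 2\<bar> = 1}"
    unfolding frontier_def closure_closed[OF cl] using sub by (force simp: diamond_def)
qed

text \<open>If v = m p with m = (1 - 2 s x y)^(-1/2), the same quadratic form evaluated at v
  recovers m, so the radial map has an explicit inverse.\<close>

lemma scale_roundtrip:
  fixes s x y :: real
  assumes s: "1 - 2 * (s * (x * y)) > 0"
  defines "m \<equiv> inverse (sqrt (1 - 2 * (s * (x * y))))"
  shows "m > 0" "1 + 2 * (s * ((m * x) * (m * y))) = m\<^sup>2"
proof -
  show "m > 0" using s by (simp add: m_def)
  have "m\<^sup>2 * (1 - 2 * (s * (x * y))) = 1" using s by (simp add: m_def power_inverse)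
  then show "1 + 2 * (s * ((m * x) * (m * y))) = m\<^sup>2" by (simp add: power2_eq_square algebra_simps)
qed

context twist
begin

text \<open>With this choice \<open>FF\<close> on \<open>sheet\<close> is a positive multiple of
  |p|^2 - 1. The open unit disk becomes the page where \<open>FF\<close> is negative, and the unit
  circle the curve.\<close>

definition "spanX p = of_real ((p $ 1)\<^sup>2 + (p $ 2)\<^sup>2 - 1)" for p :: "real^2"
definition "spanZ p = Complex (p $ 1) (p $ 2)" for p :: "real^2"
definition "sheet p = XX (spanX p) (spanZ p)" for p :: "real^2"
text \<open>The difference |ww|^2 - Re FF recovers the scale factor \<open>ll\<close> of
  \<open>sheet\<close>; dividing \<open>ww\<close> by its square root gives back p.\<close>

definition "unsheet q = inverse (sqrt ((cmod (ww q))\<^sup>2 - Re (FF q))) *\<^sub>R (vector [Re (ww q), Im (ww q)] :: real^2)" for q :: "real^3"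

lemma span_conditions: "spanX p \<noteq> 0 \<or> spanZ p \<noteq> 0" "\<not> (spanX p = (spanZ p)\<^sup>2 \<and> Im (spanZ p) = 0 \<and> Re (spanZ p) > 0)"
  by (auto simp: spanX_def spanZ_def complex_eq_iff power2_eq_square)

lemmas sheet_props = XX_props[OF span_conditions, folded sheet_def]

lemma sheet_ll: "ll (spanX p) (spanZ p) > 0" using ll_root(1)[OF span_conditions(1)] .

lemma sheet_denominator: "(cmod (ww (sheet p)))\<^sup>2 - Re (FF (sheet p)) = ll (spanX p) (spanZ p)"
proof -
  have "(cmod (ww (sheet p)))\<^sup>2 = ll (spanX p) (spanZ p) * ((p $ 1)\<^sup>2 + (p $ 2)\<^sup>2)"
    unfolding sheet_props using sheet_ll[of p] by (simp add: norm_mult power_mult_distrib cmod_power2 spanZ_def)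
  moreover have "Re (FF (sheet p)) = ll (spanX p) (spanZ p) * ((p $ 1)\<^sup>2 + (p $ 2)\<^sup>2 - 1)"
    unfolding sheet_props by (simp add: spanX_def)
  ultimately show ?thesis by (simp add: algebra_simps)
qed

lemma unsheet_sheet: "unsheet (sheet p) = p"
  unfolding unsheet_def sheet_denominator unfolding sheet_props
  using sheet_ll[of p] by (simp add: vec_eq_iff forall_2 vector_2 spanZ_def)

lemma Cinf_on_sheet: "Cinf_on UNIV sheet"
proof -
  define A where "A p = AA (spanX p) (spanZ p)" for p
  define L where "L p = ll (spanX p) (spanZ p)" for p
  define w where "w p = psi (L p * Re (A p))" for p
  define u where "u p = 1 - sqrt (L p) * (p $ 1 * cos (w p) - p $ 2 * sin (w p))" for p
  define v where "v p = sqrt (L p) * (p $ 1 * sin (w p) + p $ 2 * cos (w p))" for p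
  have A: "Cinf_on UNIV (\<lambda>p. Re (A p))" "Cinf_on UNIV (\<lambda>p. Im (A p))"
    unfolding A_def AA_def spanX_def spanZ_def power2_eq_square using kap(1)
    by (simp_all, (intro Cinf_intros; simp)+)
  have L_eq: "L p = 2 / (((p $ 1)\<^sup>2 + (p $ 2)\<^sup>2) + sqrt (((p $ 1)\<^sup>2 + (p $ 2)\<^sup>2)\<^sup>2 + 4 * ((Re (A p))\<^sup>2 + (Im (A p))\<^sup>2)))" for p
  proof -
    have "(cmod (spanZ p)) ^ 4 = ((cmod (spanZ p))\<^sup>2)\<^sup>2" by (simp flip: power_mult)
    then show ?thesis unfolding L_def ll_def A_def cmod_power2 by (simp only: cmod_power2) (simp add: spanZ_def)
  qed
  have pos: "((p $ 1)\<^sup>2 + (p $ 2)\<^sup>2)\<^sup>2 + 4 * ((Re (A p))\<^sup>2 + (Im (A p))\<^sup>2) > 0" for p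
  proof (rule ccontr)
    assume "\<not> ?thesis"
    moreover have "a = 0 \<and> b = 0" if "\<not> 0 < a + 4 * b" "0 \<le> a" "0 \<le> b" for a b :: real using that by linarith
    ultimately have "((p $ 1)\<^sup>2 + (p $ 2)\<^sup>2)\<^sup>2 = 0 \<and> (Re (A p))\<^sup>2 + (Im (A p))\<^sup>2 = 0"
      using zero_le_power2 sum_power2_ge_zero by blast
    then have z: "(p $ 1)\<^sup>2 + (p $ 2)\<^sup>2 = 0" "(Re (A p))\<^sup>2 + (Im (A p))\<^sup>2 = 0" by (simp_all only: zero_eq_power2)
    then show False using ll_root(2)[OF span_conditions(1), of p] by (simp add: cmod_power2 A_def spanZ_def)
  qed
  have den: "((p $ 1)\<^sup>2 + (p $ 2)\<^sup>2) + sqrt (((p $ 1)\<^sup>2 + (p $ 2)\<^sup>2)\<^sup>2 + 4 * ((Re (A p))\<^sup>2 + (Im (A p))\<^sup>2)) \<noteq> 0" for p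
    using pos[of p] real_sqrt_gt_zero[OF pos[of p]] sum_power2_ge_zero[of "p $ 1" "p $ 2"] by linarith
  have L: "Cinf_on UNIV L"
    unfolding L_eq[abs_def] by (intro Cinf_intros A pos den; simp)
  have Lpos: "L p > 0" for p unfolding L_def by (rule sheet_ll)
  have w: "Cinf_on UNIV w" unfolding w_def by (intro Cinf_intros Cinf_on_compose[OF Cinf_on_psi] L A) auto
  have uv: "Cinf_on UNIV u" "Cinf_on UNIV v" unfolding u_def v_def by (intro Cinf_intros L w Lpos; simp)+
  have b1: "Re (b1 (spanX p) (spanZ p)) = L p * Re (A p)" "Im (b1 (spanX p) (spanZ p)) = L p * Im (A p)" for p
    by (simp_all add: b1_def L_def A_def)
  have b2: "1 - Re (b2 (spanX p) (spanZ p)) = u p" "Im (b2 (spanX p) (spanZ p)) = v p" for p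
    unfolding b2_def b1 by (simp_all add: u_def v_def w_def L_def spanZ_def algebra_simps)
  have un: "u p \<noteq> 0" for p using Re_b2[OF span_conditions, of p] b2(1)[of p] by linarith
  have s: "sheet p = vector [L p * Re (A p) / u p, L p * Im (A p) / u p, sc (L p * Re (A p) / u p) * (v p / u p)]" for p
    unfolding sheet_def XX_def PP_def Let_def b1 b2 ..
  have "Cinf_on UNIV (\<lambda>p. sheet p $ 1)" "Cinf_on UNIV (\<lambda>p. sheet p $ 2)" "Cinf_on UNIV (\<lambda>p. sheet p $ 3)"
    unfolding s vector_3 by (intro Cinf_intros Cinf_on_compose[OF Cinf_on_sc] L A uv un; simp)+
  note c = this
  show ?thesis
  proof (rule Cinf_on_vec[OF open_UNIV])
    fix i :: 3
    show "Cinf_on UNIV (\<lambda>p. sheet p $ i)" using exhaust_3[of i] c by (elim disjE) simp_all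
  qed
qed

lemma unsheet_differentiable:
  assumes "(cmod (ww q))\<^sup>2 - Re (FF q) > 0"
  shows "unsheet differentiable (at q)"
proof -
  have N: "Cinf_on UNIV zz" "Cinf_on UNIV NN"
    unfolding NN_def zz_def using sc_nz by (intro Cinf_intros Cinf_on_compose[OF Cinf_on_sc]; simp)+
  have z: "Cinf_on UNIV (\<lambda>q. Re (z1 q))" "Cinf_on UNIV (\<lambda>q. Im (z1 q))" "Cinf_on UNIV (\<lambda>q. Re (z2 q))" "Cinf_on UNIV (\<lambda>q. Im (z2 q))"
    unfolding z1_def z2_def complex.sel using NN_nz by (intro Cinf_intros N; simp)+
  have p: "Cinf_on UNIV (\<lambda>q. psi (Re (z1 q)))" by (intro Cinf_on_compose[OF Cinf_on_psi] z) auto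
  have w: "Cinf_on UNIV (\<lambda>q. Re (ww q))" "Cinf_on UNIV (\<lambda>q. Im (ww q))"
    unfolding ww_def times_complex.sel cis.sel by (intro Cinf_intros z p; simp)+
  have F: "Cinf_on UNIV (\<lambda>q. Re (FF q))"
    unfolding FF_def power2_eq_square plus_complex.sel times_complex.sel cis.sel Re_complex_of_real Im_complex_of_real
    by (intro Cinf_intros z w; simp)
  define D where "D q = (Re (ww q))\<^sup>2 + (Im (ww q))\<^sup>2 - Re (FF q)" for q
  have D: "Cinf_on UNIV D" unfolding D_def by (intro Cinf_intros w F) auto
  have op: "open {q. 0 < D q}" using open_Collect_less[OF continuous_on_const Cinf_on_continuous[OF D]] .
  have "Cinf_on {q. 0 < D q} (\<lambda>q. (1 / sqrt (D q)) *\<^sub>R (vector [Re (ww q), Im (ww q)] :: real^2))"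
    by (intro Cinf_intros Cinf_on_scaled_vec2 op Cinf_on_subset[OF D] Cinf_on_subset[OF w(1)] Cinf_on_subset[OF w(2)]) auto
  moreover have "unsheet = (\<lambda>q. (1 / sqrt (D q)) *\<^sub>R (vector [Re (ww q), Im (ww q)] :: real^2))"
    by (simp add: unsheet_def[abs_def] D_def cmod_power2 inverse_eq_divide)
  moreover have "q \<in> {q. 0 < D q}" using assms by (simp add: D_def cmod_power2)
  ultimately show ?thesis using Cinf_on_differentiable by metis
qed

lemma sheet_boundary: "sheet ` {p. (p $ 1)\<^sup>2 + (p $ 2)\<^sup>2 = 1} = {q. FF q = 0}"
proof (intro equalityI subsetI)
  fix q assume "q \<in> sheet ` {p. (p $ 1)\<^sup>2 + (p $ 2)\<^sup>2 = 1}"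
  then obtain p where p: "(p $ 1)\<^sup>2 + (p $ 2)\<^sup>2 = 1" "q = sheet p" by auto
  then show "q \<in> {q. FF q = 0}" using sheet_props(4)[of p] by (simp add: spanX_def)
next
  fix q assume "q \<in> {q. FF q = 0}"
  then have F: "FF q = 0" by simp
  define p :: "real^2" where "p = vector [Re (ww q) / d, Im (ww q) / d]"
  have "(Re (ww q))\<^sup>2 + (Im (ww q))\<^sup>2 = d\<^sup>2" using FF_zero(1)[OF F] cmod_power2[of "ww q"] by simp
  then have p: "(p $ 1)\<^sup>2 + (p $ 2)\<^sup>2 = 1" using d0 by (simp add: p_def vector_2 power_divide flip: add_divide_distrib)
  have F2: "FF (sheet p) = 0" using sheet_props(4)[of p] p by (simp add: spanX_def)
  have "cmod (spanZ p) = 1" using p by (simp add: spanZ_def cmod_def)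
  then have "sqrt (ll (spanX p) (spanZ p)) = d"
    using FF_zero(1)[OF F2] sheet_ll[of p] unfolding sheet_props by (simp add: norm_mult)
  then have w: "ww (sheet p) = ww q" unfolding sheet_props using d0 by (simp add: complex_eq_iff spanZ_def p_def vector_2)
  have "z1 (sheet p) = z1 q" using FF_zero(3)[OF F] FF_zero(3)[OF F2] w by simp
  then have "sheet p = q" using w z2_ww PP_inverse by metis
  then show "q \<in> sheet ` {p. (p $ 1)\<^sup>2 + (p $ 2)\<^sup>2 = 1}" using p by blast
qed

text \<open>A disk must be parametrised over triangles, whereas \<open>sheet\<close> lives on the
  round disk. Dividing p by sqrt(1 - 2|xy|) carries the diamond |x| + |y| <= 1 to the unit disk. The
  absolute value has constant sign on each quarter, so the map is smooth on each triangle, and a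
  differentiable left inverse makes it an immersion.\<close>

lemma curve_unknotted:
  assumes l: "l > 0"
  shows "unknotted ((\<lambda>p. p /\<^sub>R l) ` {p. FF p = 0})"
proof -
  define m where "m s p = inverse (sqrt (1 - 2 * (s * (p $ 1 * p $ 2))))" for s and p :: "real^2"
  define m' where "m' s p = inverse (sqrt (1 + 2 * (s * (p $ 1 * p $ 2))))" for s and p :: "real^2"
  define G where "G s p = sheet (m s p *\<^sub>R p) /\<^sub>R l" for s p
  define H where "H s q = (let v = unsheet (l *\<^sub>R q) in m' s v *\<^sub>R v)" for s q
  \<comment> \<open>The sign of xy selects the smooth formula. The radial map preserves it, so it
    can be read off from the image when proving injectivity.\<close>
  define sg where "sg p = sgn (p $ 1 * p $ 2)" for p :: "real^2"
  define f where "f p = G (sg p) p" for p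
  have HG: "H s (G s p) = p" if "1 - 2 * (s * (p $ 1 * p $ 2)) > 0" for s p
  proof -
    note r = scale_roundtrip[OF that, folded m_def]
    have "H s (G s p) = m' s (m s p *\<^sub>R p) *\<^sub>R (m s p *\<^sub>R p)"
      using l by (simp add: H_def G_def unsheet_sheet Let_def)
    also have "m' s (m s p *\<^sub>R p) = inverse (m s p)"
      unfolding m'_def vector_scaleR_component real_scaleR_def r(2) using r(1) by simp
    finally show ?thesis using r(1) by simp
  qed
  have sgp: "sg p * (p $ 1 * p $ 2) = \<bar>p $ 1 * p $ 2\<bar>" for p by (simp add: sg_def abs_sgn mult.commute)
  have dpos: "1 - 2 * (sg p * (p $ 1 * p $ 2)) > 0" if "p \<in> diamond" for p
    using diamond_ineq[OF that] unfolding sgp by linarith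
  have sgG: "sg (unsheet (l *\<^sub>R f p)) = sg p" if "p \<in> diamond" for p
  proof -
    have "m (sg p) p > 0" using scale_roundtrip(1)[OF dpos[OF that]] by (simp add: m_def)
    then show ?thesis using l by (simp add: f_def G_def unsheet_sheet sg_def sgn_mult)
  qed
  have inj: "inj_on f diamond"
  proof (rule inj_onI)
    fix p q assume pq: "p \<in> diamond" "q \<in> diamond" "f p = f q"
    then have "sg p = sg q" using sgG by metis
    moreover have "H (sg p) (f p) = p" "H (sg q) (f q) = q" unfolding f_def using HG[OF dpos] pq by auto
    ultimately show "p = q" using pq(3) by metis
  qed
  have feq: "f p = sheet (inverse (sqrt (1 - 2 * \<bar>p $ 1 * p $ 2\<bar>)) *\<^sub>R p) /\<^sub>R l" for p
    unfolding f_def G_def m_def sgp ..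
  have cont: "continuous_on diamond f"
  proof -
    have "sqrt (1 - 2 * \<bar>p $ 1 * p $ 2\<bar>) \<noteq> 0" if "p \<in> diamond" for p using diamond_ineq[OF that] by simp
    then have "continuous_on diamond (\<lambda>p. inverse (sqrt (1 - 2 * \<bar>p $ 1 * p $ 2\<bar>)) *\<^sub>R p)"
      by (intro continuous_intros) auto
    then have "continuous_on diamond (\<lambda>p. sheet (inverse (sqrt (1 - 2 * \<bar>p $ 1 * p $ 2\<bar>)) *\<^sub>R p))"
      by (rule continuous_on_compose2[OF Cinf_on_continuous[OF Cinf_on_sheet]]) auto
    then show ?thesis unfolding feq[abs_def] by (intro continuous_intros)
  qed
  have piece: "\<exists>U g. open U \<and> T \<subseteq> U \<and> Cinf_on U g \<and> (\<forall>x\<in>T. g x = f x \<and> inj (frechet_derivative g (at x)))"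
    if T: "T \<in> square_triangles" for T
  proof -
    obtain a b where ab: "a \<in> {1,-1}" "b \<in> {1,-1}" "T = square_triangle a b" using T unfolding square_triangles_def by blast
    define s where "s = a * b"
    have TD: "T \<subseteq> diamond" using T Union_square_triangles by blast
    have sT: "s * (p $ 1 * p $ 2) = sg p * (p $ 1 * p $ 2)" if "p \<in> T" for p
    proof -
      have "0 \<le> (a * p $ 1) * (b * p $ 2)" using that unfolding ab(3) square_triangle_def by simp
      then have "0 \<le> s * (p $ 1 * p $ 2)" by (simp add: s_def mult_ac)
      moreover have "\<bar>s\<bar> = 1" using ab by (auto simp: s_def)
      ultimately show ?thesis unfolding sgp by (metis abs_mult abs_of_nonneg mult_1)
    qed
    define U where "U = {p::real^2. 0 < 1 - 2 * (s * (p $ 1 * p $ 2))}"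
    have opU: "open U" unfolding U_def by (intro open_Collect_less continuous_intros)
    have TU: "T \<subseteq> U" using TD dpos by (auto simp: U_def sT)
    have Cm: "Cinf_on U (\<lambda>p. (1 / sqrt (1 - 2 * (s * (p $ 1 * p $ 2)))) *\<^sub>R p)"
      using opU by (intro Cinf_intros) (auto simp: U_def)
    have "Cinf_on U (\<lambda>p. (1 / l) *\<^sub>R sheet ((1 / sqrt (1 - 2 * (s * (p $ 1 * p $ 2)))) *\<^sub>R p))"
      by (intro Cinf_intros opU Cinf_on_compose[OF Cinf_on_sheet] Cm) auto
    then have CG: "Cinf_on U (G s)" by (simp add: G_def[abs_def] m_def inverse_eq_divide)
    have "G s x = f x \<and> inj (frechet_derivative (G s) (at x))" if x: "x \<in> T" for x
    proof
      show "G s x = f x" unfolding f_def G_def m_def sT[OF x] ..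
      have xU: "x \<in> U" using x TU by blast
      then have xp: "1 - 2 * (s * (x $ 1 * x $ 2)) > 0" by (simp add: U_def)
      note r = scale_roundtrip[OF xp, folded m_def]
      have "H s differentiable (at (G s x))"
      proof -
        define v where "v = m s x *\<^sub>R x"
        have lg: "l *\<^sub>R G s x = sheet v" using l by (simp add: G_def v_def)
        have "unsheet differentiable (at (sheet v))"
          by (rule unsheet_differentiable) (unfold sheet_denominator, rule sheet_ll)
        then have d1: "(\<lambda>q. unsheet (l *\<^sub>R q)) differentiable (at (G s x))"
          using differentiable_chain_at[of "\<lambda>q. l *\<^sub>R q" "G s x" unsheet] lg by (simp add: o_def)
        define W where "W = {p::real^2. 0 < 1 + 2 * (s * (p $ 1 * p $ 2))}"
        have opW: "open W" unfolding W_def by (intro open_Collect_less continuous_intros)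
        have "Cinf_on W (\<lambda>p. (1 / sqrt (1 + 2 * (s * (p $ 1 * p $ 2)))) *\<^sub>R p)"
          using opW by (intro Cinf_intros) (auto simp: W_def)
        moreover have "v \<in> W" using r by (simp add: v_def W_def)
        ultimately have "(\<lambda>p. m' s p *\<^sub>R p) differentiable (at v)"
          unfolding m'_def inverse_eq_divide using Cinf_on_differentiable by blast
        then show ?thesis
          using differentiable_chain_at[OF d1, of "\<lambda>p. m' s p *\<^sub>R p"] lg
          by (simp add: o_def H_def[abs_def] Let_def unsheet_sheet)
      qed
      then show "inj (frechet_derivative (G s) (at x))"
        using left_inverse_inj_derivative[OF Cinf_on_differentiable[OF CG xU] _ opU xU, of "H s"] HG by (auto simp: U_def)
    qed
    then show ?thesis using opU TU CG by blast
  qed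
  have bd: "f ` frontier diamond = (\<lambda>p. p /\<^sub>R l) ` {p. FF p = 0}"
  proof -
    have "(\<lambda>p. inverse (sqrt (1 - 2 * \<bar>p $ 1 * p $ 2\<bar>)) *\<^sub>R p) ` {p::real^2. \<bar>p $ 1\<bar> + \<bar>p $ 2\<bar> = 1} = {p. (p $ 1)\<^sup>2 + (p $ 2)\<^sup>2 = 1}" (is "?u ` ?S = ?C")
    proof (intro equalityI subsetI)
      fix q assume "q \<in> ?u ` ?S"
      then obtain p where p: "\<bar>p $ 1\<bar> + \<bar>p $ 2\<bar> = 1" "q = ?u p" by auto
      have pos: "1 - 2 * \<bar>p $ 1 * p $ 2\<bar> > 0" using diamond_ineq[of p] p by (simp add: diamond_def)
      have "(\<bar>p $ 1\<bar> + \<bar>p $ 2\<bar>)\<^sup>2 = 1" using p by simp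
      \<comment> \<open>On the edge of the diamond, squaring |x| + |y| = 1 shows that the divisor is
        the Euclidean norm.\<close>
      then have e: "(p $ 1)\<^sup>2 + (p $ 2)\<^sup>2 = 1 - 2 * \<bar>p $ 1 * p $ 2\<bar>" by (simp add: power2_sum abs_mult)
      have "(q $ 1)\<^sup>2 + (q $ 2)\<^sup>2 = (inverse (sqrt (1 - 2 * \<bar>p $ 1 * p $ 2\<bar>)))\<^sup>2 * ((p $ 1)\<^sup>2 + (p $ 2)\<^sup>2)"
        unfolding p(2) by (simp add: power_mult_distrib distrib_left)
      also have "\<dots> = 1" unfolding e using pos by (simp add: power_inverse)
      finally show "q \<in> ?C" by simp
    next
      fix v assume "v \<in> ?C"
      then have v: "(v $ 1)\<^sup>2 + (v $ 2)\<^sup>2 = 1" by simp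
      define t where "t = \<bar>v $ 1\<bar> + \<bar>v $ 2\<bar>"
      have t2: "t\<^sup>2 = 1 + 2 * \<bar>v $ 1 * v $ 2\<bar>" using v by (simp add: t_def power2_sum abs_mult)
      have t: "t > 0"
      proof -
        have "t \<noteq> 0" using t2 by (metis abs_ge_zero add_pos_nonneg mult_nonneg_nonneg order_less_irrefl zero_eq_power2 zero_le_numeral zero_less_one)
        then show ?thesis by (simp add: t_def)
      qed
      define p where "p = inverse t *\<^sub>R v"
      have "\<bar>p $ 1\<bar> + \<bar>p $ 2\<bar> = inverse t * t" unfolding t_def using t by (simp add: p_def abs_mult distrib_left t_def)
      then have pS: "p \<in> ?S" using t by simp
      have "1 - 2 * \<bar>p $ 1 * p $ 2\<bar> = (inverse t)\<^sup>2"
      proof -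
        have "\<bar>p $ 1 * p $ 2\<bar> = (inverse t)\<^sup>2 * \<bar>v $ 1 * v $ 2\<bar>"
          using t by (simp add: p_def abs_mult power2_eq_square)
        moreover have "(inverse t)\<^sup>2 * (t\<^sup>2) = 1" using t by (simp add: power_inverse)
        ultimately show ?thesis unfolding t2 by (simp add: algebra_simps)
      qed
      then have "?u p = v" using t by (simp add: p_def)
      then show "v \<in> ?u ` ?S" using pS by blast
    qed
    note uS = this
    have "f ` frontier diamond = (\<lambda>p. p /\<^sub>R l) ` sheet ` ?u ` ?S"
      unfolding diamond_convex_compact(4) feq[abs_def] image_image ..
    then show ?thesis unfolding uS sheet_boundary .
  qed
  have "ps_embedded_disk square_triangles f"
    unfolding ps_embedded_disk_def Union_square_triangles
    using square_triangulation piece cont inj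
      homeomorphic_convex_compact_cball[OF diamond_convex_compact(1-3), of 1 0] by auto
  then have "spans square_triangles f ((\<lambda>p. p /\<^sub>R l) ` {p. FF p = 0})"
    unfolding spans_def disk_boundary_def Union_square_triangles using bd by simp
  then show ?thesis unfolding unknotted_def by blast
qed

end

section \<open>From lines to area\<close>

context twist_disk
begin

text \<open>The map \<open>push\<close> carries the line \<open>x = xc, z = zc\<close> to the \<open>y\<close>-axis, and it is the identity
  away from a thin neighbourhood of these lines that misses the curve.\<close>

lemma crossing_bound_lines:
  assumes y0: "\<bar>y0\<bar> \<le> 1/100" and z0: "1/50 \<le> z0" "z0 \<le> 1/25"
    and xc: "\<bar>xc\<bar> \<le> 1/1000" and zc: "\<bar>zc\<bar> \<le> 1/1000"
    and fA: "finite {p \<in> k ` cball 0 1. p $ 2 = y0 \<and> p $ 3 = z0}"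
    and fB: "finite {p \<in> k ` cball 0 1. p $ 1 = xc \<and> p $ 3 = zc}"
  shows "2 * n \<le> card {p \<in> k ` cball 0 1. p $ 2 = y0 \<and> p $ 3 = z0} + card {p \<in> k ` cball 0 1. p $ 1 = xc \<and> p $ 3 = zc}"
proof -
  \<comment> \<open>A cut-off equal to 1 on the given line, supported within 1/200 of it in the
    coordinates x and z. There heights stay below 1/50, so both the curve and the lines of the first
    family are out of reach.\<close>
  define tau where "tau p = max 0 (1 - 200 * (\<bar>p $ 1 - xc\<bar> + \<bar>p $ 3 - zc\<bar>))" for p :: "real^3"
  define push where "push p = (vector [p $ 1 - xc * tau p, p $ 2, p $ 3 - zc * tau p] :: real^3)" for p
  have c: "push p $ 1 = p $ 1 - xc * tau p" "push p $ 2 = p $ 2" "push p $ 3 = p $ 3 - zc * tau p" for p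
    by (simp_all add: push_def vector_3)
  have tau: "0 \<le> tau p" "tau p \<le> 1" for p by (auto simp: tau_def)
  have sup: "\<bar>p $ 1\<bar> \<le> 1/100 \<and> \<bar>p $ 3\<bar> \<le> 6/1000" if t: "tau p \<noteq> 0" for p
  proof -
    have "200 * (\<bar>p $ 1 - xc\<bar> + \<bar>p $ 3 - zc\<bar>) < 1" using t by (simp add: tau_def max_def split: if_splits)
    moreover have "u \<le> 1/200 \<and> w \<le> 1/200" if "200 * (u + w) < 1" "0 \<le> u" "0 \<le> w" for u w :: real
      using that by auto
    ultimately have "\<bar>p $ 1 - xc\<bar> \<le> 1/200" "\<bar>p $ 3 - zc\<bar> \<le> 1/200" using abs_ge_zero by blast+
    then show ?thesis using xc zc unfolding abs_le_iff by simp
  qed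
  have small: "\<bar>zc * tau p\<bar> \<le> 1/1000" for p
  proof -
    have "\<bar>zc * tau p\<bar> \<le> 1/1000 * 1" unfolding abs_mult using zc tau[of p] by (intro mult_mono) auto
    then show ?thesis by simp
  qed
  have fix0: "push p = p" if "tau p = 0" for p using that by (simp add: vec_eq_iff forall_3 c)
  have fixG: "push p = p" if "FF p = 0" for p
  proof (rule fix0, rule ccontr)
    assume "tau p \<noteq> 0"
    then show False using sup[of p] FF_zero_height[OF that] by linarith
  qed
  have fixA: "push p = p" if "push p $ 3 \<ge> 1/50" for p
  proof (rule fix0, rule ccontr)
    assume "tau p \<noteq> 0"
    then show False using sup[of p] small[of p] that unfolding c by linarith
  qed
  \<comment> \<open>The cut-off is 200-Lipschitz and the displacement is at most 2/1000 in total, so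
    \<open>push\<close> is a perturbation of the identity with Lipschitz constant 2/5.\<close>
  have inj: "p = q" if pq: "push p = push q" for p q
  proof -
    have e: "p $ 1 - q $ 1 = xc * (tau p - tau q)" "p $ 3 - q $ 3 = zc * (tau p - tau q)" "p $ 2 = q $ 2"
      using arg_cong[OF pq, of "\<lambda>v. v $ 1"] arg_cong[OF pq, of "\<lambda>v. v $ 2"] arg_cong[OF pq, of "\<lambda>v. v $ 3"]
      unfolding c by (simp_all add: algebra_simps)
    have "\<bar>tau p - tau q\<bar> \<le> 200 * (\<bar>p $ 1 - q $ 1\<bar> + \<bar>p $ 3 - q $ 3\<bar>)"
    proof -
      define u w where "u = \<bar>p $ 1 - xc\<bar> + \<bar>p $ 3 - zc\<bar>" and "w = \<bar>q $ 1 - xc\<bar> + \<bar>q $ 3 - zc\<bar>"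
      have lip: "\<bar>max 0 a - max 0 b\<bar> \<le> \<bar>a - b\<bar>" for a b :: real
        by (cases "0 \<le> a"; cases "0 \<le> b") (simp_all add: max_def)
      have add: "\<bar>(a + b) - (a' + b')\<bar> \<le> e + e'" if "\<bar>a - a'\<bar> \<le> e" "\<bar>b - b'\<bar> \<le> e'" for a b a' b' e e' :: real
        using that by linarith
      have "\<bar>u - w\<bar> \<le> \<bar>p $ 1 - q $ 1\<bar> + \<bar>p $ 3 - q $ 3\<bar>"
        unfolding u_def w_def
        using abs_triangle_ineq3[of "p $ 1 - xc" "q $ 1 - xc"] abs_triangle_ineq3[of "p $ 3 - zc" "q $ 3 - zc"]
        by (intro add) simp_all
      moreover have "\<bar>tau p - tau q\<bar> \<le> \<bar>(1 - 200 * u) - (1 - 200 * w)\<bar>" unfolding tau_def u_def w_def by (rule lip)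
      moreover have "\<bar>(1 - 200 * u) - (1 - 200 * w)\<bar> = 200 * \<bar>u - w\<bar>" by (simp add: abs_if)
      ultimately show ?thesis by simp
    qed
    also have "\<dots> = 200 * ((\<bar>xc\<bar> + \<bar>zc\<bar>) * \<bar>tau p - tau q\<bar>)" unfolding e by (simp add: abs_mult distrib_right)
    also have "\<dots> \<le> 200 * ((2/1000) * \<bar>tau p - tau q\<bar>)" using xc zc by (intro mult_left_mono mult_right_mono) auto
    finally have "tau p = tau q" by simp
    then show ?thesis using e by (simp add: vec_eq_iff forall_3)
  qed
  have cont: "continuous_on S push" for S
    unfolding push_def tau_def by (intro continuous_on_vector3 continuous_intros)
  have axis: "push p $ 1 = 0 \<and> push p $ 3 = 0 \<longleftrightarrow> p $ 1 = xc \<and> p $ 3 = zc" for p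
  proof
    assume "p $ 1 = xc \<and> p $ 3 = zc"
    then show "push p $ 1 = 0 \<and> push p $ 3 = 0" by (simp add: c tau_def)
  next
    assume a: "push p $ 1 = 0 \<and> push p $ 3 = 0"
    define q :: "real^3" where "q = vector [xc, p $ 2, zc]"
    have "tau q = 1" by (simp add: q_def tau_def vector_3)
    then have "push p = push q" using a by (simp add: vec_eq_iff forall_3 c) (simp add: q_def vector_3)
    then have "p = q" by (rule inj)
    then have "p $ 1 = q $ 1" "p $ 3 = q $ 3" by simp_all
    then show "p $ 1 = xc \<and> p $ 3 = zc" by (simp add: q_def vector_3)
  qed
  interpret pushed: twist_disk n d "\<lambda>x. push (k x)"
  proof unfold_locales
    show "continuous_on (cball 0 1) (\<lambda>x. push (k x))"
      by (rule continuous_on_compose2[OF cont[of UNIV] contk]) auto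
    show "inj_on (\<lambda>x. push (k x)) (cball 0 1)"
      using injk inj unfolding inj_on_def by metis
    have "(\<lambda>x. push (k x)) ` sphere 0 1 = push ` {p. FF p = 0}" unfolding bdk[symmetric] by (simp add: image_image)
    also have "\<dots> = (\<lambda>p. p) ` {p. FF p = 0}" by (rule image_cong) (use fixG in auto)
    finally show "(\<lambda>x. push (k x)) ` sphere 0 1 = {p. FF p = 0}" by simp
  qed
  define D where "D = k ` cball 0 1"
  have im: "(\<lambda>x. push (k x)) ` cball 0 1 = push ` D" by (simp add: D_def image_image)
  have A: "{p \<in> push ` D. p $ 2 = y0 \<and> p $ 3 = z0} = {p \<in> D. p $ 2 = y0 \<and> p $ 3 = z0}"
  proof (intro equalityI subsetI)
    fix p assume "p \<in> {p \<in> push ` D. p $ 2 = y0 \<and> p $ 3 = z0}"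
    then obtain q where q: "q \<in> D" "p = push q" "p $ 2 = y0" "p $ 3 = z0" by auto
    then show "p \<in> {p \<in> D. p $ 2 = y0 \<and> p $ 3 = z0}" using fixA[of q] z0 by simp
  next
    fix p assume "p \<in> {p \<in> D. p $ 2 = y0 \<and> p $ 3 = z0}"
    then have p: "p \<in> D" "p $ 2 = y0" "p $ 3 = z0" by auto
    have "push p = p"
    proof (rule fix0, rule ccontr)
      assume "tau p \<noteq> 0"
      then show False using sup[of p] p z0 by linarith
    qed
    then show "p \<in> {p \<in> push ` D. p $ 2 = y0 \<and> p $ 3 = z0}" using p by (metis (mono_tags, lifting) imageI mem_Collect_eq)
  qed
  have B: "{p \<in> push ` D. p $ 1 = 0 \<and> p $ 3 = 0} = push ` {p \<in> D. p $ 1 = xc \<and> p $ 3 = zc}"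
    using axis by blast
  have "finite {p \<in> push ` D. p $ 1 = 0 \<and> p $ 3 = 0}" unfolding B using fB by (simp add: D_def)
  then have "2 * n \<le> card {p \<in> push ` D. p $ 2 = y0 \<and> p $ 3 = z0} + card {p \<in> push ` D. p $ 1 = 0 \<and> p $ 3 = 0}"
    using pushed.crossing_bound[OF y0 z0] fA unfolding im A unfolding D_def by simp
  moreover have "card (push ` {p \<in> D. p $ 1 = xc \<and> p $ 3 = zc}) \<le> card {p \<in> D. p $ 1 = xc \<and> p $ 3 = zc}"
    using fB by (intro card_image_le) (simp add: D_def)
  ultimately show ?thesis unfolding A B unfolding D_def by linarith
qed

end

text \<open>Each minor used by the projection is, up to sign, one component of the cross product.
  Scaling the disk by l maps the rectangle of lines to a rectangle smaller by the factor
  l^2.\<close>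

lemma disk_area_projection:
  fixes f :: "real^2 \<Rightarrow> real^3" and i :: 3
  assumes disk: "ps_embedded_disk \<T> f" and l: "l > 0" and i: "i = 1 \<or> i = 2" and ab: "a1 \<le> b1" "a2 \<le> b2"
    and mult: "\<And>s t. s \<in> {a1..b1} \<Longrightarrow> t \<in> {a2..b2} \<Longrightarrow>
      infinite {q \<in> (\<lambda>x. l *\<^sub>R f x) ` \<Union>\<T>. q $ i = s \<and> q $ 3 = t} \<or> m \<le> card {q \<in> (\<lambda>x. l *\<^sub>R f x) ` \<Union>\<T>. q $ i = s \<and> q $ 3 = t}"
  shows "real m * ((b1 - a1) * (b2 - a2) / l\<^sup>2) \<le> disk_area \<T> f"
proof -
  define pr where "pr v = (vector [v $ i, v $ 3] :: real^2)" for v :: "real^3"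
  have prc: "pr v $ 1 = v $ i" "pr v $ 2 = v $ 3" for v by (simp_all add: pr_def vector_2)
  define A B :: "real^2" where "A = vector [a1 / l, a2 / l]" and "B = vector [b1 / l, b2 / l]"
  have lin: "linear pr" by (rule linearI) (simp_all add: vec_eq_iff forall_2 prc)
  have det: "\<bar>pr u $ 1 * pr v $ 2 - pr v $ 1 * pr u $ 2\<bar> \<le> norm (cross3 u v)" for u v
  proof -
    have "\<bar>pr u $ 1 * pr v $ 2 - pr v $ 1 * pr u $ 2\<bar> = \<bar>cross3 u v $ (if i = 1 then 2 else 1)\<bar>"
      using i by (auto simp: prc cross3_def vector_3 abs_minus_commute mult.commute)
    then show ?thesis using component_le_norm_cart by metis
  qed
  have inj: "inj_on (\<lambda>x. l *\<^sub>R f x) (\<Union>\<T>)"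
    using disk l unfolding ps_embedded_disk_def inj_on_def by simp
  have m: "infinite {x \<in> \<Union>\<T>. pr (f x) = p} \<or> m \<le> card {x \<in> \<Union>\<T>. pr (f x) = p}" if p: "p \<in> cbox A B" for p
  proof -
    have "a1 / l \<le> p $ 1" "p $ 1 \<le> b1 / l" "a2 / l \<le> p $ 2" "p $ 2 \<le> b2 / l"
      using p by (simp_all add: mem_box_cart forall_2 A_def B_def vector_2)
    then have r: "l * p $ 1 \<in> {a1..b1}" "l * p $ 2 \<in> {a2..b2}" using l by (simp_all add: field_simps)
    have im: "(\<lambda>x. l *\<^sub>R f x) ` {x \<in> \<Union>\<T>. pr (f x) = p} = {q \<in> (\<lambda>x. l *\<^sub>R f x) ` \<Union>\<T>. q $ i = l * p $ 1 \<and> q $ 3 = l * p $ 2}"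
      using l by (auto simp: vec_eq_iff[of _ p] forall_2 prc)
    have i: "inj_on (\<lambda>x. l *\<^sub>R f x) {x \<in> \<Union>\<T>. pr (f x) = p}" by (rule inj_on_subset[OF inj]) auto
    show ?thesis using mult[OF r] unfolding im[symmetric] finite_image_iff[OF i] card_image[OF i] .
  qed
  have ne: "cbox A B \<noteq> {}" unfolding interval_ne_empty_cart using ab l
    by (simp add: forall_2 A_def B_def vector_2 divide_right_mono)
  have "measure lebesgue (cbox A B) = (b1 - a1) * (b2 - a2) / l\<^sup>2"
    using content_cbox_cart[OF ne] by (simp add: UNIV_2 A_def B_def vector_2 power2_eq_square flip: diff_divide_distrib)
  then show ?thesis using ps_disk_area_ge[where S = "cbox A B" and m = m, OF disk lin det lmeasurable_cbox m] by simp
qed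

text \<open>Invariance of domain, applied to the map and to its inverse, matches the interiors; the
  boundaries are what remains.\<close>

lemma homeomorphism_cball_frontier:
  fixes S :: "'a::euclidean_space set" and h :: "'b::euclidean_space \<Rightarrow> 'a"
  assumes hom: "homeomorphism (cball 0 1) S h g" and dim: "DIM('a) = DIM('b)"
  shows "h ` sphere 0 1 = frontier S"
proof -
  have h: "continuous_on (cball 0 1) h" "h ` cball 0 1 = S" "inj_on h (cball 0 1)"
    and g: "continuous_on S g" "g ` S = cball 0 1" "inj_on g S"
    and hg: "\<And>y. y \<in> S \<Longrightarrow> h (g y) = y"
    using hom inj_on_inverseI[of "cball 0 1" g h] inj_on_inverseI[of S h g] by (auto simp: homeomorphism_def)
  have cS: "closed S" using compact_continuous_image[OF h(1) compact_cball] h(2) compact_imp_closed by blast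
  have "open (h ` ball 0 1)"
    using dim by (intro invariance_of_domain_gen continuous_on_subset[OF h(1)] inj_on_subset[OF h(3)]) auto
  then have a: "h ` ball 0 1 \<subseteq> interior S" using h(2) by (intro interior_maximal) (auto intro!: image_mono)
  have "open (g ` interior S)"
    using dim interior_subset by (intro invariance_of_domain_gen continuous_on_subset[OF g(1)] inj_on_subset[OF g(3)]) auto
  then have "g ` interior S \<subseteq> interior (cball 0 1)"
    using g(2) interior_subset[of S] by (intro interior_maximal) blast+
  then have "g ` interior S \<subseteq> ball 0 1" by simp
  then have b: "interior S \<subseteq> h ` ball 0 1" using hg interior_subset[of S] by (metis (no_types, lifting) image_eqI subsetD subsetI)
  have "frontier S = h ` cball 0 1 - h ` ball 0 1" using a b h(2) cS by (simp add: frontier_def closure_closed subset_antisym)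
  also have "\<dots> = h ` (cball 0 1 - ball 0 1)" using h(3) by (simp add: inj_on_image_set_diff[of _ "cball 0 1"] ball_subset_cball)
  also have "cball 0 1 - ball 0 1 = (sphere 0 1 :: 'b set)" by auto
  finally show ?thesis by simp
qed

text \<open>If some line of the first family meets the disk fewer than n times, every line of the
  second family meets it at least n times. The constant is the smaller of the two cross-sections,
  (2/1000)^2.\<close>

lemma (in twist) spanning_area:
  assumes l: "l > 0" and sp: "spans \<T> f ((\<lambda>p. p /\<^sub>R l) ` {p. FF p = 0})"
  shows "real n * (1 / (250000 * l\<^sup>2)) \<le> disk_area \<T> f"
proof -
  have disk: "ps_embedded_disk \<T> f" and bd: "f ` frontier (\<Union>\<T>) = (\<lambda>p. p /\<^sub>R l) ` {p. FF p = 0}"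
    using sp by (auto simp: spans_def disk_boundary_def)
  have S: "\<Union>\<T> homeomorphic cball (0::real^2) 1" "continuous_on (\<Union>\<T>) f" "inj_on f (\<Union>\<T>)"
    using disk by (auto simp: ps_embedded_disk_def)
  have "cball (0::real^2) 1 homeomorphic cball (0::complex) 1"
    by (intro homeomorphic_convex_compact_sets) (auto simp: aff_dim_cball)
  then have "cball (0::complex) 1 homeomorphic \<Union>\<T>" using S(1) homeomorphic_sym homeomorphic_trans by blast
  then obtain h g where hom: "homeomorphism (cball (0::complex) 1) (\<Union>\<T>) h g" by (auto simp: homeomorphic_def)
  have hs: "h ` sphere 0 1 = frontier (\<Union>\<T>)" by (rule homeomorphism_cball_frontier[OF hom]) simp
  have hc: "h ` cball 0 1 = \<Union>\<T>" "continuous_on (cball 0 1) h" "inj_on h (cball 0 1)"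
    using hom inj_on_inverseI[of "cball 0 1" g h] by (auto simp: homeomorphism_def)
  define k where "k x = l *\<^sub>R f (h x)" for x
  interpret twist_disk n d k
  proof unfold_locales
    show "continuous_on (cball 0 1) k"
      unfolding k_def by (intro continuous_intros continuous_on_compose2[OF S(2) hc(2)]) (use hc in auto)
    show "inj_on k (cball 0 1)"
    proof (rule inj_onI)
      fix x y assume xy: "x \<in> cball 0 1" "y \<in> cball 0 1" "k x = k y"
      then have "f (h x) = f (h y)" using l by (simp add: k_def)
      then have "h x = h y" using inj_onD[OF S(3)] hc(1) xy by blast
      then show "x = y" using inj_onD[OF hc(3)] xy by blast
    qed
    have "k ` sphere 0 1 = (\<lambda>p. l *\<^sub>R p) ` f ` h ` sphere 0 1" by (simp add: k_def image_image)
    also have "\<dots> = (\<lambda>p. l *\<^sub>R (p /\<^sub>R l)) ` {p. FF p = 0}" unfolding hs bd image_image ..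
    also have "\<dots> = {p. FF p = 0}" using l by simp
    finally show "k ` sphere 0 1 = {p. FF p = 0}" .
  qed
  have kD: "k ` cball 0 1 = (\<lambda>x. l *\<^sub>R f x) ` \<Union>\<T>" unfolding hc(1)[symmetric] by (simp add: k_def image_image)
  let ?D = "(\<lambda>x. l *\<^sub>R f x) ` \<Union>\<T>"
  show ?thesis
  proof (cases "\<forall>s\<in>{-1/100..1/100}. \<forall>t\<in>{1/50..1/25}. infinite {q \<in> ?D. q $ 2 = s \<and> q $ 3 = t} \<or> n \<le> card {q \<in> ?D. q $ 2 = s \<and> q $ 3 = t}")
    case True
    then have "real n * ((1/100 - (-1/100)) * (1/25 - 1/50) / l\<^sup>2) \<le> disk_area \<T> f"
      by (intro disk_area_projection[where i = 2, OF disk l]) auto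
    moreover have "real n * (1 / (250000 * l\<^sup>2)) \<le> real n * ((1/100 - (-1/100)) * (1/25 - 1/50) / l\<^sup>2)"
      using l by (intro mult_left_mono) (auto simp: field_simps)
    ultimately show ?thesis by linarith
  next
    case False
    then obtain s t where st: "s \<in> {-1/100..1/100}" "t \<in> {1/50..1/25}"
      "finite {q \<in> ?D. q $ 2 = s \<and> q $ 3 = t}" "card {q \<in> ?D. q $ 2 = s \<and> q $ 3 = t} < n" by (auto simp: not_le)
    have "infinite {q \<in> ?D. q $ 1 = u \<and> q $ 3 = v} \<or> n \<le> card {q \<in> ?D. q $ 1 = u \<and> q $ 3 = v}"
      if "u \<in> {-1/1000..1/1000}" "v \<in> {-1/1000..1/1000}" for u v
    proof (rule ccontr)
      assume a: "\<not> ?thesis"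
      have "2 * n \<le> card {q \<in> ?D. q $ 2 = s \<and> q $ 3 = t} + card {q \<in> ?D. q $ 1 = u \<and> q $ 3 = v}"
      proof (rule crossing_bound_lines[unfolded kD])
        show "\<bar>s\<bar> \<le> 1/100" "1/50 \<le> t" "t \<le> 1/25" "\<bar>u\<bar> \<le> 1/1000" "\<bar>v\<bar> \<le> 1/1000" using st(1,2) that by auto
      qed (use st(3) a in auto)
      then show False using st(4) a by linarith
    qed
    then have "real n * ((1/1000 - (-1/1000)) * (1/1000 - (-1/1000)) / l\<^sup>2) \<le> disk_area \<T> f"
      by (intro disk_area_projection[where i = 1, OF disk l]) auto
    then show ?thesis by (simp add: field_simps)
  qed
qed

theorem theorem1p3:
  shows "\<exists>(K0::real) (\<gamma> :: nat \<Rightarrow> real \<Rightarrow> real^3) (L :: nat \<Rightarrow> real). \<forall>n\<ge>1.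
    arclength_closed_curve (\<gamma> n) (L n) \<and>
    unknotted (range (\<gamma> n)) \<and>
    curve_length (\<gamma> n) (L n) = 1 \<and>
    (\<forall>t. curvature (\<gamma> n) t \<le> K0) \<and>
    (\<forall>\<T> f. spans \<T> f (range (\<gamma> n)) \<longrightarrow> disk_area \<T> f \<ge> real n)"
proof -
  obtain B where B: "B \<ge> 1" "jet_bound B tstep" "jet_bound B spread" using jet_bounds_exist by blast
  define K where "K = 3 * curve_jet_constant B"
  define lmax where "lmax = 2 * pi * K"
  have "\<exists>\<gamma>. arclength_closed_curve \<gamma> 1 \<and> unknotted (range \<gamma>) \<and> curve_length \<gamma> 1 = 1 \<and>
      (\<forall>t. curvature \<gamma> t \<le> 2 * lmax * K) \<and> (\<forall>\<T> f. spans \<T> f (range \<gamma>) \<longrightarrow> disk_area \<T> f \<ge> real n)" for n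
  proof -
    \<comment> \<open>The number of twists absorbs the constant of the area estimate and the upper
      bound \<open>lmax\<close> for the length, neither of which depends on n.\<close>
    define N where "N = Suc (nat \<lceil>250000 * lmax\<^sup>2 * real n\<rceil>)"
    \<comment> \<open>Makes d N^2 at most 1, as the curvature bound requires, and d at most
      1/100.\<close>
    define d where "d = 1 / (100 * (real N)\<^sup>2)"
    have "1 \<le> real N" by (simp only: N_def of_nat_Suc)
    then have N1: "1 \<le> (real N)\<^sup>2" by (rule one_le_power)
    interpret twist N d
    proof
      show "1 \<le> N" by (simp add: N_def)
      have "0 < 1 / (100 * q) \<and> 1 / (100 * q) \<le> 1/100" if "1 \<le> q" for q :: real using that by (simp add: divide_simps)
      then show "0 < d" "d \<le> 1/100" using N1 unfolding d_def by blast+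
    qed
    have dN: "d * (real N)\<^sup>2 \<le> 1" using N1 by (simp add: d_def)
    note b = jet2_vector_bounds[OF Cinf_on_curve curve_jets[OF B dN], folded K_def]
    obtain \<gamma> l where l: "2 * pi * 1 \<le> l" "l \<le> 2 * pi * K" and \<gamma>: "arclength_closed_curve \<gamma> 1"
      "range \<gamma> = (\<lambda>p. p /\<^sub>R l) ` range curve" "\<And>u. curvature \<gamma> u \<le> 2 * l * K / 1\<^sup>2"
      by (rule arclength_reparametrization[OF Cinf_on_curve _ curve_period curve_inj zero_less_one curve_speed b(1) b(2)])
         (simp, rule that)
    have l0: "l > 0" using l(1) pi_gt_zero by linarith
    have K0: "K \<ge> 0" using order_trans[OF norm_ge_zero b(1)] .
    have lm: "l \<le> lmax" using l(2) by (simp add: lmax_def)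
    have "curve_length \<gamma> 1 = 1" using \<gamma>(1) by (simp add: curve_length_def arclength_closed_curve_def)
    moreover have "curvature \<gamma> t \<le> 2 * lmax * K" for t
    proof -
      have "2 * l * K \<le> 2 * lmax * K" using lm K0 by (intro mult_right_mono) auto
      then show ?thesis using \<gamma>(3)[of t] by simp
    qed
    moreover have "unknotted (range \<gamma>)" unfolding \<gamma>(2) curve_range using curve_unknotted[OF l0] .
    moreover have "disk_area \<T> f \<ge> real n" if sp: "spans \<T> f (range \<gamma>)" for \<T> f
    proof -
      have "l\<^sup>2 \<le> lmax\<^sup>2" using lm l0 by (intro power_mono) auto
      then have "250000 * l\<^sup>2 * real n \<le> 250000 * lmax\<^sup>2 * real n" by (intro mult_right_mono) auto
      also have "\<dots> \<le> real N" unfolding N_def by linarith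
      finally have "real n \<le> real N * (1 / (250000 * l\<^sup>2))" using l0 by (simp add: field_simps)
      then show ?thesis using spanning_area[OF l0 sp[unfolded \<gamma>(2) curve_range]] by linarith
    qed
    ultimately show ?thesis using \<gamma>(1) by blast
  qed
  then obtain \<gamma> where "\<forall>n. arclength_closed_curve (\<gamma> n) 1 \<and> unknotted (range (\<gamma> n)) \<and> curve_length (\<gamma> n) 1 = 1 \<and>
      (\<forall>t. curvature (\<gamma> n) t \<le> 2 * lmax * K) \<and> (\<forall>\<T> f. spans \<T> f (range (\<gamma> n)) \<longrightarrow> disk_area \<T> f \<ge> real n)"
    by metis
  then show ?thesis by (intro exI[of _ "2 * lmax * K"] exI[of _ \<gamma>] exI[of _ "\<lambda>_. 1"]) blast
qed

end
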